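(* Let $n\ge 3$, $R>0$, and let $B=\{x\in\mathbb{R}^n:|x|<R\}$ with boundary sphere $\partial B$. Let $f$ be an infinitely differentiable function on $\mathbb{R}^n$ with $\operatorname{supp} f\subset B$. For $\xi\in\partial B$ and $t>0$ let $$(Mf)(\xi,t)=\frac{1}{\sigma_{n-1}}\int_{S^{n-1}} f(\xi-t\theta)\,d\theta ,$$ and let $D=\frac{1}{2t}\frac{d}{dt}$ act in the variable $t$. Then for every $x\in B$: (i) if $n=3,5,7,\dots$, $$f(x)=d_{n,1}\,\Delta\int_{\partial B} D^{n-3}\big[t^{n-2}(Mf)(\xi,t)\big]\Big|_{t=|x-\xi|}\,d\xi,\qquad d_{n,1}=\frac{(-1)^{(n-1)/2}\pi^{1-n/2}}{4R\,\Gamma(n/2)};$$ (ii) if $n=4,6,8,\dots$, $$f(x)=d_{n,2}\,\Delta\int_{\partial B}d\xi\int_0^{2R} t\,D^{n-2}\big[t^{n-2}(Mf)(\xi,t)\big]\log\big|t^2-|x-\xi|^2\big|\,dt,\qquad d_{n,2}=\frac{(-1)^{n/2-1}\pi^{-n/2}}{2R\,(n/2-1)!}.$$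
   Context: $S^{n-1}$ is the unit sphere in $\mathbb{R}^n$, $d\theta$ its surface measure, $\sigma_{n-1}=2\pi^{n/2}/\Gamma(n/2)$ its area; $d\xi$ is the surface measure on the sphere $\partial B$; $\Delta$ is the Laplacian in $x$. In (ii) the inner integral is a Lebesgue integral in $t$. *)

theory Defs
  imports "HOL-Analysis.Analysis"
begin

definition tsupp :: "('a::topological_space \<Rightarrow> real) \<Rightarrow> 'a set" where
  "tsupp g = closure {x. g x \<noteq> 0}"

fun Ck :: "nat \<Rightarrow> ('a::euclidean_space \<Rightarrow> real) \<Rightarrow> bool" where
  "Ck 0 g = continuous_on UNIV g"
| "Ck (Suc k) g = (g differentiable_on UNIV \<and>
      (\<forall>v. Ck k (\<lambda>x. frechet_derivative g (at x) v)))"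

definition C_infinity :: "('a::euclidean_space \<Rightarrow> real) \<Rightarrow> bool" where
  "C_infinity g = (\<forall>k. Ck k g)"

text \<open>Surface measure on the sphere of centre c and radius r, defined through
  the cone (polar-coordinate) construction: the surface measure of A \<subseteq> S^{n-1}
  equals n times the Lebesgue measure of {x : 0<|x|<1, x/|x| \<in> A}; for the sphere of
  radius r one pushes forward by \<theta> \<mapsto> c + r\<theta> and multiplies by r^(n-1).\<close>
definition sphere_surface :: "'a::euclidean_space \<Rightarrow> real \<Rightarrow> 'a measure" where
  "sphere_surface c r =
     density (distr (restrict_space lborel (ball 0 1 - {0})) borel (\<lambda>x. c + r *\<^sub>R sgn x))
             (\<lambda>_. ennreal (real DIM('a) * r ^ (DIM('a) - 1)))"

definition sigma_area :: "nat \<Rightarrow> real" where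
  "sigma_area n = 2 * pi powr (real n / 2) / Gamma (real n / 2)"

definition sph_mean :: "('a::euclidean_space \<Rightarrow> real) \<Rightarrow> 'a \<Rightarrow> real \<Rightarrow> real" where
  "sph_mean f \<xi> t =
     (1 / sigma_area DIM('a)) * (\<integral>\<theta>. f (\<xi> - t *\<^sub>R \<theta>) \<partial>sphere_surface 0 1)"

definition Dop :: "(real \<Rightarrow> real) \<Rightarrow> real \<Rightarrow> real" where
  "Dop h = (\<lambda>t. deriv h t / (2 * t))"

definition laplacian :: "('a::euclidean_space \<Rightarrow> real) \<Rightarrow> 'a \<Rightarrow> real" where
  "laplacian g x = (\<Sum>i\<in>Basis. deriv (deriv (\<lambda>s. g (x + s *\<^sub>R i))) 0)"

end

theory Submission
  imports Defs
begin

text \<open>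
  Write \<open>\<tau> = |x - \<xi>|\<^sup>2\<close>. In the variable \<open>t\<^sup>2\<close> the operator \<open>D\<close> is the ordinary derivative, so integrating
  \<open>\<integral> 2 t D\<^bsup>n-2\<^esup>[t\<^bsup>n-2\<^esup> M f] Ln (\<tau> - t\<^sup>2 + \<i> \<epsilon>) dt\<close> by parts and passing from polar to Cartesian coordinates
  gives a multiple of \<open>\<integral> f(y) (|x - \<xi>|\<^sup>2 - |y - \<xi>|\<^sup>2 + \<i> \<epsilon>)\<^bsup>2-n\<^esup> dy\<close>. As \<open>\<epsilon> \<rightarrow> 0\<close>, the imaginary part of the left side
  tends to the integrand of the odd formula and the real part to that of the even formula.

  On \<open>|\<xi>| = R\<close> the base of the power is affine in \<open>\<xi>\<close>, so integrating over \<open>\<xi>\<close> leads to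
  \<open>\<Phi>(z) = \<integral> (z - \<theta> \<bullet> e)\<^bsup>2-n\<^esup> d\<theta>\<close> with \<open>z\<close> near the real interval \<open>(-1, 1)\<close>. A divergence identity on the sphere
  yields \<open>\<Phi>'(z) = const (1 - z\<^sup>2)\<^bsup>-(n-1)/2\<^esup>\<close> in closed form; on \<open>(-1, 1)\<close> this is \<open>\<i>\<^bsup>n-1\<^esup>\<close> times a real function, hence the
  relevant (real or imaginary) part of \<open>\<Phi>\<close> has constant boundary values. So both backprojections are
  constant multiples of the Newtonian potential of \<open>f\<close>, which the Laplacian turns into a multiple of \<open>f\<close>.
\<close>

section \<open>Polar coordinates\<close>

text \<open>The unregularised power of |x - xi|^2 - |y - xi|^2 is not absolutely integrable across
  its zero set on the sphere, so Fubini cannot be applied to it. For fixed positive epsilon all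
  integrands are tame and the chain of identities is exact; limits are taken only at its two ends,
  where the singularities are mild: a logarithm on the side of the spherical means, the Newtonian
  kernel on the side of f. The parity of n enters only through the phase i (-i)^(n-1), which is
  imaginary for odd n and real for even n, and through the sign (-1)^(n-3). The gap between the
  support radius r and R is used twice. It makes the means vanish for small t, so that negative
  powers of t do no harm, and it keeps the real part of the kernel's argument in a compact part of
  (-1, 1), away from the zeros of 1 - z^2. The boundary constant is found by descending the
  imaginary axis from infinity, where the kernel vanishes; this gives the integral of (1 +
  u^2)^(-(n-1)/2) over u > 0, a beta integral. The duplication formula for Gamma then yields both
  constants of the theorem from a single identity.\<close>

lemma borel_measurable_sgn_euclidean [measurable]:
  "(sgn :: 'a::euclidean_space \<Rightarrow> 'a) \<in> borel_measurable borel"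
  unfolding sgn_div_norm[abs_def] by measurable

lemma sets_sphere_surface [measurable_cong, simp]: "sets (sphere_surface c r) = sets borel"
  by (simp add: sphere_surface_def)

lemma space_sphere_surface [simp]: "space (sphere_surface c r) = UNIV"
  by (simp add: sphere_surface_def)

text \<open>For integrals the cone definition is unfolded only here: a sphere integral is an
  integral of the radially constant extension over the solid unit ball. All later facts about sphere
  integrals rest on this formula.\<close>

lemma nn_integral_sphere_surface:
  fixes F :: "'a::euclidean_space \<Rightarrow> ennreal"
  assumes [measurable]: "F \<in> borel_measurable borel"
  shows "(\<integral>\<^sup>+\<xi>. F \<xi> \<partial>sphere_surface c r) = ennreal (real DIM('a) * r ^ (DIM('a) - 1)) *
    (\<integral>\<^sup>+x. F (c + r *\<^sub>R sgn x) * indicator (ball 0 1 - {0}) x \<partial>lborel)"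
proof -
  have [measurable]: "(\<lambda>x. c + r *\<^sub>R sgn x) \<in> restrict_space lborel (ball 0 1 - {0}) \<rightarrow>\<^sub>M borel"
    by (intro measurable_restrict_space1) measurable
  show ?thesis
    unfolding sphere_surface_def
    by (simp add: nn_integral_density nn_integral_distr nn_integral_cmult nn_integral_restrict_space)
qed

lemma nn_integral_lborel_scale:
  fixes F :: "'a::euclidean_space \<Rightarrow> ennreal"
  assumes [measurable]: "F \<in> borel_measurable borel" and "c \<noteq> 0"
  shows "(\<integral>\<^sup>+x. F x \<partial>lborel) = ennreal (\<bar>c\<bar> ^ DIM('a)) * (\<integral>\<^sup>+x. F (t + c *\<^sub>R x) \<partial>lborel)"
  by (subst lborel_affine[OF \<open>c \<noteq> 0\<close>, of t])
     (simp add: nn_integral_density nn_integral_distr nn_integral_cmult)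

text \<open>This probability density in an auxiliary radius is what \<open>nn_integral_polar\<close>
  has left over after its substitutions, and it integrates away there.\<close>

lemma nn_integral_inverse_power_tail:
  fixes a :: real
  assumes "a > 0" "n \<ge> 1"
  shows "(\<integral>\<^sup>+r. ennreal (real n * a ^ n / r ^ (n + 1)) * indicator {a<..} r \<partial>lborel) = 1"
proof -
  have "(\<integral>\<^sup>+r. ennreal (real n * a ^ n / r ^ (n + 1)) * indicator {a<..} r \<partial>lborel)
      = (\<integral>\<^sup>+r. ennreal (real n * a ^ n / r ^ (n + 1)) * indicator {a..} r \<partial>lborel)"
    by (intro nn_integral_cong_AE eventually_mono[OF AE_lborel_singleton[of a]])
       (auto simp: indicator_def)
  also have "\<dots> = ennreal (0 - (- (a ^ n / a ^ n)))"
  proof (rule nn_integral_FTC_atLeast[where F = "\<lambda>r. - (a ^ n / r ^ n)" and T = 0])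
    show "DERIV (\<lambda>r. - (a ^ n / r ^ n)) x :> real n * a ^ n / x ^ (n + 1)" if "a \<le> x" for x
    proof -
      obtain m where n: "n = Suc m" using assms by (cases n) auto
      show ?thesis using that assms
        by (auto intro!: derivative_eq_intros simp: n field_simps power2_eq_square)
           (metis One_nat_def Suc_pred' bot_nat_0.not_eq_extremum power_Suc)
    qed
    show "((\<lambda>r. - (a ^ n / r ^ n)) \<longlongrightarrow> 0) at_top"
    proof -
      have "((\<lambda>r. - (a ^ n / r ^ n)) \<longlongrightarrow> - 0) at_top"
        by (intro tendsto_minus real_tendsto_divide_at_top[OF tendsto_const] filterlim_pow_at_top)
           (use assms in \<open>auto simp: filterlim_ident\<close>)
      then show ?thesis by simp
    qed
  qed (use assms in auto)
  finally show ?thesis using assms by simp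
qed

text \<open>By the cone definition the right side is a double integral over t and a point x of the
  unit ball. Substituting t = |x| r turns t sgn x into r x; after exchanging the order, y = r x
  leaves F(y) times the density n |y|^n / r^(n+1) on r > |y|, whose integral in r is 1. Only
  scalings and Tonelli's theorem enter.\<close>

lemma nn_integral_polar:
  fixes F :: "'a::euclidean_space \<Rightarrow> ennreal"
  assumes [measurable]: "F \<in> borel_measurable borel"
  shows "(\<integral>\<^sup>+x. F x \<partial>lborel) = (\<integral>\<^sup>+t. ennreal (t ^ (DIM('a) - 1)) * indicator {0<..} t *
    (\<integral>\<^sup>+\<theta>. F (t *\<^sub>R \<theta>) \<partial>sphere_surface 0 1) \<partial>lborel)"
proof -
  define n where "n = DIM('a)"
  have n: "n \<ge> 1" by (simp add: n_def Suc_leI)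
  define P :: "'a \<Rightarrow> ennreal" where "P = indicator (ball 0 1 - {0})"
  have [measurable]: "P \<in> borel_measurable borel" 
    unfolding P_def by (intro borel_measurable_indicator borel_open) (simp add: open_delete)
  have "(\<integral>\<^sup>+t. ennreal (t ^ (n - 1)) * indicator {0<..} t * (\<integral>\<^sup>+\<theta>. F (t *\<^sub>R \<theta>) \<partial>sphere_surface 0 1) \<partial>lborel)
      = (\<integral>\<^sup>+t. (\<integral>\<^sup>+x. ennreal n * P x * (ennreal (t ^ (n - 1)) * indicator {0<..} t * F (t *\<^sub>R sgn x)) \<partial>lborel) \<partial>lborel)"
  proof (rule nn_integral_cong)
    fix t :: real
    have "(\<integral>\<^sup>+x. ennreal n * P x * (ennreal (t ^ (n - 1)) * indicator {0<..} t * F (t *\<^sub>R sgn x)) \<partial>lborel)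
      = (\<integral>\<^sup>+x. (ennreal n * (ennreal (t ^ (n - 1)) * indicator {0<..} t)) * (F (t *\<^sub>R sgn x) * P x) \<partial>lborel)"
      by (simp add: mult_ac)
    also have "\<dots> = (ennreal n * (ennreal (t ^ (n - 1)) * indicator {0<..} t)) * (\<integral>\<^sup>+x. (F (t *\<^sub>R sgn x) * P x) \<partial>lborel)"
      by (rule nn_integral_cmult) measurable
    finally show "ennreal (t ^ (n - 1)) * indicator {0<..} t * (\<integral>\<^sup>+\<theta>. F (t *\<^sub>R \<theta>) \<partial>sphere_surface 0 1)
      = (\<integral>\<^sup>+x. ennreal n * P x * (ennreal (t ^ (n - 1)) * indicator {0<..} t * F (t *\<^sub>R sgn x)) \<partial>lborel)"
      by (simp add: nn_integral_sphere_surface n_def P_def mult_ac)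
  qed
  also have "\<dots> = (\<integral>\<^sup>+x. (\<integral>\<^sup>+t. ennreal n * P x * (ennreal (t ^ (n - 1)) * indicator {0<..} t * F (t *\<^sub>R sgn x)) \<partial>lborel) \<partial>lborel)"
    by (rule lborel_pair.Fubini') measurable
  also have "\<dots> = (\<integral>\<^sup>+x. (\<integral>\<^sup>+r. ennreal n * P x * ennreal (norm x ^ n) * (ennreal (r ^ (n - 1)) * indicator {0<..} r * F (r *\<^sub>R x)) \<partial>lborel) \<partial>lborel)"
  proof (rule nn_integral_cong)
    fix x :: 'a
    show "(\<integral>\<^sup>+t. ennreal n * P x * (ennreal (t ^ (n - 1)) * indicator {0<..} t * F (t *\<^sub>R sgn x)) \<partial>lborel)
      = (\<integral>\<^sup>+r. ennreal n * P x * ennreal (norm x ^ n) * (ennreal (r ^ (n - 1)) * indicator {0<..} r * F (r *\<^sub>R x)) \<partial>lborel)"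
    proof (cases "x = 0")
      case False
      then have nx: "norm x > 0" by simp
      have "(\<integral>\<^sup>+t. (ennreal (t ^ (n - 1)) * indicator {0<..} t * F (t *\<^sub>R sgn x)) \<partial>lborel)
        = ennreal (norm x) * (\<integral>\<^sup>+r. (ennreal ((norm x * r) ^ (n - 1)) * indicator {0<..} (norm x * r) * F ((norm x * r) *\<^sub>R sgn x)) \<partial>lborel)"
        using nx by (subst nn_integral_real_affine[where t=0 and c="norm x"]) auto
      also have "\<dots> = (\<integral>\<^sup>+r. ennreal (norm x) * (ennreal ((norm x * r) ^ (n - 1)) * indicator {0<..} (norm x * r) * F ((norm x * r) *\<^sub>R sgn x)) \<partial>lborel)"
        by (rule nn_integral_cmult[symmetric]) measurable
      also have "\<dots> = (\<integral>\<^sup>+r. ennreal (norm x ^ n) * (ennreal (r ^ (n - 1)) * indicator {0<..} r * F (r *\<^sub>R x)) \<partial>lborel)"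
      proof (rule nn_integral_cong)
        fix r :: real
        have 1: "(norm x * r) *\<^sub>R sgn x = r *\<^sub>R x" using nx by (simp add: sgn_div_norm)
        have 2: "norm x * norm x ^ (n - 1) = norm x ^ n" using n
          by (metis Suc_diff_1 less_le_trans power_Suc zero_less_one)
        have 3: "ennreal (norm x) * ennreal ((norm x * r) ^ (n - 1)) = ennreal (norm x ^ n) * ennreal (r ^ (n - 1))" if "r > 0"
          using that by (simp add: ennreal_mult[symmetric] power_mult_distrib 2[symmetric] mult_ac)
        show "ennreal (norm x) * (ennreal ((norm x * r) ^ (n - 1)) * indicator {0<..} (norm x * r) * F ((norm x * r) *\<^sub>R sgn x))
          = ennreal (norm x ^ n) * (ennreal (r ^ (n - 1)) * indicator {0<..} r * F (r *\<^sub>R x))"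
          unfolding 1 using 3 nx by (cases "r > 0") (auto simp: mult.assoc[symmetric] zero_less_mult_iff)
      qed
      finally show ?thesis by (simp add: nn_integral_cmult mult.assoc)
    qed (simp add: P_def)
  qed
  also have "\<dots> = (\<integral>\<^sup>+r. (\<integral>\<^sup>+x. ennreal n * P x * ennreal (norm x ^ n) * (ennreal (r ^ (n - 1)) * indicator {0<..} r * F (r *\<^sub>R x)) \<partial>lborel) \<partial>lborel)"
    by (rule lborel_pair.Fubini'[symmetric]) measurable
  also have "\<dots> = (\<integral>\<^sup>+r. (\<integral>\<^sup>+y. F y * (ennreal (real n * norm y ^ n / r ^ (n + 1)) * indicator {norm y<..} r * indicator (- {0}) y) \<partial>lborel) \<partial>lborel)"
  proof (rule nn_integral_cong)
    fix r :: real
    show "(\<integral>\<^sup>+x. ennreal n * P x * ennreal (norm x ^ n) * (ennreal (r ^ (n - 1)) * indicator {0<..} r * F (r *\<^sub>R x)) \<partial>lborel)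
       = (\<integral>\<^sup>+y. F y * (ennreal (real n * norm y ^ n / r ^ (n + 1)) * indicator {norm y<..} r * indicator (- {0}) y) \<partial>lborel)"
    proof (cases "r > 0")
      case True
      have "(\<integral>\<^sup>+y. F y * (ennreal (real n * norm y ^ n / r ^ (n + 1)) * indicator {norm y<..} r * indicator (- {0}) y) \<partial>lborel)
        = ennreal (\<bar>r\<bar> ^ n) * (\<integral>\<^sup>+y. F (r *\<^sub>R y) * (ennreal (real n * norm (r *\<^sub>R y) ^ n / r ^ (n + 1)) * indicator {norm (r *\<^sub>R y)<..} r * indicator (- {0}) (r *\<^sub>R y)) \<partial>lborel)"
        unfolding n_def using True by (subst nn_integral_lborel_scale[where t=0 and c=r]) (auto simp: indicator_def)
      also have "\<dots> = (\<integral>\<^sup>+y. ennreal (\<bar>r\<bar> ^ n) * (F (r *\<^sub>R y) * (ennreal (real n * norm (r *\<^sub>R y) ^ n / r ^ (n + 1)) * indicator {norm (r *\<^sub>R y)<..} r * indicator (- {0}) (r *\<^sub>R y))) \<partial>lborel)"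
        by (rule nn_integral_cmult[symmetric]) (measurable, auto simp: indicator_def)
      also have "\<dots> = (\<integral>\<^sup>+x. ennreal n * P x * ennreal (norm x ^ n) * (ennreal (r ^ (n - 1)) * indicator {0<..} r * F (r *\<^sub>R x)) \<partial>lborel)"
      proof (rule nn_integral_cong)
        fix y :: 'a
        have "\<bar>r\<bar> ^ n * (real n * norm (r *\<^sub>R y) ^ n / r ^ (n + 1)) = n * norm y ^ n * r ^ (n - 1)"
        proof -
          obtain m where "n = Suc m" using n by (cases n) auto
          then show ?thesis using True by (simp add: power_mult_distrib)
        qed
        then have 1: "ennreal (\<bar>r\<bar> ^ n) * ennreal (real n * norm (r *\<^sub>R y) ^ n / r ^ (n + 1)) = ennreal n * ennreal (norm y ^ n) * ennreal (r ^ (n - 1))"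
          using True by (simp add: ennreal_mult[symmetric])
        have 2: "indicator {norm (r *\<^sub>R y)<..} r * indicator (- {0}) (r *\<^sub>R y) = P y"
          using True by (auto simp: P_def indicator_def)
        have rearrange: "a * (F' * (b * i * j)) = (a * b) * (i * j) * F'" for a b i j F' :: ennreal
          by (simp only: mult_ac)
        show "ennreal (\<bar>r\<bar> ^ n) * (F (r *\<^sub>R y) * (ennreal (real n * norm (r *\<^sub>R y) ^ n / r ^ (n + 1)) * indicator {norm (r *\<^sub>R y)<..} r * indicator (- {0}) (r *\<^sub>R y)))
          = ennreal n * P y * ennreal (norm y ^ n) * (ennreal (r ^ (n - 1)) * indicator {0<..} r * F (r *\<^sub>R y))"
          unfolding rearrange 1 2 using True by (simp add: mult_ac)
      qed
      finally show ?thesis by simp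
    next
      case False
      then have "indicator {norm y<..} r = (0::ennreal)" for y :: 'a
        by (simp add: indicator_def) (meson norm_ge_zero order.strict_trans1)
      with False show ?thesis by simp
    qed
  qed
  also have "\<dots> = (\<integral>\<^sup>+y. (\<integral>\<^sup>+r. F y * (ennreal (real n * norm y ^ n / r ^ (n + 1)) * indicator {norm y<..} r * indicator (- {0}) y) \<partial>lborel) \<partial>lborel)"
  proof (rule lborel_pair.Fubini')
    have [measurable]: "Measurable.pred (borel \<Otimes>\<^sub>M borel) (\<lambda>x::'a \<times> real. snd x \<in> {norm (fst x)<..})"
      by simp
    show "(\<lambda>(y, r). F y * (ennreal (real n * norm y ^ n / r ^ (n + 1)) * indicator {norm y<..} r * indicator (- {0}) y)) \<in> borel_measurable (lborel \<Otimes>\<^sub>M lborel)"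
      unfolding indicator_def by measurable
  qed
  also have "\<dots> = (\<integral>\<^sup>+y. F y \<partial>lborel)"
  proof (intro nn_integral_cong_AE eventually_mono[OF AE_lborel_singleton[of 0]])
    fix y :: 'a assume "y \<noteq> 0"
    have "(\<integral>\<^sup>+r. F y * (ennreal (real n * norm y ^ n / r ^ (n + 1)) * indicator {norm y<..} r) \<partial>lborel) = F y * 1"
      using \<open>y \<noteq> 0\<close> n nn_integral_inverse_power_tail[of "norm y" n]
      by (subst nn_integral_cmult) auto
    then show "(\<integral>\<^sup>+r. F y * (ennreal (real n * norm y ^ n / r ^ (n + 1)) * indicator {norm y<..} r * indicator (- {0}) y) \<partial>lborel) = F y"
      using \<open>y \<noteq> 0\<close> by simp
  qed
  finally show ?thesis by (simp add: n_def)
qed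

lemma nn_integral_sphere_surface_scale:
  fixes F :: "'a::euclidean_space \<Rightarrow> ennreal"
  assumes [measurable]: "F \<in> borel_measurable borel" and "r \<ge> 0"
  shows "(\<integral>\<^sup>+\<xi>. F \<xi> \<partial>sphere_surface 0 r) =
    ennreal (r ^ (DIM('a) - 1)) * (\<integral>\<^sup>+\<theta>. F (r *\<^sub>R \<theta>) \<partial>sphere_surface 0 1)"
  using assms(2) by (simp add: nn_integral_sphere_surface ennreal_mult mult_ac)

lemma sphere_surface_eq_distr:
  assumes "r \<ge> 0"
  shows "(sphere_surface 0 r :: 'a::euclidean_space measure) =
    density (distr (sphere_surface 0 1) borel (\<lambda>\<theta>. r *\<^sub>R \<theta>)) (\<lambda>_. ennreal (r ^ (DIM('a) - 1)))"
proof (rule measure_eqI)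
  fix A :: "'a set" assume "A \<in> sets (sphere_surface 0 r)"
  then have A[measurable]: "A \<in> sets borel" by simp
  show "emeasure (sphere_surface 0 r) A = emeasure (density (distr (sphere_surface 0 1) borel (\<lambda>\<theta>. r *\<^sub>R \<theta>)) (\<lambda>_. ennreal (r ^ (DIM('a) - 1)))) A"
    using nn_integral_sphere_surface_scale[of "indicator A" r] assms
    by (simp add: emeasure_density nn_integral_cmult nn_integral_distr del: nn_integral_indicator
        flip: nn_integral_indicator[of A "sphere_surface 0 r"])
qed simp

lemma integral_sphere_surface_scale:
  fixes F :: "'a::euclidean_space \<Rightarrow> 'b::{banach, second_countable_topology}"
  assumes [measurable]: "F \<in> borel_measurable borel" and "r \<ge> 0"
  shows "(\<integral>\<xi>. F \<xi> \<partial>sphere_surface 0 r) = r ^ (DIM('a) - 1) *\<^sub>R (\<integral>\<theta>. F (r *\<^sub>R \<theta>) \<partial>sphere_surface 0 1)"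
  using assms(2) by (simp add: sphere_surface_eq_distr[OF assms(2)] integral_density integral_distr)

lemma sigma_area_pos: "n \<ge> 1 \<Longrightarrow> sigma_area n > 0"
  by (simp add: sigma_area_def Gamma_real_pos)

text \<open>The cone normalisation gives n times the volume of the unit ball; Gamma(n/2 + 1) = (n/2)
  Gamma(n/2) reconciles this with the formula in \<open>sigma_area\<close>.\<close>

lemma emeasure_sphere_surface_1:
  "emeasure (sphere_surface 0 1 :: 'a::euclidean_space measure) UNIV = ennreal (sigma_area DIM('a))"
proof -
  let ?n = "DIM('a)"
  have "(\<integral>\<^sup>+x. indicator (ball 0 1 - {0}) x \<partial>(lborel :: 'a measure)) = emeasure lborel (ball (0::'a) 1 - {0})"
    by (rule nn_integral_indicator) simp
  also have "\<dots> = ennreal (unit_ball_vol ?n)"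
    by (subst emeasure_Diff_null_set) (auto simp: emeasure_ball)
  finally have "emeasure (sphere_surface 0 1 :: 'a measure) UNIV = ennreal ?n * ennreal (unit_ball_vol ?n)"
    using nn_integral_sphere_surface[of "\<lambda>_. 1" "0::'a" 1] by simp
  also have "\<dots> = ennreal (sigma_area ?n)"
  proof -
    have *: "Gamma (real ?n / 2 + 1) = real ?n / 2 * Gamma (real ?n / 2)"
      using nonpos_Ints_nonpos[of "real ?n / 2"] by (intro Gamma_plus1) auto
    have "real ?n * unit_ball_vol ?n = sigma_area ?n"
      unfolding unit_ball_vol_def sigma_area_def * by simp
    then show ?thesis
      by (simp add: ennreal_mult[symmetric])
  qed
  finally show ?thesis .
qed

lemma finite_measure_sphere_surface: "r \<ge> 0 \<Longrightarrow> finite_measure (sphere_surface 0 r)"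
  by (rule finite_measureI, subst sphere_surface_eq_distr)
     (simp_all add: emeasure_density nn_integral_cmult emeasure_distr
        emeasure_sphere_surface_1 ennreal_mult_eq_top_iff)

interpretation unit_sphere: finite_measure "sphere_surface 0 1"
  by (rule finite_measure_sphere_surface) simp

lemma measure_sphere_surface_1: "measure (sphere_surface 0 1 :: 'a::euclidean_space measure) UNIV = sigma_area DIM('a)"
  using sigma_area_pos[of "DIM('a)"] by (simp add: measure_def emeasure_sphere_surface_1 Suc_leI less_imp_le)

text \<open>The surface measure is a Borel measure on the whole space, so the constraint of lying on
  the sphere is available only almost everywhere; this is how it enters every later
  estimate.\<close>

lemma AE_sphere_surface: "r \<ge> 0 \<Longrightarrow> AE \<xi>::'a::euclidean_space in sphere_surface 0 r. norm \<xi> = r"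
proof -
  assume r: "r \<ge> 0"
  have "(\<integral>\<^sup>+\<xi>. indicator {\<xi>::'a. norm \<xi> \<noteq> r} \<xi> \<partial>sphere_surface 0 r) = ennreal (real DIM('a) * r ^ (DIM('a) - 1)) *
    (\<integral>\<^sup>+x. indicator {\<xi>::'a. norm \<xi> \<noteq> r} (0 + r *\<^sub>R sgn x) * indicator (ball 0 1 - {0}) x \<partial>lborel)"
    by (rule nn_integral_sphere_surface) simp
  also have "(\<lambda>x. indicator {\<xi>::'a. norm \<xi> \<noteq> r} (0 + r *\<^sub>R sgn x) * indicator (ball 0 1 - {0}) x) = (\<lambda>x. 0 :: ennreal)"
    using r by (auto simp: fun_eq_iff norm_sgn indicator_def)
  finally have "AE \<xi> in sphere_surface 0 r. indicator {\<xi>::'a. norm \<xi> \<noteq> r} \<xi> = (0::ennreal)"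
    by (subst nn_integral_0_iff_AE[symmetric]) simp_all
  then show ?thesis
    by (rule eventually_mono) (auto simp: indicator_def split: if_splits)
qed

section \<open>Lebesgue measure as the image of a product of radius and direction\<close>

definition radial_measure :: "nat \<Rightarrow> real measure" where
  "radial_measure n = density lborel (\<lambda>t. ennreal (indicator {0<..} t * t ^ (n - 1)))"

lemma sets_radial_measure [measurable_cong, simp]: "sets (radial_measure n) = sets borel"
  by (simp add: radial_measure_def)

lemma sigma_finite_radial_measure: "sigma_finite_measure (radial_measure n)"
  unfolding radial_measure_def
  by (subst sigma_finite_measure.sigma_finite_iff_density_finite[OF sigma_finite_lborel]) auto

text \<open>An equality of measures carries the nonnegative formula over to Bochner integrals with
  vector values and makes both orders of iteration available.\<close>

lemma lborel_eq_polar: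
  "(lborel :: 'a::euclidean_space measure) =
    distr (radial_measure DIM('a) \<Otimes>\<^sub>M sphere_surface 0 1) borel (\<lambda>(t, \<theta>). t *\<^sub>R \<theta>)"
proof (rule measure_eqI)
  fix A :: "'a set" assume "A \<in> sets lborel"
  then have A[measurable]: "A \<in> sets borel" by simp
  have "emeasure (distr (radial_measure DIM('a) \<Otimes>\<^sub>M sphere_surface 0 1) borel (\<lambda>(t, \<theta>). t *\<^sub>R \<theta>)) A
    = (\<integral>\<^sup>+x. indicator A x \<partial>distr (radial_measure DIM('a) \<Otimes>\<^sub>M sphere_surface 0 1) borel (\<lambda>(t, \<theta>). t *\<^sub>R \<theta>))"
    by simp
  also have "\<dots> = (\<integral>\<^sup>+p. indicator A (fst p *\<^sub>R snd p) \<partial>(radial_measure DIM('a) \<Otimes>\<^sub>M sphere_surface 0 1))"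
    by (subst nn_integral_distr) (auto simp: case_prod_unfold)
  also have "\<dots> = (\<integral>\<^sup>+t. (\<integral>\<^sup>+\<theta>. indicator A (t *\<^sub>R \<theta>) \<partial>sphere_surface 0 1) \<partial>radial_measure DIM('a))"
    by (subst unit_sphere.nn_integral_fst[symmetric]) auto
  also have "\<dots> = (\<integral>\<^sup>+t. ennreal (t ^ (DIM('a) - 1)) * indicator {0<..} t *
    (\<integral>\<^sup>+\<theta>. indicator A (t *\<^sub>R \<theta>) \<partial>sphere_surface 0 1) \<partial>lborel)"
    unfolding radial_measure_def
    by (subst nn_integral_density) (auto intro!: nn_integral_cong simp: indicator_def)
  also have "\<dots> = emeasure lborel A"
    using nn_integral_polar[of "indicator A :: 'a \<Rightarrow> ennreal"] by simp
  finally show "emeasure lborel A = emeasure (distr (radial_measure DIM('a) \<Otimes>\<^sub>M sphere_surface 0 1) borel (\<lambda>(t, \<theta>). t *\<^sub>R \<theta>)) A"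
    by simp
qed simp

lemma integrable_polar_iff:
  fixes F :: "'a::euclidean_space \<Rightarrow> 'b::{banach, second_countable_topology}"
  assumes [measurable]: "F \<in> borel_measurable borel"
  shows "integrable lborel F \<longleftrightarrow>
    integrable (radial_measure DIM('a) \<Otimes>\<^sub>M sphere_surface 0 1) (\<lambda>(t, \<theta>). F (t *\<^sub>R \<theta>))"
proof -
  have "integrable lborel F \<longleftrightarrow>
    integrable (distr (radial_measure DIM('a) \<Otimes>\<^sub>M sphere_surface 0 1) borel (\<lambda>(t, \<theta>). t *\<^sub>R \<theta>)) F"
    by (simp flip: lborel_eq_polar)
  also have "\<dots> \<longleftrightarrow> integrable (radial_measure DIM('a) \<Otimes>\<^sub>M sphere_surface 0 1) (\<lambda>p. F ((\<lambda>(t, \<theta>). t *\<^sub>R \<theta>) p))"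
    by (rule integrable_distr_eq) measurable
  finally show ?thesis by (simp add: case_prod_unfold)
qed

text \<open>The order with the radius outside serves spherical means and the divergence identity;
  the order with the direction outside serves the radial derivative in the Newtonian
  potential.\<close>

lemma integral_polar:
  fixes F :: "'a::euclidean_space \<Rightarrow> 'b::{banach, second_countable_topology}"
  assumes F: "integrable lborel F"
  shows "(\<integral>x. F x \<partial>lborel) =
    (\<integral>t. (indicator {0<..} t * t ^ (DIM('a) - 1)) *\<^sub>R (\<integral>\<theta>. F (t *\<^sub>R \<theta>) \<partial>sphere_surface 0 1) \<partial>lborel)"
    and "(\<integral>x. F x \<partial>lborel) =
    (\<integral>\<theta>. (\<integral>t. (indicator {0<..} t * t ^ (DIM('a) - 1)) *\<^sub>R F (t *\<^sub>R \<theta>) \<partial>lborel) \<partial>sphere_surface 0 1)"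
proof -
  have [measurable]: "F \<in> borel_measurable borel" using F by simp
  interpret radial: sigma_finite_measure "radial_measure DIM('a)" by (rule sigma_finite_radial_measure)
  interpret pair_sigma_finite "radial_measure DIM('a)" "sphere_surface 0 1 :: 'a measure" ..
  have int: "integrable (radial_measure DIM('a) \<Otimes>\<^sub>M sphere_surface 0 1) (\<lambda>(t, \<theta>). F (t *\<^sub>R \<theta>))"
    using F integrable_polar_iff[of F] by simp
  have eq: "(\<integral>x. F x \<partial>lborel) =
    (\<integral>p. (\<lambda>(t, \<theta>). F (t *\<^sub>R \<theta>)) p \<partial>(radial_measure DIM('a) \<Otimes>\<^sub>M sphere_surface 0 1))"
    by (subst lborel_eq_polar, subst integral_distr) (auto simp: case_prod_unfold)
  show "(\<integral>x. F x \<partial>lborel) =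
    (\<integral>t. (indicator {0<..} t * t ^ (DIM('a) - 1)) *\<^sub>R (\<integral>\<theta>. F (t *\<^sub>R \<theta>) \<partial>sphere_surface 0 1) \<partial>lborel)"
    unfolding eq integral_fst[OF int, symmetric] unfolding radial_measure_def
    by (subst integral_density) (auto simp del: real_scaleR_def simp: zero_le_mult_iff split: split_indicator)
  show "(\<integral>x. F x \<partial>lborel) =
    (\<integral>\<theta>. (\<integral>t. (indicator {0<..} t * t ^ (DIM('a) - 1)) *\<^sub>R F (t *\<^sub>R \<theta>) \<partial>lborel) \<partial>sphere_surface 0 1)"
    unfolding eq integral_snd[OF int, symmetric] unfolding radial_measure_def
    by (subst integral_density) (auto simp del: real_scaleR_def simp: zero_le_mult_iff split: split_indicator)
qed

section \<open>Differentiation under the integral sign\<close>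

lemma has_vector_derivative_iff_tendsto:
  "(f has_vector_derivative D) (at x) \<longleftrightarrow> ((\<lambda>y. (f y - f x) /\<^sub>R (y - x)) \<longlongrightarrow> D) (at x)"
proof -
  have "(f has_vector_derivative D) (at x) \<longleftrightarrow>
      ((\<lambda>y. (f y - f x - (y - x) *\<^sub>R D) /\<^sub>R \<bar>y - x\<bar>) \<longlongrightarrow> 0) (at x)"
    unfolding has_vector_derivative_def has_derivative_at_within
    by (simp add: bounded_linear_scaleR_left divide_inverse_commute algebra_simps)
  also have "\<dots> \<longleftrightarrow> ((\<lambda>y. norm ((f y - f x) /\<^sub>R (y - x) - D)) \<longlongrightarrow> 0) (at x)"
    unfolding tendsto_norm_zero_iff[of "\<lambda>y. (f y - f x - (y - x) *\<^sub>R D) /\<^sub>R \<bar>y - x\<bar>", symmetric]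
  proof (rule filterlim_cong[OF refl refl])
    show "\<forall>\<^sub>F y in at x. norm ((f y - f x - (y - x) *\<^sub>R D) /\<^sub>R \<bar>y - x\<bar>) = norm ((f y - f x) /\<^sub>R (y - x) - D)"
      using eventually_neq_at_within
    proof (rule eventually_mono)
      fix y assume "y \<noteq> x"
      then have "(f y - f x) /\<^sub>R (y - x) - D = (f y - f x - (y - x) *\<^sub>R D) /\<^sub>R (y - x)"
        by (simp add: scaleR_diff_right)
      then show "norm ((f y - f x - (y - x) *\<^sub>R D) /\<^sub>R \<bar>y - x\<bar>) = norm ((f y - f x) /\<^sub>R (y - x) - D)"
        by simp
    qed
  qed
  also have "\<dots> \<longleftrightarrow> ((\<lambda>y. (f y - f x) /\<^sub>R (y - x)) \<longlongrightarrow> D) (at x)"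
    by (simp add: tendsto_norm_zero_iff Lim_null[symmetric])
  finally show ?thesis .
qed

lemma vector_derivative_bound:
  fixes f :: "real \<Rightarrow> 'b::real_normed_vector"
  assumes "convex S" "\<And>s. s \<in> S \<Longrightarrow> (f has_vector_derivative f' s) (at s)"
    "\<And>s. s \<in> S \<Longrightarrow> norm (f' s) \<le> B" "x \<in> S" "y \<in> S"
  shows "norm (f x - f y) \<le> B * \<bar>x - y\<bar>"
proof -
  have "norm (f x - f y) \<le> B * norm (x - y)"
  proof (rule differentiable_bound[OF assms(1)])
    show "(f has_derivative (\<lambda>h. h *\<^sub>R f' s)) (at s within S)" if "s \<in> S" for s
      using assms(2)[OF that] by (simp add: has_vector_derivative_def has_derivative_at_withinI)
    show "onorm (\<lambda>h. h *\<^sub>R f' s) \<le> B" if "s \<in> S" for s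
      using assms(3)[OF that] by (intro onorm_le_matrix_component order_trans[OF onorm_bound[of "norm (f' s)"]])
        (auto simp: mult.commute)
  qed (use assms in auto)
  then show ?thesis by simp
qed

text \<open>Dominated convergence for the difference quotients along an arbitrary sequence: the mean
  value inequality bounds each quotient by the majorant of the derivative.\<close>

lemma has_vector_derivative_integral:
  fixes F :: "real \<Rightarrow> 'x \<Rightarrow> 'b::{banach, second_countable_topology}"
  assumes r: "r > 0"
    and int: "\<And>s. \<bar>s - s0\<bar> < r \<Longrightarrow> integrable M (F s)"
    and der: "AE x in M. \<forall>s. \<bar>s - s0\<bar> < r \<longrightarrow>
      ((\<lambda>s. F s x) has_vector_derivative F' s x) (at s) \<and> norm (F' s x) \<le> G x"
    and G: "integrable M G" and F': "F' s0 \<in> borel_measurable M"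
  shows "((\<lambda>s. \<integral>x. F s x \<partial>M) has_vector_derivative (\<integral>x. F' s0 x \<partial>M)) (at s0)"
  unfolding has_vector_derivative_iff_tendsto tendsto_at_iff_sequentially comp_def
proof (intro allI impI)
  fix X :: "nat \<Rightarrow> real"
  assume X: "\<forall>i. X i \<in> UNIV - {s0}" and lim: "X \<longlonglongrightarrow> s0"
  have "\<forall>\<^sub>F i in sequentially. \<bar>X i - s0\<bar> < r"
    using tendstoD[OF lim r] by (simp add: dist_real_def)
  then obtain N where N: "\<And>i. i \<ge> N \<Longrightarrow> \<bar>X i - s0\<bar> < r"
    by (auto simp: eventually_sequentially)
  \<comment> \<open>Dominated convergence needs the bound for every index, so the initial terms
    outside the interval of radius \<open>r\<close> are dropped.\<close>
  define Y where "Y i = X (i + N)" for i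
  have Y: "\<bar>Y i - s0\<bar> < r" "Y i \<noteq> s0" for i using N X by (auto simp: Y_def)
  have limY: "Y \<longlonglongrightarrow> s0" unfolding Y_def by (rule LIMSEQ_ignore_initial_segment[OF lim])
  have int': "integrable M (\<lambda>x. (F (Y i) x - F s0 x) /\<^sub>R (Y i - s0))" for i
    using int[of "Y i"] int[of s0] Y r by auto
  have "(\<lambda>i. \<integral>x. (F (Y i) x - F s0 x) /\<^sub>R (Y i - s0) \<partial>M) \<longlonglongrightarrow> (\<integral>x. F' s0 x \<partial>M)"
  proof (rule integral_dominated_convergence[where w = G])
    show "AE x in M. (\<lambda>i. (F (Y i) x - F s0 x) /\<^sub>R (Y i - s0)) \<longlonglongrightarrow> F' s0 x"
      using der
    proof (rule eventually_mono)
      fix x assume "\<forall>s. \<bar>s - s0\<bar> < r \<longrightarrow> ((\<lambda>s. F s x) has_vector_derivative F' s x) (at s) \<and> norm (F' s x) \<le> G x"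
      then have "((\<lambda>s. F s x) has_vector_derivative F' s0 x) (at s0)" using r by simp
      then show "(\<lambda>i. (F (Y i) x - F s0 x) /\<^sub>R (Y i - s0)) \<longlonglongrightarrow> F' s0 x"
        unfolding has_vector_derivative_iff_tendsto tendsto_at_iff_sequentially comp_def
        using Y limY by auto
    qed
    show "AE x in M. norm ((F (Y i) x - F s0 x) /\<^sub>R (Y i - s0)) \<le> G x" for i
      using der
    proof (rule eventually_mono)
      fix x assume *: "\<forall>s. \<bar>s - s0\<bar> < r \<longrightarrow> ((\<lambda>s. F s x) has_vector_derivative F' s x) (at s) \<and> norm (F' s x) \<le> G x"
      have "norm (F (Y i) x - F s0 x) \<le> G x * \<bar>Y i - s0\<bar>"
        by (rule vector_derivative_bound[where S = "ball s0 r" and f' = "\<lambda>s. F' s x"])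
           (use * Y r in \<open>auto simp: dist_real_def abs_minus_commute\<close>)
      then show "norm ((F (Y i) x - F s0 x) /\<^sub>R (Y i - s0)) \<le> G x"
        using Y(2)[of i] by (simp add: divide_simps del: scaleR_diff_right flip: divide_inverse_commute)
    qed
  qed (use F' G int' in auto)
  moreover have "(\<integral>x. (F (Y i) x - F s0 x) /\<^sub>R (Y i - s0) \<partial>M) =
      ((\<integral>x. F (Y i) x \<partial>M) - (\<integral>x. F s0 x \<partial>M)) /\<^sub>R (Y i - s0)" for i
    using int[of "Y i"] int[of s0] Y(1)[of i] r by simp
  ultimately have "(\<lambda>i. ((\<integral>x. F (Y i) x \<partial>M) - (\<integral>x. F s0 x \<partial>M)) /\<^sub>R (Y i - s0)) \<longlonglongrightarrow> (\<integral>x. F' s0 x \<partial>M)"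
    by (simp only:)
  then show "(\<lambda>i. ((\<integral>x. F (X i) x \<partial>M) - (\<integral>x. F s0 x \<partial>M)) /\<^sub>R (X i - s0)) \<longlonglongrightarrow> (\<integral>x. F' s0 x \<partial>M)"
    unfolding Y_def by (rule LIMSEQ_offset)
qed

lemma integrable_bounded_support:
  fixes g :: "'a::euclidean_space \<Rightarrow> 'b::{banach, second_countable_topology}"
  assumes "g \<in> borel_measurable borel" "\<And>x. norm (g x) \<le> B" "\<And>x. norm x > r \<Longrightarrow> g x = 0"
  shows "integrable lborel g"
proof (rule Bochner_Integration.integrable_bound[of _ "\<lambda>x. B * indicator (cball 0 r) x"])
  show "integrable lborel (\<lambda>x::'a. B * indicator (cball 0 r) x)"
    by (intro integrable_mult_right integrable_real_indicator) (auto simp: emeasure_bounded_finite[unfolded infinity_ennreal_def])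
  show "AE x in lborel. norm (g x) \<le> norm (B * indicator (cball 0 r) x)"
    using assms(2,3) by (intro AE_I2) (smt (verit) indicator_simps mem_cball_0 mult_cancel_left1 norm_zero real_norm_def)
qed (use assms in auto)

lemma integral_lborel_translate:
  fixes g :: "'a::euclidean_space \<Rightarrow> 'b::{banach, second_countable_topology}"
  assumes "g \<in> borel_measurable borel"
  shows "(\<integral>x. g (x + c) \<partial>lborel) = (\<integral>x. g x \<partial>lborel)"
    and "integrable lborel (\<lambda>x. g (x + c)) \<longleftrightarrow> integrable lborel g"
proof -
  have eq: "distr lborel borel (\<lambda>x. x + c) = (lborel :: 'a measure)"
    
  proof -
    have "(\<lambda>x. x + c) = (+) c" by (auto simp: add.commute)
    then show ?thesis using lborel_distr_plus[of c] by simp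
  qed
  show "(\<integral>x. g (x + c) \<partial>lborel) = (\<integral>x. g x \<partial>lborel)"
    using integral_distr[of "\<lambda>x. x + c" lborel borel g] assms unfolding eq by simp
  show "integrable lborel (\<lambda>x. g (x + c)) \<longleftrightarrow> integrable lborel g"
    using integrable_distr_eq[of "\<lambda>x. x + c" lborel borel g] assms unfolding eq by simp
qed

lemma has_vector_derivative_shift:
  fixes g :: "'a::real_vector \<Rightarrow> 'b::real_normed_vector"
  assumes "\<And>x. ((\<lambda>s. g (x + s *\<^sub>R e)) has_vector_derivative g' x) (at 0)"
  shows "((\<lambda>s. g (x + s *\<^sub>R e)) has_vector_derivative g' (x + s0 *\<^sub>R e)) (at s0)"
proof -
  have "((\<lambda>s. g (x + s0 *\<^sub>R e + s *\<^sub>R e)) has_vector_derivative g' (x + s0 *\<^sub>R e)) (at (s0 - s0))"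
    using assms by simp
  from has_vector_derivative_at_within[OF this]
  have "((\<lambda>s. g (x + s0 *\<^sub>R e + s *\<^sub>R e)) \<circ> (\<lambda>s. s - s0) has_vector_derivative 1 *\<^sub>R g' (x + s0 *\<^sub>R e)) (at s0)"
    by (intro vector_diff_chain_at) (auto intro!: derivative_eq_intros)
  moreover have "x + s0 *\<^sub>R e + (s - s0) *\<^sub>R e = x + s *\<^sub>R e" for s
    by (simp add: algebra_simps)
  ultimately show ?thesis by (simp add: comp_def)
qed

text \<open>The integral of g(x + s e) over x does not depend on s by translation invariance;
  differentiating it under the integral sign at s = 0 gives the claim. This replaces a divergence
  theorem with boundary.\<close>

lemma integral_directional_derivative_eq_0:
  fixes g :: "'a::euclidean_space \<Rightarrow> 'b::{banach, second_countable_topology}"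
  assumes der: "\<And>x. ((\<lambda>s. g (x + s *\<^sub>R e)) has_vector_derivative g' x) (at 0)"
    and [measurable]: "g' \<in> borel_measurable borel" and B: "\<And>x. norm (g' x) \<le> B"
    and g'0: "\<And>x. norm x > r \<Longrightarrow> g' x = 0" and g: "integrable lborel g"
  shows "(\<integral>x. g' x \<partial>lborel) = 0"
proof -
  have [measurable]: "g \<in> borel_measurable borel" using g by simp
  have "((\<lambda>s. \<integral>x. g (x + s *\<^sub>R e) \<partial>lborel) has_vector_derivative (\<integral>x. g' (x + 0 *\<^sub>R e) \<partial>lborel)) (at 0)"
  proof (rule has_vector_derivative_integral[where r = 1 and G = "\<lambda>x. B * indicator (cball 0 (r + norm e)) x"])
    show "integrable lborel (\<lambda>x. g (x + s *\<^sub>R e))" for s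
      using g by (simp add: integral_lborel_translate)
    show "integrable lborel (\<lambda>x::'a. B * indicator (cball 0 (r + norm e)) x)"
      by (intro integrable_mult_right integrable_real_indicator) (auto simp: emeasure_bounded_finite[unfolded infinity_ennreal_def])
    \<comment> \<open>Shifts by less than |e| enlarge the support radius by at most |e|, which gives
      one majorant for all s considered.\<close>
    have "norm (g' (x + s *\<^sub>R e)) \<le> B * indicator (cball 0 (r + norm e)) x" if "\<bar>s\<bar> < 1" for x s
    proof (cases "norm x \<le> r + norm e")
      case False
      have "norm (s *\<^sub>R e) \<le> norm e" using that by (simp add: mult_left_le_one_le)
      with False have "norm (x + s *\<^sub>R e) > r"
        using norm_triangle_ineq4[of "x + s *\<^sub>R e" "s *\<^sub>R e"] by simp
      with False show ?thesis by (simp add: g'0)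
    qed (simp add: B)
    then show "AE x in lborel. \<forall>s. \<bar>s - 0\<bar> < 1 \<longrightarrow> ((\<lambda>s. g (x + s *\<^sub>R e)) has_vector_derivative g' (x + s *\<^sub>R e)) (at s) \<and>
       norm (g' (x + s *\<^sub>R e)) \<le> B * indicator (cball 0 (r + norm e)) x"
      using has_vector_derivative_shift[of g e g', OF der] by simp
  qed auto
  then have "((\<lambda>s. \<integral>x. g x \<partial>lborel) has_vector_derivative (\<integral>x. g' x \<partial>lborel)) (at 0)"
    by (simp add: integral_lborel_translate)
  then show ?thesis
    using vector_derivative_unique_at has_vector_derivative_const by blast
qed

section \<open>A divergence identity on the sphere\<close>

lemma norm_diff_of_real_ge:
  assumes "Im z > 0"
  shows "norm (z - of_real s) \<ge> Im z" "z - of_real s \<noteq> 0"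
proof -
  show "norm (z - of_real s) \<ge> Im z"
    using abs_Im_le_cmod[of "z - of_real s"] assms by simp
  with assms show "z - of_real s \<noteq> 0" by auto
qed

lemma integrable_sphere_kernel:
  fixes e :: "'a::euclidean_space" and p :: "'a \<Rightarrow> complex"
  assumes z: "Im z > 0" and [measurable]: "p \<in> borel_measurable borel"
    and p: "\<And>\<theta>. norm \<theta> = 1 \<Longrightarrow> norm (p \<theta>) \<le> C"
  shows "integrable (sphere_surface 0 1) (\<lambda>\<theta>. p \<theta> / (z - of_real (\<theta> \<bullet> e)) ^ k)"
proof (rule unit_sphere.integrable_const_bound[where B = "C / Im z ^ k"])
  show "AE \<theta> in sphere_surface 0 1. norm (p \<theta> / (z - of_real (\<theta> \<bullet> e)) ^ k) \<le> C / Im z ^ k"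
    using AE_sphere_surface[of 1, simplified]
  proof (rule eventually_mono)
    fix \<theta> :: 'a assume "norm \<theta> = 1"
    then show "norm (p \<theta> / (z - of_real (\<theta> \<bullet> e)) ^ k) \<le> C / Im z ^ k"
      unfolding norm_divide norm_power
      using p[of \<theta>] norm_diff_of_real_ge[OF z, of "\<theta> \<bullet> e"] z
      by (intro frac_le power_mono order_trans[OF norm_ge_zero p]) auto
  qed
qed measurable

lemma has_field_derivative_inverse_power:
  fixes w :: "'b::real_normed_field"
  assumes "w \<noteq> 0"
  shows "((\<lambda>w. 1 / w ^ m) has_field_derivative - of_nat m / w ^ Suc m) (at w)"
  using assms by (auto intro!: derivative_eq_intros simp: field_simps)
    (metis One_nat_def Suc_pred' bot_nat_0.not_eq_extremum power_Suc)

text \<open>Squaring smooths the kink of the positive part to a function with continuous derivative,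
  the cheapest cutoff that can be differentiated once.\<close>

lemma has_real_derivative_max_square:
  "((\<lambda>s::real. (max 0 s)\<^sup>2) has_real_derivative 2 * max 0 x) (at x)"
proof -
  consider "x > 0" | "x < 0" | "x = 0" by linarith
  then show ?thesis
  proof cases
    case 1
    have "((\<lambda>s. s\<^sup>2) has_real_derivative 2 * x) (at x)"
      by (auto intro!: derivative_eq_intros)
    then have "((\<lambda>s. (max 0 s)\<^sup>2) has_real_derivative 2 * x) (at x)"
      by (rule has_field_derivative_transform_within_open[where S = "{0<..}"]) (use 1 in auto)
    with 1 show ?thesis by simp
  next
    case 2
    have "((\<lambda>s. 0) has_real_derivative 0) (at x)" by simp
    then have "((\<lambda>s. (max 0 s)\<^sup>2) has_real_derivative 0) (at x)"
      by (rule has_field_derivative_transform_within_open[where S = "{..<0}"]) (use 2 in auto)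
    with 2 show ?thesis by simp
  next
    case 3
    have "((\<lambda>h. ((max 0 h)\<^sup>2 - 0) / h) \<longlongrightarrow> (0::real)) (at 0)"
    proof (rule Lim_null_comparison)
      show "\<forall>\<^sub>F h in at (0::real). norm (((max 0 h)\<^sup>2 - 0) / h) \<le> \<bar>h\<bar>"
        by (intro always_eventually) (auto simp: max_def power2_eq_square abs_mult)
      show "((\<lambda>h::real. \<bar>h\<bar>) \<longlongrightarrow> 0) (at 0)"
        by (rule tendsto_eq_intros refl | simp)+
    qed
    with 3 show ?thesis by (simp add: DERIV_def)
  qed
qed

text \<open>A cutoff in the variable |x|^2, supported on [1, 4], that is on the annulus 1 <= |x| <=
  2. It keeps away from the origin, where the norm is not differentiable and the homogeneous kernel
  blows up, and it is compactly supported.\<close>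

definition annulus_bump :: "real \<Rightarrow> real" where
  "annulus_bump \<tau> = (max 0 ((\<tau> - 1) * (4 - \<tau>)))\<^sup>2"

definition annulus_bump' :: "real \<Rightarrow> real" where
  "annulus_bump' \<tau> = 2 * max 0 ((\<tau> - 1) * (4 - \<tau>)) * (5 - 2 * \<tau>)"

lemma annulus_bump_deriv: "(annulus_bump has_real_derivative annulus_bump' \<tau>) (at \<tau>)"
  unfolding annulus_bump_def[abs_def] annulus_bump'_def
  by (rule DERIV_cong[OF DERIV_chain2[OF has_real_derivative_max_square]])
     (auto intro!: derivative_eq_intros simp: algebra_simps)

lemma annulus_bump_eq_0:
  assumes "\<tau> \<le> 1 \<or> \<tau> \<ge> 4"
  shows "annulus_bump \<tau> = 0" "annulus_bump' \<tau> = 0"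
proof -
  have "(\<tau> - 1) * (4 - \<tau>) \<le> 0"
    using assms by (auto intro: mult_nonpos_nonneg mult_nonneg_nonpos)
  then show "annulus_bump \<tau> = 0" "annulus_bump' \<tau> = 0"
    by (simp_all add: annulus_bump_def annulus_bump'_def)
qed

lemma continuous_annulus_bump [continuous_intros]:
  "continuous_on S f \<Longrightarrow> continuous_on S (\<lambda>x. annulus_bump (f x))"
  "continuous_on S f \<Longrightarrow> continuous_on S (\<lambda>x. annulus_bump' (f x))"
  unfolding annulus_bump_def annulus_bump'_def by (intro continuous_intros; simp)+

text \<open>On [1, 4] both factors of the quadratic and |5 - 2 \<tau>| are at most 3, hence the
  crude values 9^2 and 2 * 9 * 3.\<close>

lemma annulus_bump_bound: "\<bar>annulus_bump \<tau>\<bar> \<le> 81" "\<bar>annulus_bump' \<tau>\<bar> \<le> 54"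
proof -
  have *: "max 0 ((\<tau> - 1) * (4 - \<tau>)) \<le> 9" if "1 \<le> \<tau>" "\<tau> \<le> 4"
    using mult_mono[of "\<tau> - 1" 3 "4 - \<tau>" 3] that by simp
  show "\<bar>annulus_bump \<tau>\<bar> \<le> 81"
  proof (cases "1 \<le> \<tau> \<and> \<tau> \<le> 4")
    case True
    then have "(max 0 ((\<tau> - 1) * (4 - \<tau>)))\<^sup>2 \<le> 9\<^sup>2" using * by (intro power_mono) auto
    then show ?thesis by (simp add: annulus_bump_def)
  next
    case False
    then show ?thesis using annulus_bump_eq_0[of \<tau>] by auto
  qed
  show "\<bar>annulus_bump' \<tau>\<bar> \<le> 54"
  proof (cases "1 \<le> \<tau> \<and> \<tau> \<le> 4")
    case True
    then have "max 0 ((\<tau> - 1) * (4 - \<tau>)) * \<bar>5 - 2 * \<tau>\<bar> \<le> 9 * 3" using * by (intro mult_mono) auto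
    then show ?thesis by (simp add: annulus_bump'_def abs_mult mult.commute)
  next
    case False
    then show ?thesis using annulus_bump_eq_0[of \<tau>] by auto
  qed
qed

lemma annulus_bump_deriv_sq:
  "((\<lambda>t. annulus_bump (t\<^sup>2)) has_real_derivative annulus_bump' (t\<^sup>2) * (2 * t)) (at t)"
  by (rule DERIV_chain2[OF annulus_bump_deriv]) (auto intro!: derivative_eq_intros)

lemma has_vector_derivative_norm_line:
  fixes x e :: "'a::real_inner"
  assumes "x \<noteq> 0"
  shows "((\<lambda>s. norm (x + s *\<^sub>R e)) has_real_derivative (x \<bullet> e) / norm x) (at 0)"
proof -
  have "((\<lambda>s. (x + s *\<^sub>R e) \<bullet> (x + s *\<^sub>R e)) has_real_derivative 2 * (x \<bullet> e)) (at 0)"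
  proof -
    have "((\<lambda>s. x \<bullet> x + 2 * s * (x \<bullet> e) + s\<^sup>2 * (e \<bullet> e)) has_real_derivative 2 * (x \<bullet> e)) (at 0)"
      by (auto intro!: derivative_eq_intros)
    moreover have "(\<lambda>s. (x + s *\<^sub>R e) \<bullet> (x + s *\<^sub>R e)) = (\<lambda>s. x \<bullet> x + 2 * s * (x \<bullet> e) + s\<^sup>2 * (e \<bullet> e))"
      by (auto simp: algebra_simps inner_commute power2_eq_square)
    ultimately show ?thesis by simp
  qed
  then show ?thesis
    unfolding norm_eq_sqrt_inner
    by (rule DERIV_cong[OF DERIV_chain2[OF DERIV_real_sqrt, rotated]]) (use assms in \<open>auto simp: field_simps\<close>)
qed

lemma norm_line_sq_deriv:
  fixes x e :: "'a::real_inner"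
  shows "((\<lambda>s. (norm (x + s *\<^sub>R e))\<^sup>2) has_real_derivative 2 * (x \<bullet> e)) (at 0)"
proof -
  have "((\<lambda>s. x \<bullet> x + 2 * s * (x \<bullet> e) + s\<^sup>2 * (e \<bullet> e)) has_real_derivative 2 * (x \<bullet> e)) (at 0)"
    by (auto intro!: derivative_eq_intros)
  moreover have "(\<lambda>s. (norm (x + s *\<^sub>R e))\<^sup>2) = (\<lambda>s. x \<bullet> x + 2 * s * (x \<bullet> e) + s\<^sup>2 * (e \<bullet> e))"
    unfolding power2_norm_eq_inner by (auto simp: algebra_simps inner_commute power2_eq_square)
  ultimately show ?thesis by simp
qed

lemma borel_measurable_annulus_bump [measurable]:
  "annulus_bump \<in> borel_measurable borel" "annulus_bump' \<in> borel_measurable borel"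
  by (auto intro!: borel_measurable_continuous_onI continuous_intros)

text \<open>
  Divergence identity on the sphere: integrate the derivative along \<open>e\<close> of
  \<open>annulus_bump (|x|\<^sup>2) (z |x| - x \<bullet> e)\<^bsup>1 - n\<^esup>\<close> in polar coordinates.
\<close>
lemma sphere_kernel_divergence:
  fixes e :: "'a::euclidean_space"
  assumes z: "Im z > 0" and e: "norm e = 1" and n2: "DIM('a) \<ge> 2"
  shows "(\<integral>\<theta>. (1 - z * of_real (\<theta> \<bullet> e)) / (z - of_real (\<theta> \<bullet> e)) ^ DIM('a) \<partial>sphere_surface 0 1) = 0"
proof -
  define n where "n = DIM('a)"
  obtain m where n: "n = Suc m" using n2 by (cases n) (auto simp: n_def)
  \<comment> \<open>The extension of z - \<theta> . e that is homogeneous of degree 1: on the ray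
    through \<theta> it equals t (z - \<theta> . e), so radial and angular factors separate
    below.\<close>
  define u :: "'a \<Rightarrow> complex" where "u x = z * of_real (norm x) - of_real (x \<bullet> e)" for x
  define g :: "'a \<Rightarrow> complex" where "g x = of_real (annulus_bump ((norm x)\<^sup>2)) * (1 / u x ^ m)" for x
  define g' :: "'a \<Rightarrow> complex" where
    "g' x = of_real (annulus_bump' ((norm x)\<^sup>2) * (2 * (x \<bullet> e))) * (1 / u x ^ m)
      - of_real (annulus_bump ((norm x)\<^sup>2)) * (of_nat m * (z * of_real ((x \<bullet> e) / norm x) - 1) / u x ^ n)" for x
  have [measurable]: "u \<in> borel_measurable borel" unfolding u_def[abs_def] by measurable
  have [measurable]: "g \<in> borel_measurable borel" unfolding g_def[abs_def] by measurable
  have [measurable]: "g' \<in> borel_measurable borel" unfolding g'_def[abs_def] by measurable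
  have u_ge: "norm (u x) \<ge> Im z * norm x" for x
    using abs_Im_le_cmod[of "u x"] z by (simp add: u_def)
  have u_ge': "norm (u x) \<ge> Im z" if "norm x \<ge> 1" for x
    using order_trans[OF mult_left_mono[OF that, of "Im z"] u_ge[of x]] z by simp
  have u0: "u x \<noteq> 0" if "x \<noteq> 0" for x
    using u_ge[of x] z that by (auto simp: mult_le_0_iff)
  have xe: "\<bar>x \<bullet> e\<bar> \<le> norm x" for x using Cauchy_Schwarz_ineq2[of x e] e by simp
  have outside: "annulus_bump ((norm x)\<^sup>2) = 0" "annulus_bump' ((norm x)\<^sup>2) = 0" if "norm x \<le> 1 \<or> norm x \<ge> 2" for x :: 'a
  proof -
    have "(norm x)\<^sup>2 \<le> 1 \<or> (norm x)\<^sup>2 \<ge> 4"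
      using that power_mono[of "norm x" 1 2] power_mono[of 2 "norm x" 2] by auto
    then show "annulus_bump ((norm x)\<^sup>2) = 0" "annulus_bump' ((norm x)\<^sup>2) = 0"
      by (simp_all add: annulus_bump_eq_0)
  qed
  have der: "((\<lambda>s. g (x + s *\<^sub>R e)) has_vector_derivative g' x) (at 0)" for x
  proof (cases "x = 0")
    case False
    have u': "((\<lambda>s. u (x + s *\<^sub>R e)) has_vector_derivative (z * of_real ((x \<bullet> e) / norm x) - 1)) (at 0)"
    proof -
      have A: "((\<lambda>s. of_real (norm (x + s *\<^sub>R e)) :: complex) has_vector_derivative of_real ((x \<bullet> e) / norm x)) (at 0)"
        using has_vector_derivative_norm_line[OF False, of e]
        by (intro has_vector_derivative_of_real) (simp add: has_real_derivative_iff_has_vector_derivative)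
      have B: "((\<lambda>s. of_real ((x + s *\<^sub>R e) \<bullet> e) :: complex) has_vector_derivative of_real 1) (at 0)"
        using e by (intro has_vector_derivative_of_real)
          (auto simp: inner_simps dot_square_norm has_real_derivative_iff_has_vector_derivative[symmetric] intro!: derivative_eq_intros)
      show ?thesis unfolding u_def
        using has_vector_derivative_diff[OF has_vector_derivative_mult_right[OF A, of z] B] by simp
    qed
    have "((\<lambda>w. 1 / w ^ m) has_field_derivative (- of_nat m / u x ^ n)) (at (u (x + 0 *\<^sub>R e)))"
      using has_field_derivative_inverse_power[OF u0[OF False], of m] by (simp add: n)
    from field_vector_diff_chain_at[OF u' this]
    have inv: "((\<lambda>s. 1 / u (x + s *\<^sub>R e) ^ m) has_vector_derivative (z * of_real ((x \<bullet> e) / norm x) - 1) * (- of_nat m / u x ^ n)) (at 0)"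
      by (simp add: comp_def)
    have "((\<lambda>s. annulus_bump ((norm (x + s *\<^sub>R e))\<^sup>2)) has_real_derivative annulus_bump' ((norm (x + 0 *\<^sub>R e))\<^sup>2) * (2 * (x \<bullet> e))) (at 0)"
      by (rule DERIV_chain2[OF annulus_bump_deriv norm_line_sq_deriv])
    then have "((\<lambda>s. of_real (annulus_bump ((norm (x + s *\<^sub>R e))\<^sup>2)) :: complex) has_vector_derivative of_real (annulus_bump' ((norm x)\<^sup>2) * (2 * (x \<bullet> e)))) (at 0)"
      by (intro has_vector_derivative_of_real) (simp add: has_real_derivative_iff_has_vector_derivative)
    from has_vector_derivative_mult[OF this inv] show ?thesis
      unfolding g_def g'_def by (simp add: algebra_simps diff_divide_distrib)
  next
    case True
    have "((\<lambda>s. 0) has_vector_derivative 0) (at (0::real))" by simp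
    then have "((\<lambda>s. g (x + s *\<^sub>R e)) has_vector_derivative 0) (at 0)"
      by (rule has_vector_derivative_transform_within_open[where S = "ball 0 1"])
         (auto simp: True g_def annulus_bump_eq_0 abs_square_le_1 e dist_real_def)
    then show ?thesis by (simp add: True g'_def annulus_bump_eq_0)
  qed
  \<comment> \<open>The factors 54 and 81 come from \<open>annulus_bump_bound\<close>, and 4 bounds
    2 |x . e| on the annulus |x| <= 2.\<close>
  define B where "B = 54 * 4 * (1 / Im z ^ m) + 81 * (m * (norm z + 1) / Im z ^ n)"
  have g'_bound: "norm (g' x) \<le> B" for x
  proof (cases "norm x \<le> 1 \<or> norm x \<ge> 2")
    case True
    then have "g' x = 0" by (simp add: g'_def outside)
    then show ?thesis using z by (simp add: B_def)
  next
    case False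
    then have x: "norm x \<ge> 1" "norm x \<le> 2" by auto
    have p: "1 / norm (u x) ^ k \<le> 1 / Im z ^ k" for k
      using u_ge'[OF x(1)] z by (intro frac_le power_mono) auto
    have 1: "norm (of_real (annulus_bump' ((norm x)\<^sup>2) * (2 * (x \<bullet> e))) * (1 / u x ^ m)) \<le> 54 * 4 * (1 / Im z ^ m)"
      unfolding norm_mult norm_divide norm_power norm_of_real abs_mult
      using xe[of x] x p[of m] by (intro mult_mono annulus_bump_bound) auto
    have "norm (z * of_real ((x \<bullet> e) / norm x) - 1) \<le> norm (z * of_real ((x \<bullet> e) / norm x)) + 1"
      using norm_triangle_ineq4[of "z * of_real ((x \<bullet> e) / norm x)" 1] by simp
    also have "norm (z * of_real ((x \<bullet> e) / norm x)) \<le> norm z * 1"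
      unfolding norm_mult norm_of_real using xe[of x] x by (intro mult_mono) (auto simp: divide_le_eq)
    finally have 2: "norm (z * of_real ((x \<bullet> e) / norm x) - 1) \<le> norm z + 1" by simp
    have "norm (of_nat m * (z * of_real ((x \<bullet> e) / norm x) - 1) / u x ^ n) \<le> m * (norm z + 1) * (1 / Im z ^ n)"
      unfolding norm_mult norm_divide norm_power norm_of_nat divide_inverse[of _ "norm (u x) ^ n"]
      using 2 p[of n] by (intro mult_mono) (auto simp: inverse_eq_divide)
    then have 3: "norm (of_real (annulus_bump ((norm x)\<^sup>2)) * (of_nat m * (z * of_real ((x \<bullet> e) / norm x) - 1) / u x ^ n)) \<le> 81 * (m * (norm z + 1) / Im z ^ n)"
      unfolding norm_mult[of "of_real (annulus_bump ((norm x)\<^sup>2))"] norm_of_real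
      by (intro mult_mono annulus_bump_bound) auto
    show ?thesis unfolding g'_def B_def using 1 3 by (intro order_trans[OF norm_triangle_ineq4] add_mono)
  qed
  have g_bound: "norm (g x) \<le> 81 * (1 / Im z ^ m)" for x
  proof (cases "norm x \<le> 1 \<or> norm x \<ge> 2")
    case True
    then show ?thesis using z by (simp add: g_def outside)
  next
    case False
    then show ?thesis unfolding g_def norm_mult norm_divide norm_power norm_of_real
      using u_ge'[of x] z by (intro mult_mono annulus_bump_bound frac_le power_mono) auto
  qed
  have "integrable lborel g" by (rule integrable_bounded_support[OF _ g_bound, where r = 2]) (auto simp: g_def outside)
  then have "(\<integral>x. g' x \<partial>lborel) = 0"
    by (intro integral_directional_derivative_eq_0[OF der _ g'_bound, where r = 2]) (auto simp: g'_def outside)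
  moreover have "integrable lborel g'"
    by (rule integrable_bounded_support[OF _ g'_bound, where r = 2]) (auto simp: g'_def outside)
  ultimately have zero: "(\<integral>t. (indicator {0<..} t * t ^ (DIM('a) - 1)) *\<^sub>R (\<integral>\<theta>. g' (t *\<^sub>R \<theta>) \<partial>sphere_surface 0 1) \<partial>lborel) = 0"
    using integral_polar(1)[of g'] by simp
  \<comment> \<open>The derivative of the cutoff produces \<open>E1\<close>, the derivative of the
    kernel produces \<open>E2\<close>, which is the integral to be shown zero. Their radial weights
    are \<open>a\<close> and \<open>b\<close>.\<close>
  define E1 where "E1 = (\<integral>\<theta>. of_real (\<theta> \<bullet> e) / (z - of_real (\<theta> \<bullet> e)) ^ m \<partial>sphere_surface 0 1)"
  define E2 where "E2 = (\<integral>\<theta>. (1 - z * of_real (\<theta> \<bullet> e)) / (z - of_real (\<theta> \<bullet> e)) ^ n \<partial>sphere_surface 0 1)"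
  define a where "a t = indicator {1..2} t *\<^sub>R (annulus_bump' (t\<^sup>2) * (2 * t))" for t :: real
  define b where "b t = indicator {1..2} t *\<^sub>R (m * annulus_bump (t\<^sup>2) / t)" for t :: real
  have split: "(indicator {0<..} t * t ^ (DIM('a) - 1)) *\<^sub>R (\<integral>\<theta>. g' (t *\<^sub>R \<theta>) \<partial>sphere_surface 0 1)
    = of_real (a t) * E1 + of_real (b t) * E2" for t :: real
  proof (cases "1 \<le> t \<and> t \<le> 2")
    case False
    then have *: "indicator {0<..} t * g' (t *\<^sub>R \<theta>) = 0" if "norm \<theta> = 1" for \<theta>
      using that outside[of "t *\<^sub>R \<theta>"] by (cases "t > 0") (auto simp: g'_def)
    have "AE \<theta> in sphere_surface 0 1. indicator {0<..} t * g' (t *\<^sub>R \<theta>) = 0"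
      by (rule eventually_mono[OF AE_sphere_surface[of 1] *]) simp_all
    then have "(\<integral>\<theta>. indicator {0<..} t * g' (t *\<^sub>R \<theta>) \<partial>sphere_surface 0 1) = 0"
      by (rule integral_eq_zero_AE)
    then have "indicator {0<..} t * (\<integral>\<theta>. g' (t *\<^sub>R \<theta>) \<partial>sphere_surface 0 1) = 0"
      by (simp only: integral_mult_right_zero)
    then show ?thesis using False by (auto simp: a_def b_def indicator_def)
  next
    case True
    have "(indicator {0<..} t * t ^ (DIM('a) - 1)) *\<^sub>R (\<integral>\<theta>. g' (t *\<^sub>R \<theta>) \<partial>sphere_surface 0 1)
      = (\<integral>\<theta>. of_real (t ^ m) * g' (t *\<^sub>R \<theta>) \<partial>sphere_surface 0 1)"
      using True n by (simp add: n_def[symmetric] scaleR_conv_of_real)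
    also have "\<dots> = (\<integral>\<theta>. of_real (a t) * (of_real (\<theta> \<bullet> e) / (z - of_real (\<theta> \<bullet> e)) ^ m)
         + of_real (b t) * ((1 - z * of_real (\<theta> \<bullet> e)) / (z - of_real (\<theta> \<bullet> e)) ^ n) \<partial>sphere_surface 0 1)"
    proof (rule integral_cong_AE)
      show "AE \<theta> in sphere_surface 0 1. of_real (t ^ m) * g' (t *\<^sub>R \<theta>) = of_real (a t) * (of_real (\<theta> \<bullet> e) / (z - of_real (\<theta> \<bullet> e)) ^ m)
         + of_real (b t) * ((1 - z * of_real (\<theta> \<bullet> e)) / (z - of_real (\<theta> \<bullet> e)) ^ n)"
        using AE_sphere_surface[of 1, simplified]
      proof (rule eventually_mono)
        fix \<theta> :: 'a assume \<theta>: "norm \<theta> = 1"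
        define w where "w = z - complex_of_real (\<theta> \<bullet> e)"
        have w: "w \<noteq> 0" using norm_diff_of_real_ge[OF z] by (simp add: w_def)
        have u: "u (t *\<^sub>R \<theta>) = of_real t * w" using True \<theta> by (simp add: u_def w_def algebra_simps)
        have nt: "norm (t *\<^sub>R \<theta>) = t" using True \<theta> by simp
        have ip: "(t *\<^sub>R \<theta>) \<bullet> e = t * (\<theta> \<bullet> e)" by simp
        have at: "a t = annulus_bump' (t\<^sup>2) * (2 * t)" and bt: "b t = m * annulus_bump (t\<^sup>2) / t"
          using True by (auto simp: a_def b_def)
        have t0: "complex_of_real t \<noteq> 0" using True by simp
        have "of_real (t ^ m) * g' (t *\<^sub>R \<theta>) = of_real (annulus_bump' (t\<^sup>2) * (2 * t)) * (of_real (\<theta> \<bullet> e) / w ^ m)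
         + of_real (m * annulus_bump (t\<^sup>2) / t) * ((1 - z * of_real (\<theta> \<bullet> e)) / w ^ n)"
          unfolding g'_def nt u ip n using w t0 True by (simp add: power_mult_distrib divide_simps) (simp add: algebra_simps)
        then show "of_real (t ^ m) * g' (t *\<^sub>R \<theta>) = of_real (a t) * (of_real (\<theta> \<bullet> e) / (z - of_real (\<theta> \<bullet> e)) ^ m)
         + of_real (b t) * ((1 - z * of_real (\<theta> \<bullet> e)) / (z - of_real (\<theta> \<bullet> e)) ^ n)"
          unfolding at bt w_def .
      qed
    qed measurable
    also have "\<dots> = of_real (a t) * E1 + of_real (b t) * E2"
    proof -
      have 1: "integrable (sphere_surface 0 1) (\<lambda>\<theta>. of_real (\<theta> \<bullet> e) / (z - of_real (\<theta> \<bullet> e)) ^ m)"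
        by (rule integrable_sphere_kernel[OF z, where C = 1]) (use xe in \<open>auto, metis\<close>)
      have 2: "integrable (sphere_surface 0 1) (\<lambda>\<theta>. (1 - z * of_real (\<theta> \<bullet> e)) / (z - of_real (\<theta> \<bullet> e)) ^ n)"
      proof (rule integrable_sphere_kernel[OF z, where C = "1 + norm z"])
        fix \<theta> :: 'a assume "norm \<theta> = 1"
        then have "norm (z * of_real (\<theta> \<bullet> e)) \<le> norm z"
          using xe[of \<theta>] by (simp add: norm_mult mult_left_le)
        then show "norm (1 - z * of_real (\<theta> \<bullet> e)) \<le> 1 + norm z"
          using norm_triangle_ineq4[of 1 "z * of_real (\<theta> \<bullet> e)"] by simp
      qed measurable
      show ?thesis unfolding E1_def E2_def
        by (subst Bochner_Integration.integral_add[OF integrable_mult_right[OF 1] integrable_mult_right[OF 2]])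
           (simp only: integral_mult_right_zero)
    qed
    finally show ?thesis .
  qed
  \<comment> \<open>The weight \<open>a\<close> is the derivative of the cutoff along a ray, and the
    cutoff vanishes at both ends. Hence \<open>E1\<close> drops out whatever its value is.\<close>
  have a_int: "has_bochner_integral lborel a 0"
  proof -
    have "has_bochner_integral lborel a (annulus_bump (2\<^sup>2) - annulus_bump (1\<^sup>2))"
      unfolding a_def
    proof (rule has_bochner_integral_FTC_Icc)
      show "((\<lambda>t. annulus_bump (t\<^sup>2)) has_vector_derivative annulus_bump' (x\<^sup>2) * (2 * x)) (at x within {1..2})" for x
        using annulus_bump_deriv_sq[of x]
        by (simp add: has_real_derivative_iff_has_vector_derivative has_vector_derivative_at_within)
    qed (auto intro!: continuous_intros)
    then show ?thesis by (simp add: annulus_bump_eq_0)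
  qed
  have b_int: "integrable lborel b"
    unfolding b_def by (rule borel_integrable_compact) (auto intro!: continuous_intros)
  \<comment> \<open>Positivity of the other weight is certified on a small interval inside (1, 2):
    there the quadratic is at least (5/4)(36/25) = 9/5, the cutoff at least 2, and division by t <=
    8/5 leaves at least 1.\<close>
  have "(\<integral>t. indicator {3/2..8/5::real} t \<partial>lborel) \<le> (\<integral>t. b t \<partial>lborel)"
  proof (rule integral_mono[OF _ b_int])
    show "indicator {3/2..8/5} t \<le> b t" for t :: real
    proof (cases "3/2 \<le> t \<and> t \<le> 8/5")
      case True
      have "(3/2)\<^sup>2 \<le> t\<^sup>2" "t\<^sup>2 \<le> (8/5)\<^sup>2" using True by (auto intro!: power_mono)
      then have "\<tau> = t\<^sup>2 \<Longrightarrow> 9/4 \<le> \<tau> \<and> \<tau> \<le> 64/25" for \<tau> by (simp add: power2_eq_square)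
      then have "(t\<^sup>2 - 1) * (4 - t\<^sup>2) \<ge> (5/4) * (36/25)" by (intro mult_mono) auto
      then have "(max 0 ((t\<^sup>2 - 1) * (4 - t\<^sup>2)))\<^sup>2 \<ge> (9/5)\<^sup>2" by (intro power_mono) auto
      then have "annulus_bump (t\<^sup>2) \<ge> 2" by (simp add: annulus_bump_def power2_eq_square)
      moreover have "real m \<ge> 1" using n n2 by (simp add: n_def)
      ultimately have "m * annulus_bump (t\<^sup>2) \<ge> 1 * 2" by (intro mult_mono) auto
      then have "m * annulus_bump (t\<^sup>2) / t \<ge> 1" using True by (simp add: le_divide_eq)
      with True show ?thesis by (simp add: b_def)
    next
      case False
      have "b t \<ge> 0" by (auto simp: b_def annulus_bump_def indicator_def)
      with False show ?thesis by (auto simp: indicator_def)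
    qed
  qed auto
  then have b_pos: "(\<integral>t. b t \<partial>lborel) > 0" by simp
  have "0 = (\<integral>t. of_real (a t) * E1 + of_real (b t) * E2 \<partial>lborel)"
    using zero unfolding split by simp
  also have "\<dots> = of_real (\<integral>t. a t \<partial>lborel) * E1 + of_real (\<integral>t. b t \<partial>lborel) * E2"
    using a_int b_int by (simp add: has_bochner_integral_iff)
  also have "(\<integral>t. a t \<partial>lborel) = 0" using a_int by (simp add: has_bochner_integral_iff)
  finally have "E2 = 0" using b_pos by simp
  then show ?thesis by (simp add: E2_def n_def)
qed

section \<open>The kernel on the sphere\<close>

definition sphere_kernel :: "'a::euclidean_space \<Rightarrow> nat \<Rightarrow> complex \<Rightarrow> complex" where
  "sphere_kernel e k z = (\<integral>\<theta>. 1 / (z - of_real (\<theta> \<bullet> e)) ^ k \<partial>sphere_surface 0 1)"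

text \<open>The direction \<open>c\<close> is left free because two lines are needed: vertical ones
  (c = i) for the differential equation and the descent from infinity, horizontal ones (c = 1) for
  leaving the imaginary axis.\<close>

lemma sphere_kernel_deriv:
  fixes e :: "'a::euclidean_space"
  assumes w: "Im (z + of_real s0 * c) > 0"
  shows "((\<lambda>s. sphere_kernel e k (z + of_real s * c)) has_vector_derivative
    c * (- of_nat k * sphere_kernel e (Suc k) (z + of_real s0 * c))) (at s0)"
proof -
  define w where "w s = z + of_real s * c" for s :: real
  define d where "d = Im (w s0)"
  have d: "d > 0" using assms by (simp add: d_def w_def)
  \<comment> \<open>Small enough that the imaginary part stays above d/2 on the whole interval; the
    added 1 covers c = 0.\<close>
  define r where "r = d / (2 * (norm c + 1))"
  have r: "r > 0" using d by (simp add: r_def add_nonneg_pos)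
  have ge: "Im (w s) \<ge> d / 2" if "\<bar>s - s0\<bar> < r" for s
  proof -
    have "\<bar>Im (w s) - d\<bar> = \<bar>s - s0\<bar> * \<bar>Im c\<bar>"
      by (simp add: w_def d_def abs_mult[symmetric] algebra_simps)
    also have "\<dots> \<le> r * (norm c + 1)"
      using that abs_Im_le_cmod[of c] by (intro mult_mono) auto
    also have "\<dots> = d / 2"
    proof -
      have "d / (2 * k) * k = d / 2" if "k > 0" for k :: real using that by simp
      then show ?thesis unfolding r_def by (simp only: add_nonneg_pos norm_ge_zero zero_less_one)
    qed
    finally show ?thesis by linarith
  qed
  have "((\<lambda>s. \<integral>\<theta>. 1 / (w s - of_real (\<theta> \<bullet> e)) ^ k \<partial>sphere_surface 0 1) has_vector_derivative
    (\<integral>\<theta>. c * (- of_nat k / (w s0 - of_real (\<theta> \<bullet> e)) ^ Suc k) \<partial>sphere_surface 0 1)) (at s0)"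
  proof (rule has_vector_derivative_integral[OF r, where G = "\<lambda>_. norm c * (k / (d / 2) ^ Suc k)"])
    show "integrable (sphere_surface 0 1) (\<lambda>\<theta>. 1 / (w s - of_real (\<theta> \<bullet> e)) ^ k)" if "\<bar>s - s0\<bar> < r" for s
      by (rule integrable_sphere_kernel[where C = 1]) (use ge[OF that] d in auto)
    show "AE \<theta> in sphere_surface 0 1. \<forall>s. \<bar>s - s0\<bar> < r \<longrightarrow>
       ((\<lambda>s. 1 / (w s - of_real (\<theta> \<bullet> e)) ^ k) has_vector_derivative c * (- of_nat k / (w s - of_real (\<theta> \<bullet> e)) ^ Suc k)) (at s) \<and>
       norm (c * (- of_nat k / (w s - of_real (\<theta> \<bullet> e)) ^ Suc k)) \<le> norm c * (k / (d / 2) ^ Suc k)"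
    proof (intro AE_I2 allI impI conjI)
      fix \<theta> :: 'a and s assume s: "\<bar>s - s0\<bar> < r"
      have Im: "Im (w s) > 0" using ge[OF s] d by simp
      note nz = norm_diff_of_real_ge[OF Im, of "\<theta> \<bullet> e"]
      have "((\<lambda>s. w s - of_real (\<theta> \<bullet> e)) has_vector_derivative c) (at s)"
        unfolding w_def by (auto intro!: derivative_eq_intros)
      from field_vector_diff_chain_at[OF this has_field_derivative_inverse_power[OF nz(2), of k]]
      show "((\<lambda>s. 1 / (w s - of_real (\<theta> \<bullet> e)) ^ k) has_vector_derivative c * (- of_nat k / (w s - of_real (\<theta> \<bullet> e)) ^ Suc k)) (at s)"
        by (simp add: comp_def)
      have "norm (w s - of_real (\<theta> \<bullet> e)) \<ge> d / 2" using nz(1) ge[OF s] by simp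
      then show "norm (c * (- of_nat k / (w s - of_real (\<theta> \<bullet> e)) ^ Suc k)) \<le> norm c * (k / (d / 2) ^ Suc k)"
        unfolding norm_mult norm_divide norm_power norm_minus_cancel norm_of_nat
        using d by (intro mult_left_mono frac_le power_mono) auto
    qed
  qed auto
  moreover have "(\<integral>\<theta>. c * (- of_nat k / (w s0 - of_real (\<theta> \<bullet> e)) ^ Suc k) \<partial>sphere_surface 0 1)
    = c * (- of_nat k * sphere_kernel e (Suc k) (w s0))"
    unfolding sphere_kernel_def integral_mult_right_zero[symmetric]
    by (rule Bochner_Integration.integral_cong) auto
  ultimately show ?thesis
    unfolding sphere_kernel_def[of e k] w_def by simp
qed

lemma Re_one_minus_square: "Re (1 - z\<^sup>2) = 1 - (Re z)\<^sup>2 + (Im z)\<^sup>2"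
  by (simp add: power2_eq_square)

text \<open>In the strip |Re z| < 1 the number 1 - z^2 has positive real part, so the principal
  square root is holomorphic and nonzero along every line used.\<close>

lemma one_minus_square_notin_nonpos:
  assumes "\<bar>Re z\<bar> < 1"
  shows "1 - z\<^sup>2 \<notin> \<real>\<^sub>\<le>\<^sub>0" "csqrt (1 - z\<^sup>2) \<noteq> 0"
proof -
  have "Re (1 - z\<^sup>2) > 0"
    unfolding Re_one_minus_square using assms abs_square_less_1[of "Re z"] by (simp add: add_pos_nonneg)
  then show "1 - z\<^sup>2 \<notin> \<real>\<^sub>\<le>\<^sub>0" by (auto simp: complex_nonpos_Reals_iff)
  then show "csqrt (1 - z\<^sup>2) \<noteq> 0" by auto
qed

text \<open>The divergence identity is an ODE for \<open>sphere_kernel e (n - 1)\<close> along vertical lines;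
  the constant is read off from the behaviour at infinity.\<close>
lemma sphere_kernel_closed_form:
  fixes e :: "'a::euclidean_space"
  assumes n2: "DIM('a) \<ge> 2" and e: "norm e = 1" and h: "\<bar>Re z\<bar> < 1" and Imz: "Im z > 0"
  shows "sphere_kernel e (DIM('a) - 1) z =
    of_real (sigma_area DIM('a)) * (- \<i>) ^ (DIM('a) - 1) / csqrt (1 - z\<^sup>2) ^ (DIM('a) - 1)"
proof -
  obtain m where n: "DIM('a) = Suc m" using n2 by (cases "DIM('a)") auto
  have m: "m \<ge> 1" using n n2 by simp
  define h where "h = Re z"
  have h1: "\<bar>h\<bar> < 1" using h by (simp add: h_def)
  define \<zeta> where "\<zeta> \<eta> = of_real h + of_real \<eta> * \<i>" for \<eta> :: real
  have \<zeta>: "Re (\<zeta> \<eta>) = h" "Im (\<zeta> \<eta>) = \<eta>" for \<eta> by (auto simp: \<zeta>_def)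
  define W where "W \<eta> = csqrt (1 - (\<zeta> \<eta>)\<^sup>2)" for \<eta>
  define J where "J \<eta> = sphere_kernel e m (\<zeta> \<eta>)" for \<eta>
  \<comment> \<open>The differential equation says that J is a constant multiple of W^(-m), so this
    product is its conserved quantity.\<close>
  define Q where "Q \<eta> = J \<eta> * W \<eta> ^ m" for \<eta>
  have W2: "W \<eta> ^ 2 = 1 - (\<zeta> \<eta>)\<^sup>2" for \<eta> by (simp add: W_def)
  have W0: "W \<eta> \<noteq> 0" for \<eta>
    unfolding W_def using h1 by (intro one_minus_square_notin_nonpos) (simp add: \<zeta>)
  have Q': "(Q has_vector_derivative 0) (at \<eta>)" if "\<eta> > 0" for \<eta>
  proof -
    define K where "K = sphere_kernel e (Suc m) (\<zeta> \<eta>)"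
    have J': "(J has_vector_derivative \<i> * (- of_nat m * K)) (at \<eta>)"
      unfolding J_def \<zeta>_def K_def by (rule sphere_kernel_deriv) (use that in simp)
    have "((\<lambda>\<eta>. 1 - (\<zeta> \<eta>)\<^sup>2) has_vector_derivative - (2 * \<zeta> \<eta> * \<i>)) (at \<eta>)"
    proof -
      have "(\<zeta> has_vector_derivative \<i>) (at \<eta>)"
        unfolding \<zeta>_def by (auto intro!: derivative_eq_intros)
      moreover have "((\<lambda>z. 1 - z\<^sup>2) has_field_derivative - (2 * \<zeta> \<eta>)) (at (\<zeta> \<eta>))"
        by (auto intro!: derivative_eq_intros)
      ultimately have "((\<lambda>z. 1 - z\<^sup>2) \<circ> \<zeta> has_vector_derivative \<i> * (- (2 * \<zeta> \<eta>))) (at \<eta>)"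
        by (rule field_vector_diff_chain_at)
      then show ?thesis by (simp add: comp_def mult_ac)
    qed
    moreover have "((\<lambda>w. csqrt w ^ m) has_field_derivative of_nat m * W \<eta> ^ (m - 1) * (1 / (2 * W \<eta>))) (at (1 - (\<zeta> \<eta>)\<^sup>2))"
      unfolding W_def
      using one_minus_square_notin_nonpos(1)[of "\<zeta> \<eta>"] h1
      by (auto intro!: derivative_eq_intros simp: \<zeta> field_simps)
    ultimately have "((\<lambda>w. csqrt w ^ m) \<circ> (\<lambda>\<eta>. 1 - (\<zeta> \<eta>)\<^sup>2) has_vector_derivative
        - (2 * \<zeta> \<eta> * \<i>) * (of_nat m * W \<eta> ^ (m - 1) * (1 / (2 * W \<eta>)))) (at \<eta>)"
      by (rule field_vector_diff_chain_at)
    then have W': "((\<lambda>\<eta>. W \<eta> ^ m) has_vector_derivative - (2 * \<zeta> \<eta> * \<i>) * (of_nat m * W \<eta> ^ (m - 1) * (1 / (2 * W \<eta>)))) (at \<eta>)"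
      by (simp add: comp_def W_def)
    have ode: "(1 - (\<zeta> \<eta>)\<^sup>2) * K + \<zeta> \<eta> * J \<eta> = 0"
    proof -
      have Im: "Im (\<zeta> \<eta>) > 0" using that by (simp add: \<zeta>)
      have int: "integrable (sphere_surface 0 1) (\<lambda>\<theta>. 1 / (\<zeta> \<eta> - of_real (\<theta> \<bullet> e)) ^ k)" for k
        by (rule integrable_sphere_kernel[where C = 1]) (use Im in auto)
      have "(1 - (\<zeta> \<eta>)\<^sup>2) * K + \<zeta> \<eta> * J \<eta> =
        (\<integral>\<theta>. (1 - (\<zeta> \<eta>)\<^sup>2) * (1 / (\<zeta> \<eta> - of_real (\<theta> \<bullet> e)) ^ Suc m) + \<zeta> \<eta> * (1 / (\<zeta> \<eta> - of_real (\<theta> \<bullet> e)) ^ m) \<partial>sphere_surface 0 1)"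
        unfolding K_def J_def sphere_kernel_def
        by (subst Bochner_Integration.integral_add[OF integrable_mult_right[OF int] integrable_mult_right[OF int]])
           (simp only: integral_mult_right_zero)
      \<comment> \<open>With w = \<theta> . e, the numerator splits as 1 - \<zeta> w = (1 -
        \<zeta>^2) + \<zeta> (\<zeta> - w), which turns the divergence identity into a relation
        between the kernels of orders n and n - 1.\<close>
      also have "\<dots> = (\<integral>\<theta>. (1 - \<zeta> \<eta> * of_real (\<theta> \<bullet> e)) / (\<zeta> \<eta> - of_real (\<theta> \<bullet> e)) ^ DIM('a) \<partial>sphere_surface 0 1)"
      proof (rule Bochner_Integration.integral_cong[OF refl])
        fix \<theta> :: 'a
        have "\<zeta> \<eta> - of_real (\<theta> \<bullet> e) \<noteq> 0" using norm_diff_of_real_ge[OF Im] by simp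
        then show "(1 - (\<zeta> \<eta>)\<^sup>2) * (1 / (\<zeta> \<eta> - of_real (\<theta> \<bullet> e)) ^ Suc m) + \<zeta> \<eta> * (1 / (\<zeta> \<eta> - of_real (\<theta> \<bullet> e)) ^ m)
          = (1 - \<zeta> \<eta> * of_real (\<theta> \<bullet> e)) / (\<zeta> \<eta> - of_real (\<theta> \<bullet> e)) ^ DIM('a)"
          unfolding n by (simp add: divide_simps) (simp add: algebra_simps power2_eq_square)
      qed
      also have "\<dots> = 0" by (rule sphere_kernel_divergence[OF Im e n2])
      finally show ?thesis .
    qed
    obtain k where k: "m = Suc k" using m by (cases m) auto
    have "J \<eta> * (- (2 * \<zeta> \<eta> * \<i>) * (of_nat m * W \<eta> ^ (m - 1) * (1 / (2 * W \<eta>)))) + \<i> * (- of_nat m * K) * W \<eta> ^ m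
      = - \<i> * of_nat m * W \<eta> ^ k / W \<eta> * (W \<eta> ^ 2 * K + \<zeta> \<eta> * J \<eta>)"
      using W0[of \<eta>] by (simp add: k field_simps power2_eq_square)
    also have "\<dots> = 0" using ode unfolding W2 by simp
    finally show ?thesis
      using has_vector_derivative_mult[OF J' W'] unfolding Q_def by (simp add: mult_ac)
  qed
  have const: "Q \<eta> = Q 1" if "\<eta> > 0" for \<eta>
    using vector_derivative_bound[of "{0<..}" Q "\<lambda>_. 0" 0 \<eta> 1] Q' that by simp
  \<comment> \<open>High up on the vertical line the quotient of \<eta> by \<zeta> - \<theta> . e
    tends to 1/i = -i for every \<theta>, and the total mass of the sphere is
    \<open>sigma_area\<close>.\<close>
  have limJ: "((\<lambda>\<eta>. of_real \<eta> ^ m * J \<eta>) \<longlongrightarrow> of_real (sigma_area DIM('a)) * (- \<i>) ^ m) at_top"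
  proof -
    have "((\<lambda>\<eta>. \<integral>\<theta>. (of_real \<eta> / (\<zeta> \<eta> - of_real (\<theta> \<bullet> e))) ^ m \<partial>sphere_surface 0 1) \<longlongrightarrow>
      (\<integral>\<theta>. (- \<i>) ^ m \<partial>(sphere_surface 0 1 :: 'a measure))) at_top"
    proof (rule integral_dominated_convergence_at_top[where w = "\<lambda>_. 1"])
      show "\<forall>\<^sub>F \<eta> in at_top. AE \<theta> in sphere_surface 0 1. norm ((of_real \<eta> / (\<zeta> \<eta> - of_real (\<theta> \<bullet> e))) ^ m) \<le> 1"
        using eventually_gt_at_top[of 0]
      proof (eventually_elim, intro AE_I2)
        fix \<eta> :: real and \<theta> :: 'a assume \<eta>: "\<eta> > 0"
        have "norm (\<zeta> \<eta> - of_real (\<theta> \<bullet> e)) \<ge> \<eta>"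
          using norm_diff_of_real_ge(1)[of "\<zeta> \<eta>" "\<theta> \<bullet> e"] \<eta> by (simp add: \<zeta>)
        then show "norm ((of_real \<eta> / (\<zeta> \<eta> - of_real (\<theta> \<bullet> e))) ^ m) \<le> 1"
          unfolding norm_power norm_divide using \<eta> by (intro power_le_one) (auto simp: divide_le_eq)
      qed
      show "AE \<theta> in sphere_surface 0 1. ((\<lambda>\<eta>. (of_real \<eta> / (\<zeta> \<eta> - of_real (\<theta> \<bullet> e))) ^ m) \<longlongrightarrow> (- \<i>) ^ m) at_top"
      proof (intro AE_I2 tendsto_power)
        fix \<theta> :: 'a
        have "((\<lambda>\<eta>. 1 / (of_real ((h - \<theta> \<bullet> e) / \<eta>) + \<i>)) \<longlongrightarrow> 1 / (of_real 0 + \<i>)) at_top"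
          by (intro tendsto_intros tendsto_divide_0[OF tendsto_const] filterlim_at_top_imp_at_infinity filterlim_ident) auto
        moreover have "\<forall>\<^sub>F \<eta> in at_top. 1 / (of_real ((h - \<theta> \<bullet> e) / \<eta>) + \<i>) = of_real \<eta> / (\<zeta> \<eta> - of_real (\<theta> \<bullet> e))"
          using eventually_gt_at_top[of 0]
        proof eventually_elim
          fix \<eta> :: real assume "\<eta> > 0"
          then have "of_real ((h - \<theta> \<bullet> e) / \<eta>) + \<i> = (\<zeta> \<eta> - of_real (\<theta> \<bullet> e)) / of_real \<eta>"
            by (simp add: \<zeta>_def field_simps)
          then show "1 / (of_real ((h - \<theta> \<bullet> e) / \<eta>) + \<i>) = of_real \<eta> / (\<zeta> \<eta> - of_real (\<theta> \<bullet> e))" by simp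
        qed
        ultimately show "((\<lambda>\<eta>. of_real \<eta> / (\<zeta> \<eta> - of_real (\<theta> \<bullet> e))) \<longlongrightarrow> - \<i>) at_top"
          by (simp add: filterlim_cong[OF refl refl])
      qed
    qed (auto simp: \<zeta>_def)
    moreover have "(\<integral>\<theta>. (of_real \<eta> / (\<zeta> \<eta> - of_real (\<theta> \<bullet> e))) ^ m \<partial>sphere_surface 0 1) = of_real \<eta> ^ m * J \<eta>" for \<eta>
      unfolding J_def sphere_kernel_def integral_mult_right_zero[symmetric] by (simp add: power_divide)
    moreover have "(\<integral>\<theta>. (- \<i>) ^ m \<partial>(sphere_surface 0 1 :: 'a measure)) = of_real (sigma_area DIM('a)) * (- \<i>) ^ m"
      by (simp add: measure_sphere_surface_1 scaleR_conv_of_real)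
    ultimately show ?thesis by simp
  qed
  have limW: "((\<lambda>\<eta>. W \<eta> / of_real \<eta>) \<longlongrightarrow> 1) at_top"
  proof -
    have "((\<lambda>\<eta>. W \<eta> / of_real \<eta> - 1) \<longlongrightarrow> 0) at_top"
    proof (rule Lim_null_comparison)
      show "((\<lambda>\<eta>::real. 1 / \<eta> / \<eta> + \<bar>h\<bar> / \<eta>) \<longlongrightarrow> 0) at_top"
        by (rule tendsto_eq_intros tendsto_divide_0[OF tendsto_const] real_tendsto_divide_at_top[where c = 0]
             filterlim_at_top_imp_at_infinity filterlim_ident refl | simp)+
      show "\<forall>\<^sub>F \<eta> in at_top. norm (W \<eta> / of_real \<eta> - 1) \<le> 1 / \<eta> / \<eta> + \<bar>h\<bar> / \<eta>"
        using eventually_gt_at_top[of 0]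
      proof eventually_elim
        fix \<eta> :: real assume \<eta>: "\<eta> > 0"
        \<comment> \<open>Since Re W >= 0 for the principal root, the second factor has modulus at
          least \<eta>, so the first is at most 1/\<eta>. This selects the branch W ~ -i \<zeta> ~
          \<eta> at infinity.\<close>
        have prod: "(W \<eta> + \<i> * \<zeta> \<eta>) * (W \<eta> - \<i> * \<zeta> \<eta>) = 1"
          using W2[of \<eta>] by (simp add: algebra_simps power2_eq_square)
        have "Re (W \<eta>) \<ge> 0" unfolding W_def by (rule Re_csqrt)
        then have "\<eta> \<le> Re (W \<eta> - \<i> * \<zeta> \<eta>)" by (simp add: \<zeta>)
        also have "\<dots> \<le> norm (W \<eta> - \<i> * \<zeta> \<eta>)" by (rule complex_Re_le_cmod)
        finally have ge: "\<eta> \<le> norm (W \<eta> - \<i> * \<zeta> \<eta>)" .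
        have "norm (W \<eta> + \<i> * \<zeta> \<eta>) * \<eta> \<le> norm (W \<eta> + \<i> * \<zeta> \<eta>) * norm (W \<eta> - \<i> * \<zeta> \<eta>)"
          using ge by (rule mult_left_mono) simp
        also have "\<dots> = 1" using prod by (simp add: norm_mult[symmetric])
        finally have le: "norm (W \<eta> + \<i> * \<zeta> \<eta>) \<le> 1 / \<eta>" using \<eta> by (simp add: field_simps)
        have "W \<eta> / of_real \<eta> - 1 = (W \<eta> + \<i> * \<zeta> \<eta>) / of_real \<eta> - \<i> * of_real h / of_real \<eta>"
          using \<eta> by (simp add: \<zeta>_def field_simps)
        also have "norm \<dots> \<le> norm ((W \<eta> + \<i> * \<zeta> \<eta>) / of_real \<eta>) + norm (\<i> * of_real h / of_real \<eta>)"
          by (rule norm_triangle_ineq4)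
        also have "\<dots> \<le> 1 / \<eta> / \<eta> + \<bar>h\<bar> / \<eta>"
          using divide_right_mono[OF le, of \<eta>] \<eta> by (simp add: norm_divide norm_mult)
        finally show "norm (W \<eta> / of_real \<eta> - 1) \<le> 1 / \<eta> / \<eta> + \<bar>h\<bar> / \<eta>" .
      qed
    qed
    then show ?thesis by (simp add: Lim_null[symmetric])
  qed
  have "((\<lambda>\<eta>. (of_real \<eta> ^ m * J \<eta>) * (W \<eta> / of_real \<eta>) ^ m) \<longlongrightarrow> of_real (sigma_area DIM('a)) * (- \<i>) ^ m * 1 ^ m) at_top"
    by (intro tendsto_mult limJ tendsto_power limW)
  moreover have "\<forall>\<^sub>F \<eta> in at_top. (of_real \<eta> ^ m * J \<eta>) * (W \<eta> / of_real \<eta>) ^ m = Q 1"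
    using eventually_gt_at_top[of 0]
  proof eventually_elim
    fix \<eta> :: real assume "\<eta> > 0"
    then show "(of_real \<eta> ^ m * J \<eta>) * (W \<eta> / of_real \<eta>) ^ m = Q 1"
      using const[of \<eta>] by (simp add: Q_def power_divide)
  qed
  ultimately have "((\<lambda>\<eta>::real. Q 1) \<longlongrightarrow> of_real (sigma_area DIM('a)) * (- \<i>) ^ m) at_top"
    by (simp add: filterlim_cong[OF refl refl])
  then have "Q 1 = of_real (sigma_area DIM('a)) * (- \<i>) ^ m"
    by (simp add: tendsto_const_iff)
  then have "J (Im z) * W (Im z) ^ m = of_real (sigma_area DIM('a)) * (- \<i>) ^ m"
    using const[OF Imz] by (simp add: Q_def)
  moreover have "\<zeta> (Im z) = z" by (simp add: \<zeta>_def h_def complex_eq_iff)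
  ultimately show ?thesis
    using W0[of "Im z"] unfolding n J_def W_def by (simp add: field_simps)
qed

text \<open>Half of the beta value B(1/2, (m-1)/2), which is the integral of (1 + u^2)^(-m/2) over u
  > 0.\<close>

definition beta_const :: "nat \<Rightarrow> real" where
  "beta_const m = sqrt pi * Gamma ((real m - 1) / 2) / (2 * Gamma (real m / 2))"

lemma sqrt_1_plus_pos: "sqrt (1 + u\<^sup>2) > (0::real)"
  by (simp add: add_pos_nonneg)

lemma deriv_sqrt_1_plus:
  "((\<lambda>u. sqrt (1 + u\<^sup>2)) has_real_derivative u / sqrt (1 + u\<^sup>2)) (at u)"
proof -
  have "1 + u\<^sup>2 > 0" by (simp add: add_pos_nonneg)
  then show ?thesis by (auto intro!: derivative_eq_intros simp: field_simps)
qed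

lemma sqrt_1_plus_tendsto: "filterlim (\<lambda>u::real. sqrt (1 + u\<^sup>2)) at_top at_top"
  by (rule filterlim_at_top_mono[OF filterlim_ident])
     (auto intro!: always_eventually real_le_rsqrt)

lemma ratio_tendsto_1: "((\<lambda>u::real. u / sqrt (1 + u\<^sup>2)) \<longlongrightarrow> 1) at_top"
proof -
  have "((\<lambda>u::real. 1 / sqrt ((1 / u)\<^sup>2 + 1)) \<longlongrightarrow> 1 / sqrt (0\<^sup>2 + 1)) at_top"
    by (intro tendsto_intros tendsto_divide_0[OF tendsto_const] filterlim_at_top_imp_at_infinity filterlim_ident) auto
  moreover have "\<forall>\<^sub>F u in at_top. 1 / sqrt ((1 / u)\<^sup>2 + 1) = u / sqrt (1 + u\<^sup>2)"
    using eventually_gt_at_top[of 0]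
  proof eventually_elim
    fix u :: real assume u: "u > 0"
    have "(1 / u)\<^sup>2 + 1 = (1 + u\<^sup>2) / u\<^sup>2" using u by (simp add: field_simps)
    then show "1 / sqrt ((1 / u)\<^sup>2 + 1) = u / sqrt (1 + u\<^sup>2)"
      using u by (simp add: real_sqrt_divide)
  qed
  ultimately show ?thesis by (simp add: filterlim_cong[OF refl refl])
qed

text \<open>Reduction in steps of two: an antiderivative for k + 2 is ((k - 1) B_k + u (1 +
  u^2)^(-k/2)) / k, starting from arctan for 2 and u / sqrt(1 + u^2) for 3. Only an antiderivative
  and its limit are used later, so no improper integral is formed.\<close>

lemma ex_antiderivative_inverse_sqrt_power:
  assumes "m \<ge> 2"
  shows "\<exists>B. (\<forall>u. (B has_real_derivative 1 / sqrt (1 + u\<^sup>2) ^ m) (at u)) \<and> B 0 = 0 \<and> (B \<longlongrightarrow> beta_const m) at_top"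
  using assms
proof (induction m rule: less_induct)
  case (less m)
  consider "m = 2" | "m = 3" | k where "m = k + 2" "k \<ge> 2"
  proof -
    have "m = 2 \<or> m = 3 \<or> (m = (m - 2) + 2 \<and> m - 2 \<ge> 2)" using less.prems by arith
    then show thesis using that by blast
  qed
  then show ?case
  proof cases
    case 1
    have b2: "beta_const 2 = pi / 2" by (simp add: beta_const_def Gamma_one_half_real)
    have "(arctan has_real_derivative 1 / sqrt (1 + u\<^sup>2) ^ 2) (at u)" for u
      by (auto intro!: derivative_eq_intros simp: add_nonneg_nonneg field_simps)
    then show ?thesis unfolding 1 b2 using tendsto_arctan_at_top by (intro exI[of _ arctan]) simp
  next
    case 2
    have G: "Gamma (3/2 :: real) = sqrt pi / 2"
      using Gamma_plus1[of "1/2 :: real"] nonpos_Ints_nonpos[of "1/2 :: real"]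
      by (auto simp: Gamma_one_half_real)
    have b3: "beta_const 3 = 1" by (simp add: beta_const_def G)
    have "((\<lambda>u. u / sqrt (1 + u\<^sup>2)) has_real_derivative 1 / sqrt (1 + u\<^sup>2) ^ 3) (at u)" for u :: real
    proof -
      define q where "q = sqrt (1 + u\<^sup>2)"
      have q: "q > 0" "q\<^sup>2 = 1 + u\<^sup>2" using sqrt_1_plus_pos by (auto simp: q_def add_nonneg_nonneg)
      have "((\<lambda>u. u / sqrt (1 + u\<^sup>2)) has_real_derivative (1 * sqrt (1 + u\<^sup>2) - u * (u / sqrt (1 + u\<^sup>2))) / (sqrt (1 + u\<^sup>2) * sqrt (1 + u\<^sup>2))) (at u)"
        by (rule DERIV_divide[OF DERIV_ident deriv_sqrt_1_plus]) (use sqrt_1_plus_pos[of u] in simp)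
      also have "(1 * sqrt (1 + u\<^sup>2) - u * (u / sqrt (1 + u\<^sup>2))) / (sqrt (1 + u\<^sup>2) * sqrt (1 + u\<^sup>2)) = (q\<^sup>2 - u\<^sup>2) / q ^ 3"
        unfolding q_def[symmetric] using q(1) by (simp add: field_simps power2_eq_square power3_eq_cube)
      finally show ?thesis unfolding q(2) by (simp add: q_def)
    qed
    then show ?thesis unfolding 2 b3 using ratio_tendsto_1
      by (intro exI[of _ "\<lambda>u. u / sqrt (1 + u\<^sup>2)"]) auto
  next
    case 3
    then obtain B where B: "\<And>u. (B has_real_derivative 1 / sqrt (1 + u\<^sup>2) ^ k) (at u)" "B 0 = 0"
      "(B \<longlongrightarrow> beta_const k) at_top"
      using less.IH[of k] by auto
    define B2 where "B2 u = ((real k - 1) * B u + u * (1 / sqrt (1 + u\<^sup>2) ^ k)) / k" for u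
    have k: "real k > 1" using 3 by simp
    have "(B2 has_real_derivative 1 / sqrt (1 + u\<^sup>2) ^ m) (at u)" for u
    proof -
      define q where "q = sqrt (1 + u\<^sup>2)"
      have q: "q > 0" "q\<^sup>2 = 1 + u\<^sup>2" using sqrt_1_plus_pos by (auto simp: q_def add_nonneg_nonneg)
      have "((\<lambda>u. 1 / sqrt (1 + u\<^sup>2) ^ k) has_real_derivative (- real k / q ^ Suc k) * (u / q)) (at u)"
        using DERIV_chain2[OF has_field_derivative_inverse_power deriv_sqrt_1_plus, of u k] q by (simp add: q_def)
      note H = this
      have "(B2 has_real_derivative ((real k - 1) * (1 / q ^ k) + (u * ((- real k / q ^ Suc k) * (u / q)) + 1 / q ^ k)) / k) (at u)"
        unfolding B2_def
        by (rule DERIV_cong[OF DERIV_cdivide[OF DERIV_add[OF DERIV_cmult[OF B(1)] DERIV_mult[OF DERIV_ident H]]]])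
           (simp add: q_def mult.commute)
      also have "((real k - 1) * (1 / q ^ k) + (u * ((- real k / q ^ Suc k) * (u / q)) + 1 / q ^ k)) / k = (q\<^sup>2 - u\<^sup>2) / q ^ m"
        using q(1) k unfolding 3 by (simp add: field_simps power2_eq_square)
      finally show ?thesis unfolding q(2) by (simp add: q_def)
    qed
    moreover have "B2 0 = 0" by (simp add: B2_def B(2))
    moreover have "(B2 \<longlongrightarrow> beta_const m) at_top"
    proof -
      obtain j where j: "k = Suc j" "j \<ge> 1" using 3 by (cases k) auto
      have "((\<lambda>u. u / sqrt (1 + u\<^sup>2) * (1 / sqrt (1 + u\<^sup>2) ^ j)) \<longlongrightarrow> 1 * 0) at_top"
        by (intro tendsto_mult ratio_tendsto_1 real_tendsto_divide_at_top[OF tendsto_const] filterlim_pow_at_top sqrt_1_plus_tendsto)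
           (use j in simp)
      then have "((\<lambda>u. u * (1 / sqrt (1 + u\<^sup>2) ^ k)) \<longlongrightarrow> 0) at_top" by (simp add: j)
      then have "(B2 \<longlongrightarrow> ((real k - 1) * beta_const k + 0) / k) at_top"
        unfolding B2_def using k B(3) by (intro tendsto_intros) auto
      moreover have "((real k - 1) * beta_const k + 0) / k = beta_const m"
      proof -
        have 1: "Gamma ((real k - 1) / 2 + 1) = (real k - 1) / 2 * Gamma ((real k - 1) / 2)"
          using nonpos_Ints_nonpos[of "(real k - 1) / 2"] k by (intro Gamma_plus1) auto
        have 2: "Gamma (real k / 2 + 1) = real k / 2 * Gamma (real k / 2)"
          using nonpos_Ints_nonpos[of "real k / 2"] k by (intro Gamma_plus1) auto
        have 3: "(real m - 1) / 2 = (real k - 1) / 2 + 1" "real m / 2 = real k / 2 + 1" by (auto simp: 3 field_simps)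
        have "Gamma (real k / 2) > 0" using k by (intro Gamma_real_pos) auto
        then show ?thesis unfolding beta_const_def 3 1 2 using k by (simp add: field_simps)
      qed
      ultimately show ?thesis by simp
    qed
    ultimately show ?thesis by blast
  qed
qed

section \<open>Bounds and boundary values of the kernel above the interval (-1, 1)\<close>

lemma abs_Im_power_le: "\<bar>Im (v ^ m)\<bar> \<le> m * norm v ^ (m - 1) * \<bar>Im v\<bar>"
proof (induction m)
  case (Suc m)
  have "\<bar>Im (v ^ Suc m)\<bar> \<le> \<bar>Re v\<bar> * \<bar>Im (v ^ m)\<bar> + \<bar>Im v\<bar> * \<bar>Re (v ^ m)\<bar>"
    by (simp flip: abs_mult)
  also have "\<dots> \<le> norm v * (m * norm v ^ (m - 1) * \<bar>Im v\<bar>) + \<bar>Im v\<bar> * norm v ^ m"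
    using Suc abs_Re_le_cmod[of "v ^ m"]
    by (intro add_mono mult_mono abs_Re_le_cmod) (auto simp: norm_power)
  also have "\<dots> = Suc m * norm v ^ (Suc m - 1) * \<bar>Im v\<bar>"
    by (cases m) (auto simp: algebra_simps)
  finally show ?case .
qed simp

text \<open>\<open>normalized_kernel\<close> is \<open>sphere_kernel e (n - 2)\<close> divided by the unit \<open>\<i> (- \<i>)\<^bsup>n - 1\<^esup>\<close>,
  so that its real part is the part of the kernel having constant boundary values on \<open>(-1, 1)\<close>.\<close>
definition normalized_kernel :: "'a::euclidean_space \<Rightarrow> complex \<Rightarrow> complex" where
  "normalized_kernel e z = sphere_kernel e (DIM('a) - 2) z / (\<i> * (- \<i>) ^ (DIM('a) - 1))"

text \<open>Insert the closed form of the kernel of order n - 1; the unit in the normalisation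
  cancels all powers of -i except one factor i. As Im z tends to 0 the root becomes real, so along
  horizontal lines the derivative becomes purely imaginary and the real part becomes
  constant.\<close>

lemma normalized_kernel_deriv:
  fixes e :: "'a::euclidean_space"
  assumes n3: "DIM('a) \<ge> 3" and e: "norm e = 1"
    and w: "\<bar>Re (z + of_real s0 * c)\<bar> < 1" "Im (z + of_real s0 * c) > 0"
  shows "((\<lambda>s. normalized_kernel e (z + of_real s * c)) has_vector_derivative
    c * (\<i> * of_real ((DIM('a) - 2) * sigma_area DIM('a)) / csqrt (1 - (z + of_real s0 * c)\<^sup>2) ^ (DIM('a) - 1))) (at s0)"
proof -
  define m where "m = DIM('a) - 2"
  have n: "DIM('a) = Suc (Suc m)" using n3 by (simp add: m_def)
  define w where "w = z + of_real s0 * c"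
  have "((\<lambda>s. sphere_kernel e m (z + of_real s * c) / (\<i> * (- \<i>) ^ Suc m)) has_vector_derivative
     (c * (- of_nat m * sphere_kernel e (Suc m) w)) / (\<i> * (- \<i>) ^ Suc m)) (at s0)"
    using sphere_kernel_deriv[OF w(2), of e m] unfolding w_def by (rule has_vector_derivative_divide)
  moreover have "sphere_kernel e (Suc m) w = of_real (sigma_area DIM('a)) * (- \<i>) ^ Suc m / csqrt (1 - w\<^sup>2) ^ Suc m"
    using sphere_kernel_closed_form[of e w] n n3 e assms(3,4) by (simp add: w_def)
  ultimately show ?thesis
    unfolding normalized_kernel_def n w_def[symmetric] by (simp add: field_simps)
qed

lemma norm_sphere_kernel_le:
  fixes e :: "'a::euclidean_space"
  assumes "Im z > 0"
  shows "norm (sphere_kernel e k z) \<le> sigma_area DIM('a) / Im z ^ k"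
proof -
  have "norm (sphere_kernel e k z) \<le> (\<integral>\<theta>. 1 / Im z ^ k \<partial>(sphere_surface 0 1 :: 'a measure))"
    unfolding sphere_kernel_def
  proof (rule order_trans[OF integral_norm_bound integral_mono])
    show "integrable (sphere_surface 0 1) (\<lambda>\<theta>. norm (1 / (z - of_real (\<theta> \<bullet> e)) ^ k))"
      by (rule integrable_norm, rule integrable_sphere_kernel[where C = 1]) (use assms in auto)
    show "norm (1 / (z - of_real (\<theta> \<bullet> e)) ^ k) \<le> 1 / Im z ^ k" for \<theta>
      unfolding norm_divide norm_power
      using norm_diff_of_real_ge(1)[OF assms, of "\<theta> \<bullet> e"] assms by (intro frac_le power_mono) auto
  qed auto
  then show ?thesis by (simp add: measure_sphere_surface_1)
qed

text \<open>Let w be the root and d = sqrt(1 - h^2). Real parts of w^2 = 1 - z^2 give (Re w)^2 >=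
  d^2, and the principal branch makes this Re w >= d. Imaginary parts give Re w Im w = - Re z Im z,
  so |Im w| <= Im z / d: the imaginary part of 1/w vanishes linearly with Im z.\<close>

lemma csqrt_strip_bounds:
  assumes h: "\<bar>Re z\<bar> \<le> h" "h < 1" and c: "c = 1 / sqrt (1 - h\<^sup>2)" and Im: "Im z > 0"
  defines "v \<equiv> 1 / csqrt (1 - z\<^sup>2)"
  shows "norm v \<le> c" "\<bar>Im v\<bar> \<le> Im z * c ^ 3"
proof -
  define w where "w = csqrt (1 - z\<^sup>2)"
  define d where "d = sqrt (1 - h\<^sup>2)"
  have "h\<^sup>2 < 1" using h abs_square_less_1[of h] by simp
  then have d: "d > 0" "d\<^sup>2 = 1 - h\<^sup>2" by (auto simp: d_def)
  have w2: "w\<^sup>2 = 1 - z\<^sup>2" by (simp add: w_def)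
  have "d\<^sup>2 \<le> 1 - (Re z)\<^sup>2 + (Im z)\<^sup>2"
    using h power_mono[of "\<bar>Re z\<bar>" h 2] d by (simp add: power2_abs add_increasing2)
  also have "\<dots> = (Re w)\<^sup>2 - (Im w)\<^sup>2"
    using arg_cong[OF w2, of Re] by (simp add: power2_eq_square)
  finally have "d\<^sup>2 \<le> (Re w)\<^sup>2" using zero_le_power2[of "Im w"] by linarith
  then have Rew: "d \<le> Re w" using Re_csqrt[of "1 - z\<^sup>2"] unfolding w_def[symmetric] by (rule power2_le_imp_le)
  then have nw: "d \<le> norm w" using complex_Re_le_cmod[of w] by linarith
  show "norm v \<le> c"
    unfolding v_def c d_def[symmetric] w_def[symmetric] norm_divide using nw d by (intro frac_le) auto
  have "Re w * Im w = - (Re z * Im z)" using arg_cong[OF w2, of Im] by (simp add: power2_eq_square mult.commute)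
  then have "Re w * \<bar>Im w\<bar> = \<bar>Re z\<bar> * Im z"
    using Rew d Im by (metis abs_minus_cancel abs_mult abs_of_pos order_less_le_trans)
  also have "\<dots> \<le> 1 * Im z" using h Im by (intro mult_right_mono) auto
  finally have "Re w * \<bar>Im w\<bar> \<le> Im z" by simp
  then have "d * \<bar>Im w\<bar> \<le> Im z" using mult_right_mono[OF Rew, of "\<bar>Im w\<bar>"] by simp
  then have Imw: "\<bar>Im w\<bar> \<le> Im z / d" using d by (simp add: field_simps)
  have "\<bar>Im v\<bar> = \<bar>Im w\<bar> / (norm w)\<^sup>2"
    unfolding v_def w_def[symmetric] by (simp add: Im_divide cmod_power2 abs_divide)
  also have "\<dots> \<le> (Im z / d) / d\<^sup>2" using Imw nw d(1) Im by (intro frac_le power_mono) auto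
  also have "\<dots> = Im z * c ^ 3" unfolding c d_def[symmetric] by (simp add: power_divide power2_eq_square power3_eq_cube)
  finally show "\<bar>Im v\<bar> \<le> Im z * c ^ 3" .
qed

text \<open>On the imaginary axis 1 - z^2 = 1 + \<eta>^2 is positive, so the derivative in \<eta> is
  real, namely a negative multiple of the beta integrand. The constant of integration comes from the
  decay of the kernel at infinity.\<close>

lemma normalized_kernel_imaginary_axis:
  fixes e :: "'a::euclidean_space"
  assumes n3: "DIM('a) \<ge> 3" and e: "norm e = 1" and "\<eta> > 0"
    and B: "\<And>u. (B has_real_derivative 1 / sqrt (1 + u\<^sup>2) ^ (DIM('a) - 1)) (at u)"
    and lim: "(B \<longlongrightarrow> b) at_top"
  shows "normalized_kernel e (of_real \<eta> * \<i>) = of_real ((DIM('a) - 2) * sigma_area DIM('a) * (b - B \<eta>))"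
proof -
  define C where "C = (DIM('a) - 2) * sigma_area DIM('a)"
  define Q where "Q \<eta> = normalized_kernel e (0 + of_real \<eta> * \<i>) + of_real (C * B \<eta>)" for \<eta>
  have Q': "(Q has_vector_derivative 0) (at \<eta>)" if "\<eta> > 0" for \<eta>
  proof -
    have eq: "1 - (0 + of_real \<eta> * \<i>)\<^sup>2 = of_real (1 + \<eta>\<^sup>2)" by (simp add: power_mult_distrib)
    have cs: "csqrt (1 - (0 + of_real \<eta> * \<i>)\<^sup>2) = of_real (sqrt (1 + \<eta>\<^sup>2))"
      unfolding eq by (subst csqrt_of_real_nonneg) (simp_all add: add_nonneg_nonneg del: of_real_add)
    have "((\<lambda>\<eta>. normalized_kernel e (0 + of_real \<eta> * \<i>)) has_vector_derivative
      \<i> * (\<i> * of_real C / csqrt (1 - (0 + of_real \<eta> * \<i>)\<^sup>2) ^ (DIM('a) - 1))) (at \<eta>)"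
      unfolding C_def using n3 by (intro normalized_kernel_deriv e) (use that in auto)
    also have "\<i> * (\<i> * of_real C / csqrt (1 - (0 + of_real \<eta> * \<i>)\<^sup>2) ^ (DIM('a) - 1)) =
      - of_real (C * (1 / sqrt (1 + \<eta>\<^sup>2) ^ (DIM('a) - 1)))"
      unfolding cs by simp
    finally have 1: "((\<lambda>\<eta>. normalized_kernel e (0 + of_real \<eta> * \<i>)) has_vector_derivative
      - of_real (C * (1 / sqrt (1 + \<eta>\<^sup>2) ^ (DIM('a) - 1)))) (at \<eta>)" .
    have 2: "((\<lambda>\<eta>. of_real (C * B \<eta>) :: complex) has_vector_derivative of_real (C * (1 / sqrt (1 + \<eta>\<^sup>2) ^ (DIM('a) - 1)))) (at \<eta>)"
      using DERIV_cmult[OF B, of C]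
      by (intro has_vector_derivative_of_real) (simp add: has_real_derivative_iff_has_vector_derivative)
    show ?thesis unfolding Q_def using has_vector_derivative_add[OF 1 2] by simp
  qed
  have const: "Q x = Q \<eta>" if "x > 0" for x
    using vector_derivative_bound[of "{0<..}" Q "\<lambda>_. 0" 0 x \<eta>] Q' that \<open>\<eta> > 0\<close> by simp
  have "((\<lambda>x. normalized_kernel e (0 + of_real x * \<i>)) \<longlongrightarrow> 0) at_top"
  proof (rule Lim_null_comparison)
    show "\<forall>\<^sub>F x in at_top. norm (normalized_kernel e (0 + of_real x * \<i>)) \<le> sigma_area DIM('a) / x ^ (DIM('a) - 2)"
      using eventually_gt_at_top[of 0]
    proof eventually_elim
      fix x :: real assume "x > 0"
      then show "norm (normalized_kernel e (0 + of_real x * \<i>)) \<le> sigma_area DIM('a) / x ^ (DIM('a) - 2)"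
        using norm_sphere_kernel_le[of "of_real x * \<i>" e "DIM('a) - 2"]
        by (simp add: normalized_kernel_def norm_divide norm_mult norm_power)
    qed
    show "((\<lambda>x. sigma_area DIM('a) / x ^ (DIM('a) - 2)) \<longlongrightarrow> 0) at_top"
      using n3 by (intro real_tendsto_divide_at_top[OF tendsto_const] filterlim_pow_at_top filterlim_ident) auto
  qed
  then have "(Q \<longlongrightarrow> 0 + of_real (C * b)) at_top"
    unfolding Q_def by (intro tendsto_intros lim)
  moreover have "\<forall>\<^sub>F x in at_top. Q x = Q \<eta>"
    using eventually_gt_at_top[of 0] by eventually_elim (rule const)
  ultimately have "((\<lambda>x::real. Q \<eta>) \<longlongrightarrow> 0 + of_real (C * b)) at_top"
    by (rule Lim_transform_eventually)
  then have "Q \<eta> = of_real (C * b)" by (simp add: tendsto_const_iff)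
  then show ?thesis by (simp add: Q_def C_def algebra_simps eq_diff_eq)
qed

text \<open>Integrates the derivative horizontally from the imaginary axis to abscissa h. The bound
  \<open>M\<close> is left abstract since it is used twice: as a constant for the uniform majorant
  and as a quantity of order \<eta> for the limit.\<close>

lemma Re_normalized_kernel_diff_le:
  fixes e :: "'a::euclidean_space"
  assumes n3: "DIM('a) \<ge> 3" and e: "norm e = 1" and \<eta>: "\<eta> > 0" and h: "\<bar>h\<bar> \<le> h0" "h0 < 1"
    and M: "\<And>z. \<bar>Re z\<bar> \<le> h0 \<Longrightarrow> Im z = \<eta> \<Longrightarrow> \<bar>Im ((1 / csqrt (1 - z\<^sup>2)) ^ (DIM('a) - 1))\<bar> \<le> M"
  shows "\<bar>Re (normalized_kernel e (Complex h \<eta>)) - Re (normalized_kernel e (of_real \<eta> * \<i>))\<bar>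
    \<le> (DIM('a) - 2) * sigma_area DIM('a) * M"
proof -
  define C where "C = (DIM('a) - 2) * sigma_area DIM('a)"
  have C: "C \<ge> 0" using sigma_area_pos[of "DIM('a)"] n3 by (simp add: C_def)
  have M0: "M \<ge> 0" using M[of "Complex 0 \<eta>"] h by (auto intro: order_trans[OF abs_ge_zero])
  define g where "g x = Re (normalized_kernel e (of_real \<eta> * \<i> + of_real x * 1))" for x
  have "norm (g h - g 0) \<le> C * M * \<bar>h - 0\<bar>"
  proof (rule vector_derivative_bound[of "{-h0..h0}"])
    fix x assume x: "x \<in> {-h0..h0}"
    define z where "z = of_real \<eta> * \<i> + of_real x * 1"
    have z: "\<bar>Re z\<bar> \<le> h0" "Im z = \<eta>" using x by (auto simp: z_def)
    have "((\<lambda>x. normalized_kernel e (of_real \<eta> * \<i> + of_real x * 1)) has_vector_derivative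
      1 * (\<i> * of_real C / csqrt (1 - z\<^sup>2) ^ (DIM('a) - 1))) (at x)"
      unfolding C_def z_def using n3 by (intro normalized_kernel_deriv e) (use x h \<eta> in auto)
    from bounded_linear.has_vector_derivative[OF bounded_linear_Re this]
    have "(g has_vector_derivative Re (\<i> * of_real C / csqrt (1 - z\<^sup>2) ^ (DIM('a) - 1))) (at x)"
      unfolding g_def by simp
    also have "Re (\<i> * of_real C / csqrt (1 - z\<^sup>2) ^ (DIM('a) - 1)) = - C * Im ((1 / csqrt (1 - z\<^sup>2)) ^ (DIM('a) - 1))"
    proof -
      have "\<i> * of_real C / csqrt (1 - z\<^sup>2) ^ (DIM('a) - 1) = of_real C * (\<i> * (1 / csqrt (1 - z\<^sup>2)) ^ (DIM('a) - 1))"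
        by (simp add: power_divide)
      then show ?thesis by (simp only: Re_complex_of_real Im_complex_of_real times_complex.sel imaginary_unit.sel) simp
    qed
    finally show "(g has_vector_derivative - C * Im ((1 / csqrt (1 - (of_real \<eta> * \<i> + of_real x * 1)\<^sup>2)) ^ (DIM('a) - 1))) (at x)"
      by (simp only: z_def)
    show "norm (- C * Im ((1 / csqrt (1 - (of_real \<eta> * \<i> + of_real x * 1)\<^sup>2)) ^ (DIM('a) - 1))) \<le> C * M"
      using mult_left_mono[OF M[OF z] C] C by (simp add: abs_mult z_def)
  qed (use h in auto)
  also have "\<dots> \<le> C * M" using h C M0 by (intro mult_left_le) auto
  finally show ?thesis
    by (simp add: g_def C_def add.commute complex_eq_cancel_iff2 flip: Complex_eq)
       (simp add: Complex_eq mult.commute add.commute)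
qed

text \<open>The majorant for the final dominated convergence. It depends only on h0 and the
  dimension, not on the direction, the abscissa or the height; this fails as h0 approaches
  1.\<close>

lemma Re_normalized_kernel_bound:
  assumes n3: "DIM('a::euclidean_space) \<ge> 3" and h0: "0 \<le> h0" "h0 < 1"
  obtains K where "\<And>(e::'a) h \<eta>. norm e = 1 \<Longrightarrow> \<bar>h\<bar> \<le> h0 \<Longrightarrow> \<eta> > 0 \<Longrightarrow> \<bar>Re (normalized_kernel e (Complex h \<eta>))\<bar> \<le> K"
proof -
  obtain B where B: "\<And>u. (B has_real_derivative 1 / sqrt (1 + u\<^sup>2) ^ (DIM('a) - 1)) (at u)" "B 0 = 0"
    "(B \<longlongrightarrow> beta_const (DIM('a) - 1)) at_top"
    using ex_antiderivative_inverse_sqrt_power[of "DIM('a) - 1"] n3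
    by (metis (no_types, lifting) One_nat_def Suc_1 diff_le_mono diff_Suc_1 numeral_3_eq_3)
  define C where "C = (DIM('a) - 2) * sigma_area DIM('a)"
  define c where "c = 1 / sqrt (1 - h0\<^sup>2)"
  have C: "C \<ge> 0" using sigma_area_pos[of "DIM('a)"] n3 by (simp add: C_def)
  have B': "0 \<le> B \<eta>" "B \<eta> \<le> beta_const (DIM('a) - 1)" if "\<eta> > 0" for \<eta>
  proof -
    have mono: "B x \<le> B y" if "x \<le> y" for x y
      using that by (rule DERIV_nonneg_imp_nondecreasing) (use B(1) in \<open>auto intro!: exI\<close>)
    from mono[of 0 \<eta>] that B show "0 \<le> B \<eta>" by simp
    show "B \<eta> \<le> beta_const (DIM('a) - 1)"
      by (rule tendsto_lowerbound[OF B(3)]) (auto intro!: eventually_mono[OF eventually_ge_at_top[of \<eta>]] mono)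
  qed
  show thesis
  proof (rule that)
    fix e :: 'a and h \<eta> :: real assume e: "norm e = 1" and h: "\<bar>h\<bar> \<le> h0" and \<eta>: "\<eta> > 0"
    have "\<bar>Re (normalized_kernel e (Complex h \<eta>)) - Re (normalized_kernel e (of_real \<eta> * \<i>))\<bar> \<le> C * c ^ (DIM('a) - 1)"
      unfolding C_def
    proof (rule Re_normalized_kernel_diff_le[OF n3 e \<eta> h h0(2)])
      fix z assume z: "\<bar>Re z\<bar> \<le> h0" "Im z = \<eta>"
      have "\<bar>Im ((1 / csqrt (1 - z\<^sup>2)) ^ (DIM('a) - 1))\<bar> \<le> norm (1 / csqrt (1 - z\<^sup>2)) ^ (DIM('a) - 1)"
        using abs_Im_le_cmod[of "(1 / csqrt (1 - z\<^sup>2)) ^ (DIM('a) - 1)"] by (simp only: norm_power)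
      also have "\<dots> \<le> c ^ (DIM('a) - 1)"
        using csqrt_strip_bounds(1)[OF z(1) h0(2) c_def] z \<eta> by (intro power_mono) auto
      finally show "\<bar>Im ((1 / csqrt (1 - z\<^sup>2)) ^ (DIM('a) - 1))\<bar> \<le> c ^ (DIM('a) - 1)" .
    qed
    moreover have "Re (normalized_kernel e (of_real \<eta> * \<i>)) = C * (beta_const (DIM('a) - 1) - B \<eta>)"
      unfolding normalized_kernel_imaginary_axis[OF n3 e \<eta> B(1,3)] C_def by simp
    moreover have "\<bar>C * (beta_const (DIM('a) - 1) - B \<eta>)\<bar> \<le> C * beta_const (DIM('a) - 1)"
      using B'[OF \<eta>] C by (auto simp: abs_mult intro!: mult_left_mono)
    ultimately show "\<bar>Re (normalized_kernel e (Complex h \<eta>))\<bar> \<le> C * beta_const (DIM('a) - 1) + C * c ^ (DIM('a) - 1)"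
      by linarith
  qed
qed

text \<open>On the axis the limit is read off from the antiderivative vanishing at 0; off the axis
  the horizontal error is of order \<eta>. The limit depends neither on h nor on e, and this is why
  a pure Newtonian kernel emerges.\<close>

lemma Re_normalized_kernel_tendsto:
  fixes e :: "'a::euclidean_space"
  assumes n3: "DIM('a) \<ge> 3" and e: "norm e = 1" and h: "\<bar>h\<bar> < 1"
  shows "((\<lambda>\<eta>. Re (normalized_kernel e (Complex h \<eta>))) \<longlongrightarrow>
    (DIM('a) - 2) * sigma_area DIM('a) * beta_const (DIM('a) - 1)) (at_right 0)"
proof -
  obtain B where B: "\<And>u. (B has_real_derivative 1 / sqrt (1 + u\<^sup>2) ^ (DIM('a) - 1)) (at u)" "B 0 = 0"
    "(B \<longlongrightarrow> beta_const (DIM('a) - 1)) at_top"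
    using ex_antiderivative_inverse_sqrt_power[of "DIM('a) - 1"] n3
    by (metis (no_types, lifting) One_nat_def Suc_1 diff_le_mono diff_Suc_1 numeral_3_eq_3)
  define C where "C = (DIM('a) - 2) * sigma_area DIM('a)"
  define c where "c = 1 / sqrt (1 - \<bar>h\<bar>\<^sup>2)"
  define m where "m = DIM('a) - 1"
  have C: "C \<ge> 0" using sigma_area_pos[of "DIM('a)"] n3 by (simp add: C_def)
  have "((\<lambda>\<eta>. Re (normalized_kernel e (Complex h \<eta>)) - C * beta_const m) \<longlongrightarrow> 0) (at_right 0)"
  proof (rule Lim_null_comparison)
    have "isCont B 0" using B(1) by (rule DERIV_isCont)
    then have "(B \<longlongrightarrow> 0) (at_right 0)" using B(2) by (simp add: isCont_def filterlim_at_split)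
    then show "((\<lambda>\<eta>. C * \<bar>B \<eta>\<bar> + C * (real m * c ^ (m - 1) * (\<eta> * c ^ 3))) \<longlongrightarrow> 0) (at_right 0)"
      by (auto intro!: tendsto_eq_intros)
    show "\<forall>\<^sub>F \<eta> in at_right 0. norm (Re (normalized_kernel e (Complex h \<eta>)) - C * beta_const m)
      \<le> C * \<bar>B \<eta>\<bar> + C * (real m * c ^ (m - 1) * (\<eta> * c ^ 3))"
      using eventually_at_right_less[of 0]
    proof eventually_elim
      fix \<eta> :: real assume \<eta>: "\<eta> > 0"
      have "\<bar>Re (normalized_kernel e (Complex h \<eta>)) - Re (normalized_kernel e (of_real \<eta> * \<i>))\<bar> \<le> C * (real m * c ^ (m - 1) * (\<eta> * c ^ 3))"
        unfolding C_def
      proof (rule Re_normalized_kernel_diff_le[OF n3 e \<eta> order_refl h])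
        fix z assume z: "\<bar>Re z\<bar> \<le> \<bar>h\<bar>" "Im z = \<eta>"
        note bounds = csqrt_strip_bounds[OF z(1) h c_def, unfolded z(2), OF \<eta>]
        have "\<bar>Im ((1 / csqrt (1 - z\<^sup>2)) ^ m)\<bar> \<le> real m * norm (1 / csqrt (1 - z\<^sup>2)) ^ (m - 1) * \<bar>Im (1 / csqrt (1 - z\<^sup>2))\<bar>"
          by (rule abs_Im_power_le)
        also have "\<dots> \<le> real m * c ^ (m - 1) * (\<eta> * c ^ 3)"
          using bounds order_trans[OF norm_ge_zero bounds(1)] by (intro mult_mono power_mono mult_left_mono) auto
        finally show "\<bar>Im ((1 / csqrt (1 - z\<^sup>2)) ^ (DIM('a) - 1))\<bar> \<le> real m * c ^ (m - 1) * (\<eta> * c ^ 3)"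
          by (simp add: m_def)
      qed
      moreover have "Re (normalized_kernel e (of_real \<eta> * \<i>)) = C * beta_const m - C * B \<eta>"
        unfolding normalized_kernel_imaginary_axis[OF n3 e \<eta> B(1,3)] C_def m_def by (simp add: algebra_simps)
      moreover have "C * \<bar>B \<eta>\<bar> = \<bar>C * B \<eta>\<bar>" using C by (simp add: abs_mult)
      ultimately show "norm (Re (normalized_kernel e (Complex h \<eta>)) - C * beta_const m)
        \<le> C * \<bar>B \<eta>\<bar> + C * (real m * c ^ (m - 1) * (\<eta> * c ^ 3))"
        unfolding real_norm_def by linarith
    qed
  qed
  then show ?thesis by (simp add: Lim_null[symmetric] C_def m_def)
qed

section \<open>The Newtonian potential\<close>

abbreviation dir_deriv :: "('a::euclidean_space \<Rightarrow> real) \<Rightarrow> 'a \<Rightarrow> 'a \<Rightarrow> real" where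
  "dir_deriv f v x \<equiv> frechet_derivative f (at x) v"

text \<open>The support is recorded as vanishing outside a closed ball of radius r; this is stable
  under differentiation with the same r.\<close>

definition test_function :: "real \<Rightarrow> ('a::euclidean_space \<Rightarrow> real) \<Rightarrow> bool" where
  "test_function r f \<longleftrightarrow> C_infinity f \<and> (\<forall>x. norm x > r \<longrightarrow> f x = 0)"

lemma test_function_eq_0: "test_function r f \<Longrightarrow> norm x > r \<Longrightarrow> f x = 0"
  by (simp add: test_function_def)

lemma test_function_continuous: "test_function r f \<Longrightarrow> continuous_on UNIV f"
  unfolding test_function_def C_infinity_def by (metis Ck.simps(1))

lemma test_function_measurable: "test_function r f \<Longrightarrow> f \<in> borel_measurable borel"
  by (intro borel_measurable_continuous_onI test_function_continuous)

lemma test_function_has_derivative: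
  assumes "test_function r f"
  shows "(f has_derivative frechet_derivative f (at x)) (at x)"
proof -
  have "Ck (Suc 0) f" using assms unfolding test_function_def C_infinity_def by blast
  then show ?thesis by (simp add: differentiable_on_def frechet_derivative_works)
qed

lemma test_function_dir_deriv:
  fixes f :: "'a::euclidean_space \<Rightarrow> real"
  assumes "test_function r f"
  shows "test_function r (dir_deriv f v)"
  unfolding test_function_def C_infinity_def
proof (intro conjI allI impI)
  fix k
  have "Ck (Suc k) f" using assms unfolding test_function_def C_infinity_def by blast
  then show "Ck k (dir_deriv f v)" by simp
next
  fix x :: 'a assume x: "norm x > r"
  have "((\<lambda>_. 0) has_derivative (\<lambda>_. 0)) (at x)" by simp
  then have "(f has_derivative (\<lambda>_. 0)) (at x)"
    by (rule has_derivative_transform_within_open[OF _ open_Compl[OF closed_cball[of 0 r]]])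
       (use x test_function_eq_0[OF assms] in auto)
  then have "frechet_derivative f (at x) = (\<lambda>_. 0)"
    using frechet_derivative_at by metis
  then show "dir_deriv f v x = 0" by simp
qed

lemma test_function_bounded:
  assumes "test_function r f"
  obtains B where "B \<ge> 0" "\<And>x. \<bar>f x\<bar> \<le> B"
proof -
  have "compact (f ` cball 0 r)"
    using test_function_continuous[OF assms] by (intro compact_continuous_image) (auto intro: continuous_on_subset)
  then obtain B where B: "\<And>y. y \<in> f ` cball 0 r \<Longrightarrow> norm y \<le> B"
    using compact_imp_bounded bounded_iff by metis
  have "\<bar>f x\<bar> \<le> max B 0" for x
    using B[of "f x"] test_function_eq_0[OF assms, of x] by (cases "norm x \<le> r") auto
  then show thesis using that[of "max B 0"] by simp
qed

lemma dir_deriv_expand: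
  assumes "test_function r f"
  shows "dir_deriv f v x = (\<Sum>i\<in>Basis. (v \<bullet> i) * dir_deriv f i x)"
proof -
  interpret bounded_linear "frechet_derivative f (at x)"
    using test_function_has_derivative[OF assms] by (rule has_derivative_bounded_linear)
  have "dir_deriv f v x = dir_deriv f (\<Sum>i\<in>Basis. (v \<bullet> i) *\<^sub>R i) x" by (simp add: euclidean_representation)
  then show ?thesis by (simp add: sum scale)
qed

lemma dir_deriv_bounded:
  fixes f :: "'a::euclidean_space \<Rightarrow> real"
  assumes "test_function r f"
  obtains B where "B \<ge> 0" "\<And>x v. \<bar>dir_deriv f v x\<bar> \<le> B * norm v"
proof -
  have "\<exists>B. \<forall>i\<in>Basis::'a set. B i \<ge> 0 \<and> (\<forall>x. \<bar>dir_deriv f i x\<bar> \<le> B i)"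
    by (intro bchoice ballI) (metis test_function_bounded[OF test_function_dir_deriv[OF assms]])
  then obtain B where B: "\<And>i x. i \<in> (Basis::'a set) \<Longrightarrow> B i \<ge> 0 \<and> \<bar>dir_deriv f i x\<bar> \<le> B i" by blast
  have "\<bar>dir_deriv f v x\<bar> \<le> (\<Sum>i\<in>Basis. B i) * norm v" for v x
  proof -
    have "\<bar>dir_deriv f v x\<bar> \<le> (\<Sum>i\<in>Basis. norm v * B i)"
      unfolding dir_deriv_expand[OF assms, where v = v and x = x]
      using B by (intro order_trans[OF sum_abs] sum_mono) (auto simp: abs_mult intro!: mult_mono Basis_le_norm)
    then show ?thesis by (simp add: sum_distrib_left mult.commute)
  qed
  moreover have "(\<Sum>i\<in>Basis. B i) \<ge> 0" using B by (intro sum_nonneg) blast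
  ultimately show thesis using that by blast
qed

lemma test_function_line_deriv:
  assumes "test_function r f"
  shows "((\<lambda>s. f (x + s *\<^sub>R v)) has_real_derivative dir_deriv f v (x + s *\<^sub>R v)) (at s)"
proof -
  have "((\<lambda>s. x + s *\<^sub>R v) has_vector_derivative v) (at s)" by (auto intro!: derivative_eq_intros)
  from vector_derivative_diff_chain_within[OF this has_derivative_at_withinI[OF test_function_has_derivative[OF assms]]]
  show ?thesis by (simp add: comp_def has_real_derivative_iff_has_vector_derivative)
qed

section \<open>Convolution with weakly singular powers of the norm\<close>

lemma integrable_inverse_power_cball:
  assumes "p < DIM('a::euclidean_space)" "r \<ge> 0"
  shows "integrable lborel (\<lambda>z::'a. indicator (cball 0 r) z * (1 / norm z ^ p))"
proof (rule integrableI_nonneg)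
  let ?n = "DIM('a)"
  have [measurable]: "cball (0::'a) r \<in> sets borel" by auto
  show "(\<lambda>z::'a. indicator (cball 0 r) z * (1 / norm z ^ p)) \<in> borel_measurable lborel" by measurable
  have "(\<integral>\<^sup>+z. ennreal (indicator (cball 0 r) z * (1 / norm z ^ p)) \<partial>(lborel :: 'a measure)) =
    (\<integral>\<^sup>+t. ennreal (t ^ (?n - 1)) * indicator {0<..} t *
      (\<integral>\<^sup>+\<theta>. ennreal (indicator (cball 0 r) (t *\<^sub>R \<theta>) * (1 / norm (t *\<^sub>R \<theta>) ^ p)) \<partial>(sphere_surface 0 1 :: 'a measure)) \<partial>lborel)"
    by (rule nn_integral_polar) measurable
  also have "\<dots> \<le> (\<integral>\<^sup>+t. ennreal (r ^ (?n - 1 - p) * sigma_area ?n) * indicator {0..r} t \<partial>lborel)"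
  proof (rule nn_integral_mono)
    fix t :: real
    show "ennreal (t ^ (?n - 1)) * indicator {0<..} t *
      (\<integral>\<^sup>+\<theta>. ennreal (indicator (cball 0 r) (t *\<^sub>R \<theta>) * (1 / norm (t *\<^sub>R \<theta>) ^ p)) \<partial>(sphere_surface 0 1 :: 'a measure))
      \<le> ennreal (r ^ (?n - 1 - p) * sigma_area ?n) * indicator {0..r} t"
    proof (cases "t > 0")
      case True
      have "(\<integral>\<^sup>+\<theta>. ennreal (indicator (cball 0 r) (t *\<^sub>R \<theta>) * (1 / norm (t *\<^sub>R \<theta>) ^ p)) \<partial>(sphere_surface 0 1 :: 'a measure))
        = (\<integral>\<^sup>+\<theta>. ennreal (indicator {0..r} t / t ^ p) \<partial>(sphere_surface 0 1 :: 'a measure))"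
        by (rule nn_integral_cong_AE, rule eventually_mono[OF AE_sphere_surface[of 1]])
           (use True in \<open>auto simp: indicator_def\<close>)
      also have "\<dots> = ennreal (indicator {0..r} t / t ^ p * sigma_area ?n)"
        using True sigma_area_pos[of ?n]
        by (simp add: emeasure_sphere_surface_1 ennreal_mult[symmetric] Suc_leI)
      finally have *: "(\<integral>\<^sup>+\<theta>. ennreal (indicator (cball 0 r) (t *\<^sub>R \<theta>) * (1 / norm (t *\<^sub>R \<theta>) ^ p)) \<partial>(sphere_surface 0 1 :: 'a measure)) = \<dots>" .
      have "t ^ (?n - 1) * (1 / t ^ p * sigma_area ?n) \<le> r ^ (?n - 1 - p) * sigma_area ?n" if "t \<le> r"
      proof -
        have "t ^ (?n - 1) * (1 / t ^ p * sigma_area ?n) = t ^ (?n - 1 - p) * sigma_area ?n"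
          using True assms by (simp add: power_diff)
        also have "\<dots> \<le> r ^ (?n - 1 - p) * sigma_area ?n"
          using True that sigma_area_pos[of ?n] by (intro mult_right_mono power_mono) (auto simp: Suc_leI less_imp_le)
        finally show ?thesis .
      qed
      then show ?thesis
        unfolding * using True by (cases "t \<le> r") (simp_all add: ennreal_mult'[symmetric] ennreal_leI del: One_nat_def)
    qed simp
  qed
  also have "\<dots> = ennreal (r ^ (?n - 1 - p) * sigma_area ?n) * ennreal r"
    using assms by (subst nn_integral_cmult_indicator) auto
  also have "\<dots> < \<infinity>" by (simp add: ennreal_mult_less_top)
  finally show "(\<integral>\<^sup>+z. ennreal (indicator (cball 0 r) z * (1 / norm z ^ p)) \<partial>(lborel :: 'a measure)) < \<infinity>" .
qed auto

lemma integrable_singular_kernel: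
  fixes g k :: "'a::euclidean_space \<Rightarrow> real"
  assumes [measurable]: "g \<in> borel_measurable borel" "k \<in> borel_measurable borel"
    and g: "\<And>z. \<bar>g z\<bar> \<le> B" "\<And>z. norm z > r \<Longrightarrow> g z = 0"
    and k: "\<And>z. \<bar>k z\<bar> \<le> 1 / norm z ^ p" and p: "p < DIM('a)"
  shows "integrable lborel (\<lambda>z. g z * k z)"
proof (rule Bochner_Integration.integrable_bound[of _ "\<lambda>z. B * (indicator (cball 0 (max r 0)) z * (1 / norm z ^ p))"])
  show "integrable lborel (\<lambda>z::'a. B * (indicator (cball 0 (max r 0)) z * (1 / norm z ^ p)))"
    by (intro integrable_mult_right integrable_inverse_power_cball p) simp
  have "norm (g z * k z) \<le> norm (B * (indicator (cball 0 (max r 0)) z * (1 / norm z ^ p)))" for z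
  proof (cases "norm z \<le> r")
    case True
    have "\<bar>g z\<bar> * \<bar>k z\<bar> \<le> B * (1 / norm z ^ p)"
      using g(1)[of z] k[of z] order_trans[OF abs_ge_zero g(1)] by (intro mult_mono) auto
    also have "\<dots> \<le> \<bar>B\<bar> * (1 / norm z ^ p)" by (intro mult_right_mono) auto
    finally show ?thesis using True by (simp add: abs_mult)
  next
    case False
    then show ?thesis using g(2)[of z] by simp
  qed
  then show "AE z in lborel. norm (g z * k z) \<le> norm (B * (indicator (cball 0 (max r 0)) z * (1 / norm z ^ p)))"
    by simp
qed measurable

text \<open>The moving point sits in g and not in the kernel, so every derivative falls on the test
  function and local integrability of the kernel is all that is asked of it.\<close>

lemma potential_deriv:
  fixes g :: "'a::euclidean_space \<Rightarrow> real"
  assumes g: "test_function r g" and p: "p < DIM('a)"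
  shows "((\<lambda>s. \<integral>z. g (x + s *\<^sub>R v - z) * (1 / norm z ^ p) \<partial>lborel) has_real_derivative
    (\<integral>z. dir_deriv g v (x + s0 *\<^sub>R v - z) * (1 / norm z ^ p) \<partial>lborel)) (at s0)"
  unfolding has_real_derivative_iff_has_vector_derivative
proof -
  note [measurable] = test_function_measurable[OF g] test_function_measurable[OF test_function_dir_deriv[OF g]]
  obtain B where B: "B \<ge> 0" "\<And>y. \<bar>dir_deriv g v y\<bar> \<le> B"
    using test_function_bounded[OF test_function_dir_deriv[OF g]] by metis
  obtain B0 where B0: "\<And>y. \<bar>g y\<bar> \<le> B0" using test_function_bounded[OF g] by metis
  define R where "R = norm x + (\<bar>s0\<bar> + 1) * norm v + max r 0"
  have R: "R \<ge> 0" by (simp add: R_def)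
  have far: "norm (x + s *\<^sub>R v - z) > r" if "\<bar>s - s0\<bar> < 1" "norm z > R" for s z
  proof -
    have "norm (s *\<^sub>R v) \<le> (\<bar>s0\<bar> + 1) * norm v" using that(1) by (auto intro!: mult_right_mono)
    moreover have "norm z \<le> norm (x + s *\<^sub>R v - z) + (norm x + norm (s *\<^sub>R v))"
      using norm_triangle_ineq4[of "x + s *\<^sub>R v" "x + s *\<^sub>R v - z"] norm_triangle_ineq[of x "s *\<^sub>R v"] by simp
    ultimately show ?thesis using that(2) by (simp add: R_def)
  qed
  show "((\<lambda>s. \<integral>z. g (x + s *\<^sub>R v - z) * (1 / norm z ^ p) \<partial>lborel) has_vector_derivative
    (\<integral>z. dir_deriv g v (x + s0 *\<^sub>R v - z) * (1 / norm z ^ p) \<partial>lborel)) (at s0)"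
  proof (rule has_vector_derivative_integral[where r = 1 and G = "\<lambda>z. B * (indicator (cball 0 R) z * (1 / norm z ^ p))"])
    show "integrable lborel (\<lambda>z. g (x + s *\<^sub>R v - z) * (1 / norm z ^ p))" if "\<bar>s - s0\<bar> < 1" for s
      by (rule integrable_singular_kernel[OF _ _ B0 _ _ p, where r = R])
         (use far[OF that] test_function_eq_0[OF g] in auto)
    show "integrable lborel (\<lambda>z::'a. B * (indicator (cball 0 R) z * (1 / norm z ^ p)))"
      by (intro integrable_mult_right integrable_inverse_power_cball p R)
    show "AE z in lborel. \<forall>s. \<bar>s - s0\<bar> < 1 \<longrightarrow>
       ((\<lambda>s. g (x + s *\<^sub>R v - z) * (1 / norm z ^ p)) has_vector_derivative dir_deriv g v (x + s *\<^sub>R v - z) * (1 / norm z ^ p)) (at s) \<and>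
       norm (dir_deriv g v (x + s *\<^sub>R v - z) * (1 / norm z ^ p)) \<le> B * (indicator (cball 0 R) z * (1 / norm z ^ p))"
    proof (intro AE_I2 allI impI conjI)
      fix z :: 'a and s assume s: "\<bar>s - s0\<bar> < 1"
      have eq: "x + s *\<^sub>R v - z = (x - z) + s *\<^sub>R v" for s by simp
      have "((\<lambda>s. g (x + s *\<^sub>R v - z)) has_real_derivative dir_deriv g v (x + s *\<^sub>R v - z)) (at s)"
        unfolding eq by (rule test_function_line_deriv[OF g])
      then show "((\<lambda>s. g (x + s *\<^sub>R v - z) * (1 / norm z ^ p)) has_vector_derivative dir_deriv g v (x + s *\<^sub>R v - z) * (1 / norm z ^ p)) (at s)"
        unfolding has_real_derivative_iff_has_vector_derivative[symmetric] by (rule DERIV_cmult_right)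
      show "norm (dir_deriv g v (x + s *\<^sub>R v - z) * (1 / norm z ^ p)) \<le> B * (indicator (cball 0 R) z * (1 / norm z ^ p))"
      proof (cases "norm z \<le> R")
        case True
        then show ?thesis using B(2)[of "x + s *\<^sub>R v - z"] by (simp add: abs_mult divide_right_mono)
      next
        case False
        then show ?thesis using far[OF s, of z] test_function_eq_0[OF test_function_dir_deriv[OF g]] by simp
      qed
    qed
  qed auto
qed

lemma laplacian_potential:
  fixes f :: "'a::euclidean_space \<Rightarrow> real"
  assumes f: "test_function r f" and p: "p < DIM('a)"
  shows "laplacian (\<lambda>y. \<integral>z. f (y - z) * (1 / norm z ^ p) \<partial>lborel) x =
    (\<Sum>i\<in>Basis. \<integral>z. dir_deriv (dir_deriv f i) i (x - z) * (1 / norm z ^ p) \<partial>lborel)"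
  unfolding laplacian_def
proof (rule sum.cong[OF refl])
  fix i :: 'a
  have "deriv (\<lambda>s. \<integral>z. f (x + s *\<^sub>R i - z) * (1 / norm z ^ p) \<partial>lborel) =
    (\<lambda>s. \<integral>z. dir_deriv f i (x + s *\<^sub>R i - z) * (1 / norm z ^ p) \<partial>lborel)"
    using potential_deriv[OF f p] by (intro ext DERIV_imp_deriv)
  moreover have "deriv (\<lambda>s. \<integral>z. dir_deriv f i (x + s *\<^sub>R i - z) * (1 / norm z ^ p) \<partial>lborel) 0 =
     (\<integral>z. dir_deriv (dir_deriv f i) i (x + 0 *\<^sub>R i - z) * (1 / norm z ^ p) \<partial>lborel)"
    by (intro DERIV_imp_deriv potential_deriv[OF test_function_dir_deriv[OF f] p])
  ultimately show "deriv (deriv (\<lambda>s. \<integral>z. f (x + s *\<^sub>R i - z) * (1 / norm z ^ p) \<partial>lborel)) 0 =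
    (\<integral>z. dir_deriv (dir_deriv f i) i (x - z) * (1 / norm z ^ p) \<partial>lborel)" by simp
qed

text \<open>In polar coordinates the derivative in direction t \<theta> contributes a factor t,
  which together with t^(n-1) cancels the power t^n. What remains is the t-derivative of -f(x - t
  \<theta>), with integral f(x) for every direction.\<close>

lemma integral_radial_derivative:
  fixes f :: "'a::euclidean_space \<Rightarrow> real"
  assumes f: "test_function r f"
  shows "integrable lborel (\<lambda>z. dir_deriv f z (x - z) / norm z ^ DIM('a))"
    "(\<integral>z. dir_deriv f z (x - z) / norm z ^ DIM('a) \<partial>lborel) = sigma_area DIM('a) * f x"
proof -
  let ?n = "DIM('a)"
  have n: "?n = Suc (?n - 1)" by simp
  define F where "F z = dir_deriv f z (x - z) / norm z ^ ?n" for z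
  have F_eq: "F z = (\<Sum>i\<in>Basis. dir_deriv f i (x - z) * ((z \<bullet> i) / norm z ^ ?n))" for z
    unfolding F_def dir_deriv_expand[OF f, where v = z and x = "x - z"] by (simp add: sum_divide_distrib mult.commute)
  have far: "norm (x - z) > r" if "norm z > norm x + max r 0" for z
    using norm_triangle_ineq4[of x "x - z"] that by simp
  have "integrable lborel (\<lambda>z. dir_deriv f i (x - z) * ((z \<bullet> i) / norm z ^ ?n))" if "i \<in> Basis" for i
  proof -
    note [measurable] = test_function_measurable[OF test_function_dir_deriv[OF f]]
    obtain B where B: "\<And>y. \<bar>dir_deriv f i y\<bar> \<le> B"
      using test_function_bounded[OF test_function_dir_deriv[OF f]] by metis
    show ?thesis
    proof (rule integrable_singular_kernel[OF _ _ B, where p = "?n - 1" and r = "norm x + max r 0"])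
      show "\<bar>(z \<bullet> i) / norm z ^ ?n\<bar> \<le> 1 / norm z ^ (?n - 1)" for z
      proof -
        have "norm z ^ ?n = norm z * norm z ^ (?n - 1)" by (subst n) (rule power_Suc)
        then show ?thesis using Basis_le_norm[OF that, of z]
          by (cases "z = 0") (auto simp: field_simps)
      qed
    qed (use far test_function_eq_0[OF test_function_dir_deriv[OF f]] in auto)
  qed
  then have int: "integrable lborel F" unfolding F_eq by (intro Bochner_Integration.integrable_sum)
  then show "integrable lborel (\<lambda>z. dir_deriv f z (x - z) / norm z ^ DIM('a))"
    unfolding F_def[abs_def] .
  have "(\<integral>z. F z \<partial>lborel) = (\<integral>\<theta>. (\<integral>t. (indicator {0<..} t * t ^ (?n - 1)) *\<^sub>R F (t *\<^sub>R \<theta>) \<partial>lborel) \<partial>sphere_surface 0 1)"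
    by (rule integral_polar(2)[OF int])
  also have "\<dots> = (\<integral>\<theta>. f x \<partial>(sphere_surface 0 1 :: 'a measure))"
  proof (rule integral_cong_AE)
    have [measurable]: "F \<in> borel_measurable borel" using int by simp
    interpret radial: sigma_finite_measure "lborel :: real measure" by (rule sigma_finite_lborel)
    show "(\<lambda>\<theta>. \<integral>t. (indicator {0<..} t * t ^ (?n - 1)) *\<^sub>R F (t *\<^sub>R \<theta>) \<partial>lborel) \<in> borel_measurable (sphere_surface 0 1)"
      by measurable
    show "AE \<theta> in sphere_surface 0 1. (\<integral>t. (indicator {0<..} t * t ^ (?n - 1)) *\<^sub>R F (t *\<^sub>R \<theta>) \<partial>lborel) = f x"
    proof (rule eventually_mono[OF AE_sphere_surface[of 1]])
      fix \<theta> :: 'a assume \<theta>: "norm \<theta> = 1"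
      define T where "T = norm x + max r 0 + 1"
      have T: "T > 0" by (simp add: T_def add_nonneg_pos)
      have far': "norm (x - t *\<^sub>R \<theta>) > r" if "t \<ge> T" for t
        using far[of "t *\<^sub>R \<theta>"] that T \<theta> by (simp add: T_def)
      have der: "((\<lambda>t. - f (x - t *\<^sub>R \<theta>)) has_real_derivative dir_deriv f \<theta> (x - t *\<^sub>R \<theta>)) (at t)" for t
      proof -
        have "((\<lambda>t. - f (x + (- t) *\<^sub>R \<theta>)) has_real_derivative - (dir_deriv f \<theta> (x + (- t) *\<^sub>R \<theta>) * (- 1))) (at t)"
          by (intro DERIV_minus DERIV_chain2[OF test_function_line_deriv[OF f]]) (auto intro!: derivative_eq_intros)
        then show ?thesis by simp
      qed
      have "(\<integral>t. (indicator {0<..} t * t ^ (?n - 1)) *\<^sub>R F (t *\<^sub>R \<theta>) \<partial>lborel) = (\<integral>t. indicator {0..T} t *\<^sub>R dir_deriv f \<theta> (x - t *\<^sub>R \<theta>) \<partial>lborel)"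
      proof (rule integral_cong_AE)
        show "(\<lambda>t. indicator {0..T} t *\<^sub>R dir_deriv f \<theta> (x - t *\<^sub>R \<theta>)) \<in> borel_measurable lborel"
          using test_function_measurable[OF test_function_dir_deriv[OF f], of \<theta>] by measurable
        show "AE t in lborel. (indicator {0<..} t * t ^ (?n - 1)) *\<^sub>R F (t *\<^sub>R \<theta>) = indicator {0..T} t *\<^sub>R dir_deriv f \<theta> (x - t *\<^sub>R \<theta>)"
        proof (rule eventually_mono[OF AE_lborel_singleton[of 0]])
          fix t :: real assume "t \<noteq> 0"
          interpret bounded_linear "frechet_derivative f (at (x - t *\<^sub>R \<theta>))"
            using test_function_has_derivative[OF f] by (rule has_derivative_bounded_linear)
          show "(indicator {0<..} t * t ^ (?n - 1)) *\<^sub>R F (t *\<^sub>R \<theta>) = indicator {0..T} t *\<^sub>R dir_deriv f \<theta> (x - t *\<^sub>R \<theta>)"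
          proof (cases "t > 0")
            case True
            have "t ^ (?n - 1) * F (t *\<^sub>R \<theta>) = t ^ (?n - 1) * (t * dir_deriv f \<theta> (x - t *\<^sub>R \<theta>) / t ^ Suc (?n - 1))"
              unfolding F_def n[symmetric] using True \<theta> by (simp add: scale)
            also have "\<dots> = dir_deriv f \<theta> (x - t *\<^sub>R \<theta>)"
            proof -
              have "t ^ k * (t * D / t ^ Suc k) = D" for k D using True by simp
              then show ?thesis .
            qed
            finally show ?thesis
              using True far'[of t] test_function_eq_0[OF test_function_dir_deriv[OF f], of "x - t *\<^sub>R \<theta>" \<theta>]
              by (cases "t \<le> T") auto
          next
            case False
            with \<open>t \<noteq> 0\<close> show ?thesis by auto
          qed
        qed
      qed measurable
      also have "\<dots> = - f (x - T *\<^sub>R \<theta>) - (- f (x - 0 *\<^sub>R \<theta>))"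
      proof (rule integral_FTC_Icc)
        show "((\<lambda>t. - f (x - t *\<^sub>R \<theta>)) has_vector_derivative dir_deriv f \<theta> (x - t *\<^sub>R \<theta>)) (at t within {0..T})" for t
          using der[of t] unfolding has_real_derivative_iff_has_vector_derivative by (rule has_vector_derivative_at_within)
        show "continuous_on {0..T} (\<lambda>t. dir_deriv f \<theta> (x - t *\<^sub>R \<theta>))"
          by (intro continuous_on_compose2[OF test_function_continuous[OF test_function_dir_deriv[OF f]]] continuous_intros) auto
      qed (use T in auto)
      also have "\<dots> = f x" using test_function_eq_0[OF f far'[of T]] by simp
      finally show "(\<integral>t. (indicator {0<..} t * t ^ (?n - 1)) *\<^sub>R F (t *\<^sub>R \<theta>) \<partial>lborel) = f x" .
    qed simp
  qed auto
  also have "\<dots> = sigma_area ?n * f x" by (simp add: measure_sphere_surface_1)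
  finally show "(\<integral>z. dir_deriv f z (x - z) / norm z ^ DIM('a) \<partial>lborel) = sigma_area DIM('a) * f x"
    by (simp add: F_def)
qed

text \<open>Regularise \<open>|z|\<close> to \<open>sqrt (|z|\<^sup>2 + \<epsilon>\<^sup>2)\<close>, integrate by parts once, and let \<open>\<epsilon> \<rightarrow> 0\<close>:
  the remaining integrand is a radial derivative.\<close>
lemma laplacian_newton_potential:
  fixes f :: "'a::euclidean_space \<Rightarrow> real"
  assumes f: "test_function r f" and n3: "DIM('a) \<ge> 3"
  shows "laplacian (\<lambda>y. \<integral>z. f (y - z) * (1 / norm z ^ (DIM('a) - 2)) \<partial>lborel) x =
    - ((DIM('a) - 2) * sigma_area DIM('a) * f x)"
proof -
  define m where "m = DIM('a) - 2"
  have n: "DIM('a) = Suc (Suc m)" and m: "m \<ge> 1" using n3 by (auto simp: m_def)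
  define q :: "real \<Rightarrow> 'a \<Rightarrow> real" where "q \<epsilon> z = sqrt ((norm z)\<^sup>2 + \<epsilon>\<^sup>2)" for \<epsilon> z
  have [measurable]: "q \<epsilon> \<in> borel_measurable borel" for \<epsilon> unfolding q_def[abs_def] by measurable
  have q_pos: "q \<epsilon> z > 0" if "\<epsilon> > 0" for \<epsilon> z using that by (simp add: q_def add_nonneg_pos)
  have q_ge: "q \<epsilon> z \<ge> norm z" "q \<epsilon> z \<ge> \<bar>\<epsilon>\<bar>" for \<epsilon> z by (auto simp: q_def intro!: real_le_rsqrt)
  have [measurable]: "dir_deriv f i \<in> borel_measurable borel" "dir_deriv (dir_deriv f i) j \<in> borel_measurable borel" for i j
    using test_function_measurable test_function_dir_deriv f by blast+
  define D2 where "D2 i z = dir_deriv (dir_deriv f i) i (x - z)" for i z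
  define D1 where "D1 i z = dir_deriv f i (x - z)" for i z
  have [measurable]: "D1 i \<in> borel_measurable borel" "D2 i \<in> borel_measurable borel" for i
    unfolding D1_def[abs_def] D2_def[abs_def] by measurable
  define \<rho> where "\<rho> = norm x + max r 0"
  have far: "norm (x - z) > r" if "norm z > \<rho>" for z
    using norm_triangle_ineq4[of x "x - z"] that by (simp add: \<rho>_def)
  have D0: "D1 i z = 0" "D2 i z = 0" if "norm z > \<rho>" for i z
    using far[OF that] test_function_eq_0 test_function_dir_deriv f unfolding D1_def D2_def by blast+
  have ex_bound: "\<exists>B\<ge>0. \<forall>z. \<bar>D1 i z\<bar> \<le> B \<and> \<bar>D2 i z\<bar> \<le> B" for i
  proof -
    obtain B1 where B1: "B1 \<ge> 0" "\<And>y. \<bar>dir_deriv f i y\<bar> \<le> B1"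
      using test_function_bounded[OF test_function_dir_deriv[OF f]] by metis
    obtain B2 where B2: "B2 \<ge> 0" "\<And>y. \<bar>dir_deriv (dir_deriv f i) i y\<bar> \<le> B2"
      using test_function_bounded[OF test_function_dir_deriv[OF test_function_dir_deriv[OF f]]] by metis
    have "\<bar>D1 i z\<bar> \<le> B1 + B2" "\<bar>D2 i z\<bar> \<le> B1 + B2" for z
      using B1(2)[of "x - z"] B2(2)[of "x - z"] B1(1) B2(1) by (auto simp: D1_def D2_def)
    then show ?thesis using B1(1) B2(1) by (intro exI[of _ "B1 + B2"]) auto
  qed
  have by_parts: "(\<integral>z. D2 i z * (1 / q \<epsilon> z ^ m) \<partial>lborel) = - (m * (\<integral>z. D1 i z * ((z \<bullet> i) / q \<epsilon> z ^ DIM('a)) \<partial>lborel))"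
    if i: "i \<in> Basis" and \<epsilon>: "\<epsilon> > 0" for i \<epsilon>
  proof -
    obtain B where B: "B \<ge> 0" "\<And>z. \<bar>D1 i z\<bar> \<le> B" "\<And>z. \<bar>D2 i z\<bar> \<le> B" using ex_bound by metis
    define K where "K = B * (1 / \<epsilon> ^ m) + m * (B * (\<rho> / \<epsilon> ^ DIM('a)))"
    have inv: "\<bar>1 / q \<epsilon> z ^ k\<bar> \<le> 1 / \<epsilon> ^ k" for z k
      unfolding abs_divide power_abs using q_ge(2)[of \<epsilon> z] \<epsilon> by (intro frac_le power_mono) auto
    have \<rho>: "\<rho> \<ge> 0" by (simp add: \<rho>_def)
    have b1: "\<bar>D2 i z * (1 / q \<epsilon> z ^ m)\<bar> \<le> B * (1 / \<epsilon> ^ m)" "\<bar>D1 i z * (1 / q \<epsilon> z ^ m)\<bar> \<le> B * (1 / \<epsilon> ^ m)" for z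
      unfolding abs_mult by (rule mult_mono[OF B(3) inv B(1)] mult_mono[OF B(2) inv B(1)]; simp)+
    have b2: "\<bar>D1 i z * ((z \<bullet> i) / q \<epsilon> z ^ DIM('a))\<bar> \<le> B * (\<rho> / \<epsilon> ^ DIM('a))" for z
    proof (cases "norm z \<le> \<rho>")
      case True
      have "\<bar>(z \<bullet> i) / q \<epsilon> z ^ DIM('a)\<bar> \<le> \<rho> / \<epsilon> ^ DIM('a)"
        unfolding abs_divide using True Basis_le_norm[OF i, of z] q_ge(2)[of \<epsilon> z] \<epsilon> \<rho> q_pos[OF \<epsilon>, of z]
        by (intro frac_le) (auto intro!: power_mono simp: power_abs)
      then show ?thesis unfolding abs_mult using B by (intro mult_mono) auto
    next
      case False
      then show ?thesis using D0[of z i] B \<rho> \<epsilon> by simp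
    qed
    have I1: "integrable lborel (\<lambda>z. D2 i z * (1 / q \<epsilon> z ^ m))"
      by (rule integrable_bounded_support[where r = \<rho> and B = "B * (1 / \<epsilon> ^ m)"]) (use b1 D0 in auto)
    have I2: "integrable lborel (\<lambda>z. D1 i z * ((z \<bullet> i) / q \<epsilon> z ^ DIM('a)))"
      by (rule integrable_bounded_support[where r = \<rho>  and B = "B * (\<rho> / \<epsilon> ^ DIM('a))"]) (use b2 D0 in auto)
    have "(\<integral>z. - (D2 i z * (1 / q \<epsilon> z ^ m)) - m * (D1 i z * ((z \<bullet> i) / q \<epsilon> z ^ DIM('a))) \<partial>lborel) = 0"
    proof (rule integral_directional_derivative_eq_0[where g = "\<lambda>z. D1 i z * (1 / q \<epsilon> z ^ m)" and e = i and B = K and r = \<rho>])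
      fix z :: 'a
      \<comment> \<open>The minus sign comes from the argument x - z: differentiation in z reverses
        the direction.\<close>
      have D1': "((\<lambda>s. D1 i (z + s *\<^sub>R i)) has_real_derivative - D2 i z) (at 0)"
      proof -
        have eq: "D1 i (z + s *\<^sub>R i) = dir_deriv f i ((x - z) + (- s) *\<^sub>R i)" for s by (simp add: D1_def algebra_simps)
        have "((\<lambda>s. dir_deriv f i ((x - z) + (- s) *\<^sub>R i)) has_real_derivative dir_deriv (dir_deriv f i) i ((x - z) + (- 0) *\<^sub>R i) * (- 1)) (at 0)"
          by (intro DERIV_chain2[OF test_function_line_deriv[OF test_function_dir_deriv[OF f]]]) (auto intro!: derivative_eq_intros)
        then show ?thesis unfolding eq by (simp add: D2_def)
      qed
      have sq: "((\<lambda>s. (norm (z + s *\<^sub>R i))\<^sup>2 + \<epsilon>\<^sup>2) has_real_derivative 2 * (z \<bullet> i)) (at 0)"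
        using DERIV_add[OF norm_line_sq_deriv[of z i] DERIV_const] by simp
      have pos: "(norm (z + 0 *\<^sub>R i))\<^sup>2 + \<epsilon>\<^sup>2 > 0" using \<epsilon> by (simp add: add_nonneg_pos)
      have q': "((\<lambda>s. q \<epsilon> (z + s *\<^sub>R i)) has_real_derivative (z \<bullet> i) / q \<epsilon> z) (at 0)"
        using DERIV_chain2[OF DERIV_real_sqrt[OF pos] sq] unfolding q_def
        by (rule DERIV_cong) (simp add: field_simps)
      have qnz: "q \<epsilon> (z + 0 *\<^sub>R i) \<noteq> 0" using q_pos[OF \<epsilon>, of z] by simp
      have "((\<lambda>s. 1 / q \<epsilon> (z + s *\<^sub>R i) ^ m) has_real_derivative (- real m / q \<epsilon> z ^ Suc m) * ((z \<bullet> i) / q \<epsilon> z)) (at 0)"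
        using DERIV_chain2[OF has_field_derivative_inverse_power[OF qnz, of m] q'] by simp
      also have "(- real m / q \<epsilon> z ^ Suc m) * ((z \<bullet> i) / q \<epsilon> z) = - (m * ((z \<bullet> i) / q \<epsilon> z ^ DIM('a)))"
        unfolding n by simp
      finally have "((\<lambda>s. 1 / q \<epsilon> (z + s *\<^sub>R i) ^ m) has_real_derivative - (m * ((z \<bullet> i) / q \<epsilon> z ^ DIM('a)))) (at 0)" .
      from DERIV_mult[OF D1' this]
      show "((\<lambda>s. D1 i (z + s *\<^sub>R i) * (1 / q \<epsilon> (z + s *\<^sub>R i) ^ m)) has_vector_derivative
        - (D2 i z * (1 / q \<epsilon> z ^ m)) - m * (D1 i z * ((z \<bullet> i) / q \<epsilon> z ^ DIM('a)))) (at 0)"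
        unfolding has_real_derivative_iff_has_vector_derivative[symmetric]
        by (rule DERIV_cong) (simp add: algebra_simps)
      show "norm (- (D2 i z * (1 / q \<epsilon> z ^ m)) - m * (D1 i z * ((z \<bullet> i) / q \<epsilon> z ^ DIM('a)))) \<le> K"
      proof -
        have "norm (- (D2 i z * (1 / q \<epsilon> z ^ m)) - m * (D1 i z * ((z \<bullet> i) / q \<epsilon> z ^ DIM('a))))
          \<le> \<bar>D2 i z * (1 / q \<epsilon> z ^ m)\<bar> + m * \<bar>D1 i z * ((z \<bullet> i) / q \<epsilon> z ^ DIM('a))\<bar>"
          using norm_triangle_ineq4[of "- (D2 i z * (1 / q \<epsilon> z ^ m))" "m * (D1 i z * ((z \<bullet> i) / q \<epsilon> z ^ DIM('a)))"]
          unfolding real_norm_def abs_minus_cancel abs_mult[of "real m"] abs_of_nat .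
        also have "\<dots> \<le> K" unfolding K_def using b1(1)[of z] b2[of z] by (intro add_mono mult_left_mono) auto
        finally show ?thesis .
      qed
    next
      show "integrable lborel (\<lambda>z. D1 i z * (1 / q \<epsilon> z ^ m))"
        by (rule integrable_bounded_support[where r = \<rho>  and B = "B * (1 / \<epsilon> ^ m)"]) (use b1 D0 in auto)
    qed (use D0 in auto)
    also have "(\<integral>z. - (D2 i z * (1 / q \<epsilon> z ^ m)) - m * (D1 i z * ((z \<bullet> i) / q \<epsilon> z ^ DIM('a))) \<partial>lborel)
      = - (\<integral>z. D2 i z * (1 / q \<epsilon> z ^ m) \<partial>lborel) - m * (\<integral>z. D1 i z * ((z \<bullet> i) / q \<epsilon> z ^ DIM('a)) \<partial>lborel)"
      by (subst Bochner_Integration.integral_diff[OF integrable_minus[OF I1] integrable_mult_right[OF I2]])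
         (simp only: integral_minus integral_mult_right_zero)
    finally show ?thesis by linarith
  qed
  define \<delta> where "\<delta> k = inverse (real (Suc k))" for k
  have \<delta>: "\<delta> k > 0" for k by (simp add: \<delta>_def)
  have q_lim: "(\<lambda>k. q (\<delta> k) z) \<longlonglongrightarrow> norm z" for z
  proof -
    have "(\<lambda>k. sqrt ((norm z)\<^sup>2 + (\<delta> k)\<^sup>2)) \<longlonglongrightarrow> sqrt ((norm z)\<^sup>2 + 0\<^sup>2)"
      unfolding \<delta>_def by (intro tendsto_intros LIMSEQ_inverse_real_of_nat)
    then show ?thesis by (simp add: q_def)
  qed
  \<comment> \<open>Because q >= |z|, the limiting integrand dominates all regularised ones; it is
    integrable as the exponent is below n. The same works for the first derivatives with exponent n
    - 1.\<close>
  have lim1: "(\<lambda>k. \<integral>z. D2 i z * (1 / q (\<delta> k) z ^ m) \<partial>lborel) \<longlonglongrightarrow> (\<integral>z. D2 i z * (1 / norm z ^ m) \<partial>lborel)" for i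
  proof -
    obtain B where B: "B \<ge> 0" "\<And>z. \<bar>D2 i z\<bar> \<le> B" using ex_bound by metis
    have int: "integrable lborel (\<lambda>z. D2 i z * (1 / norm z ^ m))"
      by (rule integrable_singular_kernel[OF _ _ B(2), where r = \<rho> and p = m]) (use D0 n in auto)
    show ?thesis
    proof (rule integral_dominated_convergence[OF _ _ integrable_norm[OF int]])
      show "AE z in lborel. (\<lambda>k. D2 i z * (1 / q (\<delta> k) z ^ m)) \<longlonglongrightarrow> D2 i z * (1 / norm z ^ m)"
        by (rule eventually_mono[OF AE_lborel_singleton[of 0]]) (intro tendsto_intros q_lim, auto)
      show "AE z in lborel. norm (D2 i z * (1 / q (\<delta> k) z ^ m)) \<le> norm (D2 i z * (1 / norm z ^ m))" for k
      proof (rule eventually_mono[OF AE_lborel_singleton[of 0]])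
        fix z :: 'a assume "z \<noteq> 0"
        then show "norm (D2 i z * (1 / q (\<delta> k) z ^ m)) \<le> norm (D2 i z * (1 / norm z ^ m))"
          unfolding norm_mult norm_divide norm_power using q_ge(1)[of z "\<delta> k"] q_pos[OF \<delta>, of k z]
          by (intro mult_left_mono frac_le power_mono) auto
      qed
    qed measurable
  qed
  have int2: "integrable lborel (\<lambda>z. D1 i z * ((z \<bullet> i) / norm z ^ DIM('a)))" if i: "i \<in> Basis" for i
  proof -
    obtain B where B: "B \<ge> 0" "\<And>z. \<bar>D1 i z\<bar> \<le> B" using ex_bound by metis
    show ?thesis
    proof (rule integrable_singular_kernel[OF _ _ B(2), where r = \<rho> and p = "Suc m"])
      show "\<bar>(z \<bullet> i) / norm z ^ DIM('a)\<bar> \<le> 1 / norm z ^ Suc m" for z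
        using Basis_le_norm[OF i, of z] unfolding n by (cases "z = 0") (auto simp: field_simps)
    qed (use D0 n in auto)
  qed
  have lim2: "(\<lambda>k. \<integral>z. D1 i z * ((z \<bullet> i) / q (\<delta> k) z ^ DIM('a)) \<partial>lborel) \<longlonglongrightarrow> (\<integral>z. D1 i z * ((z \<bullet> i) / norm z ^ DIM('a)) \<partial>lborel)"
    if i: "i \<in> Basis" for i
  proof (rule integral_dominated_convergence[OF _ _ integrable_norm[OF int2[OF i]]])
    show "AE z in lborel. (\<lambda>k. D1 i z * ((z \<bullet> i) / q (\<delta> k) z ^ DIM('a))) \<longlonglongrightarrow> D1 i z * ((z \<bullet> i) / norm z ^ DIM('a))"
      by (rule eventually_mono[OF AE_lborel_singleton[of 0]]) (intro tendsto_intros q_lim, auto)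
    show "AE z in lborel. norm (D1 i z * ((z \<bullet> i) / q (\<delta> k) z ^ DIM('a))) \<le> norm (D1 i z * ((z \<bullet> i) / norm z ^ DIM('a)))" for k
    proof (rule eventually_mono[OF AE_lborel_singleton[of 0]])
      fix z :: 'a assume "z \<noteq> 0"
      then show "norm (D1 i z * ((z \<bullet> i) / q (\<delta> k) z ^ DIM('a))) \<le> norm (D1 i z * ((z \<bullet> i) / norm z ^ DIM('a)))"
        unfolding norm_mult norm_divide norm_power using q_ge(1)[of z "\<delta> k"] q_pos[OF \<delta>, of k z]
        by (intro mult_left_mono frac_le power_mono) auto
    qed
  qed measurable
  have limit: "(\<integral>z. D2 i z * (1 / norm z ^ m) \<partial>lborel) = - (m * (\<integral>z. D1 i z * ((z \<bullet> i) / norm z ^ DIM('a)) \<partial>lborel))"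
    if i: "i \<in> Basis" for i
    using LIMSEQ_unique[OF lim1[of i]] tendsto_minus[OF tendsto_mult_left[OF lim2[OF i], of "real m"]]
    unfolding by_parts[OF i \<delta>] by blast
  have "(\<Sum>i\<in>Basis. \<integral>z. D2 i z * (1 / norm z ^ m) \<partial>lborel) =
    - (m * (\<Sum>i\<in>Basis. \<integral>z. D1 i z * ((z \<bullet> i) / norm z ^ DIM('a)) \<partial>lborel))"
    unfolding sum_distrib_left sum_negf[symmetric] by (rule sum.cong[OF refl limit])
  also have "(\<Sum>i\<in>Basis. \<integral>z. D1 i z * ((z \<bullet> i) / norm z ^ DIM('a)) \<partial>lborel) =
    (\<integral>z. (\<Sum>i\<in>Basis. D1 i z * ((z \<bullet> i) / norm z ^ DIM('a))) \<partial>lborel)"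
    by (rule Bochner_Integration.integral_sum[symmetric]) (rule int2)
  \<comment> \<open>Only after summing over the basis do the coordinates of z assemble into the
    derivative in the radial direction z itself.\<close>
  also have "\<dots> = (\<integral>z. dir_deriv f z (x - z) / norm z ^ DIM('a) \<partial>lborel)"
  proof (rule Bochner_Integration.integral_cong[OF refl])
    fix z :: 'a
    show "(\<Sum>i\<in>Basis. D1 i z * ((z \<bullet> i) / norm z ^ DIM('a))) = dir_deriv f z (x - z) / norm z ^ DIM('a)"
      unfolding dir_deriv_expand[OF f, where v = z and x = "x - z"]
      by (simp add: sum_divide_distrib mult.commute D1_def)
  qed
  also have "\<dots> = sigma_area DIM('a) * f x" by (rule integral_radial_derivative(2)[OF f])
  finally have sum: "(\<Sum>i\<in>Basis. \<integral>z. D2 i z * (1 / norm z ^ m) \<partial>lborel) = - (m * (sigma_area DIM('a) * f x))" .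
  have "m < DIM('a)" by (simp add: n)
  from laplacian_potential[OF f this, of x] sum show ?thesis
    unfolding m_def[symmetric] D2_def by simp
qed

section \<open>Uniform regularity of spherical means\<close>

text \<open>One bound B serves all \<xi> on the sphere; this uniformity supplies the majorants when
  limits are taken under the integral over \<xi>.\<close>

definition bounded_family :: "real \<Rightarrow> real \<Rightarrow> real \<Rightarrow> ('a::euclidean_space \<Rightarrow> real \<Rightarrow> real) \<Rightarrow> bool" where
  "bounded_family R a b F \<longleftrightarrow> (\<exists>B. \<forall>\<xi>. norm \<xi> = R \<longrightarrow> continuous_on {0<..} (F \<xi>) \<and>
     (\<forall>t>0. \<bar>F \<xi> t\<bar> \<le> B \<and> (t < a \<or> t > b \<longrightarrow> F \<xi> t = 0)))"

text \<open>Joint measurability is required for all \<open>\<xi>\<close>, not only for \<open>|\<xi>| = R\<close>: the surface measure lives on the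
  Borel sets of the whole space, and the Bochner integral of a function that is not measurable there is 0.\<close>
definition admissible0 :: "real \<Rightarrow> real \<Rightarrow> real \<Rightarrow> ('a::euclidean_space \<Rightarrow> real \<Rightarrow> real) \<Rightarrow> bool" where
  "admissible0 R a b F \<longleftrightarrow> bounded_family R a b F \<and>
     (\<lambda>(\<xi>, t). indicator {0<..} t * F \<xi> t) \<in> borel_measurable (borel \<Otimes>\<^sub>M borel)"

text \<open>Regularity of order k in the variable t^2. The derivative is an explicit witness instead
  of \<open>Dop\<close>, so its bounds and joint measurability come from a formula; the equation is
  required for every \<xi>, so that they pass to \<open>Dop\<close> everywhere.\<close>

fun admissible :: "real \<Rightarrow> real \<Rightarrow> real \<Rightarrow> nat \<Rightarrow> ('a::euclidean_space \<Rightarrow> real \<Rightarrow> real) \<Rightarrow> bool" where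
  "admissible R a b 0 F = admissible0 R a b F"
| "admissible R a b (Suc k) F = (admissible0 R a b F \<and> (\<exists>F'. admissible R a b k F' \<and>
     (\<forall>\<xi> t. t > 0 \<longrightarrow> (F \<xi> has_real_derivative 2 * t * F' \<xi> t) (at t))))"

lemma admissible_imp_0: "admissible R a b k F \<Longrightarrow> admissible0 R a b F"
  by (cases k) auto

lemma bounded_family_cong:
  assumes "\<And>\<xi> t. norm \<xi> = R \<Longrightarrow> t > 0 \<Longrightarrow> F \<xi> t = G \<xi> t"
  shows "bounded_family R a b F \<longleftrightarrow> bounded_family R a b G"
proof -
  have "continuous_on {0<..} (F \<xi>) \<longleftrightarrow> continuous_on {0<..} (G \<xi>)" if "norm \<xi> = R" for \<xi>
    using assms[OF that] by (intro continuous_on_cong) auto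
  then have "(norm \<xi> = R \<longrightarrow> continuous_on {0<..} (F \<xi>) \<and> (\<forall>t>0. \<bar>F \<xi> t\<bar> \<le> B \<and> (t < a \<or> t > b \<longrightarrow> F \<xi> t = 0))) \<longleftrightarrow>
    (norm \<xi> = R \<longrightarrow> continuous_on {0<..} (G \<xi>) \<and> (\<forall>t>0. \<bar>G \<xi> t\<bar> \<le> B \<and> (t < a \<or> t > b \<longrightarrow> G \<xi> t = 0)))" for \<xi> B
    using assms[of \<xi>] by auto
  then show ?thesis unfolding bounded_family_def by simp
qed

lemma admissible0_cong:
  assumes "\<And>\<xi> t. t > 0 \<Longrightarrow> F \<xi> t = G \<xi> t"
  shows "admissible0 R a b F \<longleftrightarrow> admissible0 R a b G"
proof -
  have "bounded_family R a b F = bounded_family R a b G" by (rule bounded_family_cong) (rule assms)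
  moreover have "(\<lambda>(\<xi>, t). indicator {0<..} t * F \<xi> t) = (\<lambda>(\<xi>, t). indicator {0<..} t * G \<xi> t)"
    using assms by (auto simp: fun_eq_iff indicator_def)
  ultimately show ?thesis unfolding admissible0_def by simp
qed

text \<open>Only t > 0 is compared. There \<open>Dop\<close> divides by a nonzero number and
  \<open>powr\<close> agrees with natural powers, and derivatives at t > 0 see only positive
  arguments.\<close>

lemma admissible_cong:
  assumes "\<And>\<xi> t. t > 0 \<Longrightarrow> F \<xi> t = G \<xi> t"
  shows "admissible R a b k F \<longleftrightarrow> admissible R a b k G"
proof (cases k)
  case 0
  then show ?thesis using admissible0_cong[OF assms] by simp
next
  case (Suc j)
  have "(F \<xi> has_real_derivative D) (at t) \<longleftrightarrow> (G \<xi> has_real_derivative D) (at t)" if "t > 0" for \<xi> t D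
  proof (rule DERIV_cong_ev[OF refl _ refl])
    show "\<forall>\<^sub>F x in nhds t. F \<xi> x = G \<xi> x"
      using eventually_nhds_in_open[of "{0<..}" t] that assms by (auto elim: eventually_mono)
  qed
  then have eq: "(\<forall>\<xi> t. t > 0 \<longrightarrow> (F \<xi> has_real_derivative 2 * t * F' \<xi> t) (at t)) \<longleftrightarrow>
    (\<forall>\<xi> t. t > 0 \<longrightarrow> (G \<xi> has_real_derivative 2 * t * F' \<xi> t) (at t))" for F'
    by blast
  have "admissible0 R a b F = admissible0 R a b G" by (rule admissible0_cong[OF assms])
  then show ?thesis unfolding Suc admissible.simps eq by simp
qed

lemma bounded_family_add:
  assumes "bounded_family R a b F" "bounded_family R a b G"
  shows "bounded_family R a b (\<lambda>\<xi> t. F \<xi> t + G \<xi> t)"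
proof -
  obtain B1 where 1: "\<forall>\<xi>. norm \<xi> = R \<longrightarrow> continuous_on {0<..} (F \<xi>) \<and>
     (\<forall>t>0. \<bar>F \<xi> t\<bar> \<le> B1 \<and> (t < a \<or> t > b \<longrightarrow> F \<xi> t = 0))" using assms(1) unfolding bounded_family_def by blast
  obtain B2 where 2: "\<forall>\<xi>. norm \<xi> = R \<longrightarrow> continuous_on {0<..} (G \<xi>) \<and>
     (\<forall>t>0. \<bar>G \<xi> t\<bar> \<le> B2 \<and> (t < a \<or> t > b \<longrightarrow> G \<xi> t = 0))" using assms(2) unfolding bounded_family_def by blast
  show ?thesis unfolding bounded_family_def
  proof (intro exI[of _ "B1 + B2"] allI impI conjI)
    fix \<xi> :: 'a and t :: real assume \<xi>: "norm \<xi> = R"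
    show "continuous_on {0<..} (\<lambda>t. F \<xi> t + G \<xi> t)" using 1 2 \<xi> by (intro continuous_on_add) auto
    assume "t > 0"
    with 1 2 \<xi> have "\<bar>F \<xi> t\<bar> \<le> B1" "\<bar>G \<xi> t\<bar> \<le> B2" by auto
    then show "\<bar>F \<xi> t + G \<xi> t\<bar> \<le> B1 + B2" by linarith
    assume "t < a \<or> b < t"
    with 1 2 \<xi> \<open>t > 0\<close> have "F \<xi> t = 0" "G \<xi> t = 0" by blast+
    then show "F \<xi> t + G \<xi> t = 0" by simp
  qed
qed

lemma admissible0_add:
  assumes "admissible0 R a b F" "admissible0 R a b G"
  shows "admissible0 R a b (\<lambda>\<xi> t. F \<xi> t + G \<xi> t)"
proof -
  have "(\<lambda>x. (\<lambda>(\<xi>, t). indicator {0<..} t * F \<xi> t) x + (\<lambda>(\<xi>, t). indicator {0<..} t * G \<xi> t) x) \<in> borel_measurable (borel \<Otimes>\<^sub>M borel)"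
    using assms unfolding admissible0_def by (intro borel_measurable_add) auto
  then show ?thesis
    using bounded_family_add assms unfolding admissible0_def by (auto simp: case_prod_unfold distrib_left)
qed

lemma admissible_add:
  "admissible R a b k F \<Longrightarrow> admissible R a b k G \<Longrightarrow> admissible R a b k (\<lambda>\<xi> t. F \<xi> t + G \<xi> t)"
proof (induction k arbitrary: F G)
  case (Suc k)
  obtain F' where F': "admissible R a b k F'"
    "\<And>\<xi> t. t > 0 \<Longrightarrow> (F \<xi> has_real_derivative 2 * t * F' \<xi> t) (at t)"
    using Suc.prems(1) by auto
  obtain G' where G': "admissible R a b k G'"
    "\<And>\<xi> t. t > 0 \<Longrightarrow> (G \<xi> has_real_derivative 2 * t * G' \<xi> t) (at t)"
    using Suc.prems(2) by auto
  have "((\<lambda>t. F \<xi> t + G \<xi> t) has_real_derivative 2 * t * (F' \<xi> t + G' \<xi> t)) (at t)" if "t > 0" for \<xi> t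
    using DERIV_add[OF F'(2) G'(2), OF that that] by (simp add: algebra_simps)
  then show ?case
    using admissible0_add Suc.prems Suc.IH[OF F'(1) G'(1)] by (auto intro!: exI[of _ "\<lambda>\<xi> t. F' \<xi> t + G' \<xi> t"])
qed (simp add: admissible0_add)

lemma admissible_zero: "admissible R a b k (\<lambda>\<xi> t. 0)"
proof (induction k)
  have base: "admissible0 R a b (\<lambda>\<xi> t. 0)"
    unfolding admissible0_def bounded_family_def by (auto intro!: exI[of _ 0])
  {
    case 0
    show ?case using base by simp
  next
    case (Suc k)
    then show ?case using base by (auto intro!: exI[of _ "\<lambda>\<xi> t. 0"])
  }
qed

lemma admissible_sum:
  "finite I \<Longrightarrow> (\<And>i. i \<in> I \<Longrightarrow> admissible R a b k (F i)) \<Longrightarrow> admissible R a b k (\<lambda>\<xi> t. \<Sum>i\<in>I. F i \<xi> t)"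
  by (induction I rule: finite_induct) (auto intro: admissible_zero admissible_add)

lemma admissible_Suc_deriv:
  assumes "admissible R a b (Suc k) F" "t > 0"
  shows "(F \<xi> has_real_derivative 2 * t * Dop (F \<xi>) t) (at t)"
proof -
  obtain D where D: "(F \<xi> has_real_derivative 2 * t * D) (at t)" using assms by auto
  then show ?thesis using DERIV_imp_deriv[OF D] assms(2) by (simp add: Dop_def)
qed

lemma admissible_Dop:
  assumes "admissible R a b (Suc k) F"
  shows "admissible R a b k (\<lambda>\<xi>. Dop (F \<xi>))"
proof -
  obtain F' where F': "admissible R a b k F'"
    "\<And>\<xi> t. t > 0 \<Longrightarrow> (F \<xi> has_real_derivative 2 * t * F' \<xi> t) (at t)"
    using assms by auto
  have "admissible R a b k (\<lambda>\<xi>. Dop (F \<xi>)) \<longleftrightarrow> admissible R a b k F'"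
    by (rule admissible_cong) (simp add: Dop_def DERIV_imp_deriv[OF F'(2)])
  with F'(1) show ?thesis by simp
qed

lemma admissible_Dop_power:
  "admissible R a b (j + k) F \<Longrightarrow> admissible R a b k (\<lambda>\<xi>. (Dop ^^ j) (F \<xi>))"
proof (induction j arbitrary: k)
  case (Suc j)
  then have "admissible R a b (j + Suc k) F" by (simp only: add_Suc_right add_Suc)
  then have "admissible R a b (Suc k) (\<lambda>\<xi>. (Dop ^^ j) (F \<xi>))" by (rule Suc.IH)
  from admissible_Dop[OF this] show ?case by simp
qed simp

text \<open>Spherical means with an angular weight form a class closed under differentiation in t,
  which plain spherical means do not.\<close>

definition weighted_mean :: "('a::euclidean_space \<Rightarrow> real) \<Rightarrow> ('a \<Rightarrow> real) \<Rightarrow> 'a \<Rightarrow> real \<Rightarrow> real" where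
  "weighted_mean g p \<xi> t = (\<integral>\<theta>. g (\<xi> - t *\<^sub>R \<theta>) * p \<theta> \<partial>sphere_surface 0 1)"

context
  fixes p :: "'a::euclidean_space \<Rightarrow> real" and C r :: real and g :: "'a \<Rightarrow> real"
  assumes p[measurable]: "p \<in> borel_measurable borel" and C: "\<And>\<theta>. norm \<theta> = 1 \<Longrightarrow> \<bar>p \<theta>\<bar> \<le> C"
    and g: "test_function r g"
begin

lemma weighted_mean_integrable: "integrable (sphere_surface 0 1) (\<lambda>\<theta>. g (\<xi> - t *\<^sub>R \<theta>) * p \<theta>)"
proof -
  obtain B where B: "B \<ge> 0" "\<And>y. \<bar>g y\<bar> \<le> B" using test_function_bounded[OF g] by metis
  note [measurable] = test_function_measurable[OF g]
  show ?thesis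
  proof (rule unit_sphere.integrable_const_bound[where B = "B * C"])
    show "AE \<theta> in sphere_surface 0 1. norm (g (\<xi> - t *\<^sub>R \<theta>) * p \<theta>) \<le> B * C"
      by (rule eventually_mono[OF AE_sphere_surface[of 1]])
         (auto simp: abs_mult intro!: mult_mono B C)
  qed measurable
qed

lemma weighted_mean_bound: "\<exists>B\<ge>0. \<forall>\<xi> t. \<bar>weighted_mean g p \<xi> t\<bar> \<le> B"
proof -
  obtain B where B: "B \<ge> 0" "\<And>y. \<bar>g y\<bar> \<le> B" using test_function_bounded[OF g] by metis
  have "\<bar>weighted_mean g p \<xi> t\<bar> \<le> \<bar>B * C\<bar> * sigma_area DIM('a)" for \<xi> t
  proof -
    have "\<bar>weighted_mean g p \<xi> t\<bar> \<le> (\<integral>\<theta>. \<bar>g (\<xi> - t *\<^sub>R \<theta>) * p \<theta>\<bar> \<partial>sphere_surface 0 1)"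
      unfolding weighted_mean_def by (rule integral_abs_bound)
    also have "\<dots> \<le> (\<integral>\<theta>. \<bar>B * C\<bar> \<partial>(sphere_surface 0 1 :: 'a measure))"
    proof (rule integral_mono_AE)
      show "integrable (sphere_surface 0 1) (\<lambda>\<theta>. \<bar>g (\<xi> - t *\<^sub>R \<theta>) * p \<theta>\<bar>)"
        by (intro integrable_abs weighted_mean_integrable)
      have *: "\<bar>g (\<xi> - t *\<^sub>R \<theta>) * p \<theta>\<bar> \<le> \<bar>B * C\<bar>" if "norm \<theta> = 1" for \<theta>
      proof -
        have "\<bar>g (\<xi> - t *\<^sub>R \<theta>) * p \<theta>\<bar> \<le> B * C"
          unfolding abs_mult using B C[OF that] by (intro mult_mono) auto
        then show ?thesis by linarith
      qed
      show "AE \<theta> in sphere_surface 0 1. \<bar>g (\<xi> - t *\<^sub>R \<theta>) * p \<theta>\<bar> \<le> \<bar>B * C\<bar>"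
        by (rule eventually_mono[OF AE_sphere_surface[of 1] *]) simp_all
    qed simp
    also have "\<dots> = \<bar>B * C\<bar> * sigma_area DIM('a)" by (simp add: measure_sphere_surface_1)
    finally show ?thesis .
  qed
  then show ?thesis using sigma_area_pos[of "DIM('a)"]
    by (intro exI[of _ "\<bar>B * C\<bar> * sigma_area DIM('a)"]) (auto simp: Suc_leI less_imp_le)
qed

text \<open>The sphere of radius t about \<xi> stays at distance at least |R - t| from the origin,
  hence misses the support.\<close>

lemma weighted_mean_eq_0:
  assumes "norm \<xi> = R" "t > 0" "t < R - r \<or> t > R + r"
  shows "weighted_mean g p \<xi> t = 0"
proof -
  have *: "g (\<xi> - t *\<^sub>R \<theta>) * p \<theta> = 0" if "norm \<theta> = 1" for \<theta>
  proof -
    have "\<bar>norm \<xi> - norm (t *\<^sub>R \<theta>)\<bar> \<le> norm (\<xi> - t *\<^sub>R \<theta>)" by (rule norm_triangle_ineq3)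
    then have "norm (\<xi> - t *\<^sub>R \<theta>) > r" using assms that by auto
    then show ?thesis using test_function_eq_0[OF g] by simp
  qed
  have "AE \<theta> in sphere_surface 0 1. g (\<xi> - t *\<^sub>R \<theta>) * p \<theta> = 0"
    by (rule eventually_mono[OF AE_sphere_surface[of 1] *]) simp_all
  then show ?thesis unfolding weighted_mean_def by (rule integral_eq_zero_AE)
qed

end

text \<open>The t-derivative is the derivative of g in direction -\<theta>, which varies with
  \<theta>. Expanding it in the basis moves this dependence into the weights and stays within the
  class.\<close>

lemma weighted_mean_deriv:
  fixes p g :: "'a::euclidean_space \<Rightarrow> real"
  assumes p[measurable]: "p \<in> borel_measurable borel" and C: "\<And>\<theta>. norm \<theta> = 1 \<Longrightarrow> \<bar>p \<theta>\<bar> \<le> C"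
    and g: "test_function r g"
  shows "(weighted_mean g p \<xi> has_real_derivative
    (\<Sum>i\<in>Basis. weighted_mean (dir_deriv g i) (\<lambda>\<theta>. - (\<theta> \<bullet> i) * p \<theta>) \<xi> t0)) (at t0)"
proof -
  obtain B where B: "B \<ge> 0" "\<And>y v. \<bar>dir_deriv g v y\<bar> \<le> B * norm v" using dir_deriv_bounded[OF g] by metis
  note [measurable] = test_function_measurable[OF g] test_function_measurable[OF test_function_dir_deriv[OF g]]
  define F' where "F' s \<theta> = (\<Sum>i\<in>Basis. dir_deriv g i (\<xi> - s *\<^sub>R \<theta>) * (- (\<theta> \<bullet> i) * p \<theta>))" for s \<theta>
  have F'_eq: "F' s \<theta> = - dir_deriv g \<theta> (\<xi> - s *\<^sub>R \<theta>) * p \<theta>" for s \<theta>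
    unfolding F'_def dir_deriv_expand[OF g, where v = \<theta> and x = "\<xi> - s *\<^sub>R \<theta>"]
    by (simp add: sum_distrib_left sum_negf mult_ac)
  have int: "integrable (sphere_surface 0 1) (\<lambda>\<theta>. dir_deriv g i (\<xi> - s *\<^sub>R \<theta>) * (- (\<theta> \<bullet> i) * p \<theta>))" if "i \<in> Basis" for i s
  proof (rule weighted_mean_integrable[OF _ _ test_function_dir_deriv[OF g], where C = C])
    fix \<theta> :: 'a assume "norm \<theta> = 1"
    then have "\<bar>\<theta> \<bullet> i\<bar> * \<bar>p \<theta>\<bar> \<le> 1 * C"
      using Basis_le_norm[OF that, of \<theta>] C[of \<theta>] by (intro mult_mono) auto
    then show "\<bar>- (\<theta> \<bullet> i) * p \<theta>\<bar> \<le> C" by (simp add: abs_mult)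
  qed measurable
  have "((\<lambda>s. \<integral>\<theta>. g (\<xi> - s *\<^sub>R \<theta>) * p \<theta> \<partial>sphere_surface 0 1) has_vector_derivative (\<integral>\<theta>. F' t0 \<theta> \<partial>sphere_surface 0 1)) (at t0)"
  proof (rule has_vector_derivative_integral[where r = 1 and G = "\<lambda>_. B * C"])
    show "integrable (sphere_surface 0 1) (\<lambda>\<theta>. g (\<xi> - s *\<^sub>R \<theta>) * p \<theta>)" for s
      by (rule weighted_mean_integrable[OF p C g])
    have *: "\<forall>s. \<bar>s - t0\<bar> < 1 \<longrightarrow>
      ((\<lambda>s. g (\<xi> - s *\<^sub>R \<theta>) * p \<theta>) has_vector_derivative F' s \<theta>) (at s) \<and> norm (F' s \<theta>) \<le> B * C" if \<theta>: "norm \<theta> = 1" for \<theta>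
    proof (intro allI impI conjI)
      fix s
      have "((\<lambda>s. g (\<xi> + (- s) *\<^sub>R \<theta>)) has_real_derivative dir_deriv g \<theta> (\<xi> + (- s) *\<^sub>R \<theta>) * (- 1)) (at s)"
        by (intro DERIV_chain2[OF test_function_line_deriv[OF g]]) (auto intro!: derivative_eq_intros)
      then have "((\<lambda>s. g (\<xi> - s *\<^sub>R \<theta>) * p \<theta>) has_real_derivative (dir_deriv g \<theta> (\<xi> - s *\<^sub>R \<theta>) * (- 1)) * p \<theta>) (at s)"
        by (intro DERIV_cmult_right) simp
      then show "((\<lambda>s. g (\<xi> - s *\<^sub>R \<theta>) * p \<theta>) has_vector_derivative F' s \<theta>) (at s)"
        unfolding has_real_derivative_iff_has_vector_derivative[symmetric] F'_eq by simp
      show "norm (F' s \<theta>) \<le> B * C"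
        unfolding F'_eq using B(2)[of "\<xi> - s *\<^sub>R \<theta>" \<theta>] B(1) C[OF \<theta>] \<theta> by (auto simp: abs_mult intro!: mult_mono)
    qed
    show "AE \<theta> in sphere_surface 0 1. \<forall>s. \<bar>s - t0\<bar> < 1 \<longrightarrow>
      ((\<lambda>s. g (\<xi> - s *\<^sub>R \<theta>) * p \<theta>) has_vector_derivative F' s \<theta>) (at s) \<and> norm (F' s \<theta>) \<le> B * C"
      by (rule eventually_mono[OF AE_sphere_surface[of 1] *]) simp_all
    show "F' t0 \<in> borel_measurable (sphere_surface 0 1)" unfolding F'_def[abs_def] by measurable
  qed auto
  moreover have "(\<integral>\<theta>. F' t0 \<theta> \<partial>sphere_surface 0 1) =
      (\<Sum>i\<in>Basis. weighted_mean (dir_deriv g i) (\<lambda>\<theta>. - (\<theta> \<bullet> i) * p \<theta>) \<xi> t0)"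
    unfolding F'_def weighted_mean_def by (rule Bochner_Integration.integral_sum) (rule int)
  ultimately show ?thesis
    unfolding has_real_derivative_iff_has_vector_derivative by (simp add: weighted_mean_def[abs_def])
qed

lemma powr_le_interval:
  assumes "0 < a" "a \<le> t" "t \<le> b"
  shows "t powr \<alpha> \<le> a powr \<alpha> + b powr (\<alpha>::real)"
proof (cases "\<alpha> \<ge> 0")
  case True
  then have "t powr \<alpha> \<le> b powr \<alpha>" using assms by (intro powr_mono2) auto
  then show ?thesis by (simp add: add_increasing)
next
  case False
  then have "t powr \<alpha> \<le> a powr \<alpha>" using assms by (intro powr_mono2') auto
  then show ?thesis by (simp add: add_increasing2)
qed

text \<open>Induction over all exponents, weights and test functions at once. Each application of D
  lowers the power of t by one or two, so real exponents, eventually negative ones, are allowed;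
  they stay bounded because the mean vanishes for t < R - r and R - r > 0.\<close>

lemma admissible_weighted_mean:
  fixes p g :: "'a::euclidean_space \<Rightarrow> real"
  assumes "0 \<le> r" "r < R"
    and "p \<in> borel_measurable borel" "\<And>\<theta>. norm \<theta> = 1 \<Longrightarrow> \<bar>p \<theta>\<bar> \<le> C" "test_function r g"
  shows "admissible R (R - r) (R + r) k (\<lambda>\<xi> t. t powr \<alpha> * weighted_mean g p \<xi> t)"
  using assms(3-)
proof (induction k arbitrary: \<alpha> p C g)
  have base: "bounded_family R (R - r) (R + r) (\<lambda>\<xi> t. t powr \<alpha> * weighted_mean g p \<xi> t)"
    if p: "p \<in> borel_measurable borel" and C: "\<And>\<theta>. norm \<theta> = 1 \<Longrightarrow> \<bar>p \<theta>\<bar> \<le> C" and g: "test_function r g" for \<alpha> p C and g :: "'a \<Rightarrow> real"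
  proof -
    obtain B where B: "B \<ge> 0" "\<And>\<xi> t. \<bar>weighted_mean g p \<xi> t\<bar> \<le> B" using weighted_mean_bound[OF p C g] by blast
    show ?thesis unfolding bounded_family_def
    proof (intro exI[of _ "((R - r) powr \<alpha> + (R + r) powr \<alpha>) * B"] allI impI conjI)
      fix \<xi> :: 'a and t :: real assume \<xi>: "norm \<xi> = R"
      have "isCont (weighted_mean g p \<xi>) t" for t
        using weighted_mean_deriv[OF p C g] by (rule DERIV_isCont)
      then show "continuous_on {0<..} (\<lambda>t. t powr \<alpha> * weighted_mean g p \<xi> t)"
        by (intro continuous_intros continuous_at_imp_continuous_on) auto
      assume t: "t > 0"
      show "t < R - r \<or> R + r < t \<Longrightarrow> t powr \<alpha> * weighted_mean g p \<xi> t = 0"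
        using weighted_mean_eq_0[OF p C g \<xi> t] by simp
      show "\<bar>t powr \<alpha> * weighted_mean g p \<xi> t\<bar> \<le> ((R - r) powr \<alpha> + (R + r) powr \<alpha>) * B"
      proof (cases "t < R - r \<or> R + r < t")
        case True
        then show ?thesis using weighted_mean_eq_0[OF p C g \<xi> t] B(1) by simp
      next
        case False
        then show ?thesis unfolding abs_mult using B \<open>r < R\<close> powr_le_interval[of "R - r" t "R + r" \<alpha>]
          by (intro mult_mono) auto
      qed
    qed
  qed
  have meas: "(\<lambda>(\<xi>, t). indicator {0<..} t * (t powr \<alpha> * weighted_mean g p \<xi> t)) \<in> borel_measurable (borel \<Otimes>\<^sub>M borel)"
    if [measurable]: "p \<in> borel_measurable borel" and g: "test_function r g" for \<alpha> p and g :: "'a \<Rightarrow> real"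
  proof -
    note [measurable] = test_function_measurable[OF g]
    show ?thesis unfolding weighted_mean_def by measurable
  qed
  {
    case 0
    show ?case unfolding admissible.simps admissible0_def using base[OF 0] meas[OF 0(1,3)] by simp
  next
    case (Suc k)
    note p = Suc.prems(1) and C = Suc.prems(2) and g = Suc.prems(3)
    note [measurable] = p
    \<comment> \<open>The product rule divided by 2t, with the numerical factors absorbed into the
      weights so that the induction hypothesis applies to every summand.\<close>
    define F' where "F' \<xi> t = t powr (\<alpha> - 2) * weighted_mean g (\<lambda>\<theta>. \<alpha> / 2 * p \<theta>) \<xi> t +
      (\<Sum>i\<in>Basis. t powr (\<alpha> - 1) * weighted_mean (dir_deriv g i) (\<lambda>\<theta>. - (\<theta> \<bullet> i) / 2 * p \<theta>) \<xi> t)" for \<xi> t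
    have "admissible R (R - r) (R + r) k F'"
      unfolding F'_def
    proof (intro admissible_add admissible_sum)
      show "admissible R (R - r) (R + r) k (\<lambda>\<xi> t. t powr (\<alpha> - 2) * weighted_mean g (\<lambda>\<theta>. \<alpha> / 2 * p \<theta>) \<xi> t)"
        by (rule Suc.IH[where C = "\<bar>\<alpha> / 2\<bar> * C"]) (use g C in \<open>auto simp: abs_mult intro!: mult_left_mono divide_right_mono\<close>)
      show "admissible R (R - r) (R + r) k (\<lambda>\<xi> t. t powr (\<alpha> - 1) * weighted_mean (dir_deriv g i) (\<lambda>\<theta>. - (\<theta> \<bullet> i) / 2 * p \<theta>) \<xi> t)"
        if "i \<in> Basis" for i
      proof (rule Suc.IH[where C = C])
        fix \<theta> :: 'a assume "norm \<theta> = 1"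
        then have "(\<bar>\<theta> \<bullet> i\<bar> / 2) * \<bar>p \<theta>\<bar> \<le> 1 * C"
          using Basis_le_norm[OF that, of \<theta>] C[of \<theta>] by (intro mult_mono) auto
        then show "\<bar>- (\<theta> \<bullet> i) / 2 * p \<theta>\<bar> \<le> C" by (simp add: abs_mult)
      qed (use test_function_dir_deriv[OF g] in auto)
    qed simp
    moreover have "((\<lambda>t. t powr \<alpha> * weighted_mean g p \<xi> t) has_real_derivative 2 * t * F' \<xi> t) (at t)"
      if "t > 0" for \<xi> t
    proof -
      have "((\<lambda>t. t powr \<alpha>) has_real_derivative \<alpha> * t powr (\<alpha> - 1)) (at t)"
        using that by (auto intro!: derivative_eq_intros)
      from DERIV_mult[OF this weighted_mean_deriv[OF p C g, of \<xi>]]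
      show ?thesis
      proof (rule DERIV_cong)
        have 1: "t powr (\<alpha> - 1) = t * t powr (\<alpha> - 2)" "t powr \<alpha> = t * t powr (\<alpha> - 1)"
          using that by (simp_all add: powr_diff power2_eq_square)
        have 2: "weighted_mean g (\<lambda>\<theta>. \<alpha> / 2 * p \<theta>) \<xi> t = \<alpha> / 2 * weighted_mean g p \<xi> t"
          unfolding weighted_mean_def integral_mult_right_zero[symmetric] by (simp add: mult_ac)
        have 3: "weighted_mean (dir_deriv g i) (\<lambda>\<theta>. - (\<theta> \<bullet> i) / 2 * p \<theta>) \<xi> t = 1 / 2 * weighted_mean (dir_deriv g i) (\<lambda>\<theta>. - (\<theta> \<bullet> i) * p \<theta>) \<xi> t" for i
          unfolding weighted_mean_def integral_mult_right_zero[symmetric] by (simp add: mult_ac)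
        show "\<alpha> * t powr (\<alpha> - 1) * weighted_mean g p \<xi> t +
          (\<Sum>i\<in>Basis. weighted_mean (dir_deriv g i) (\<lambda>\<theta>. - (\<theta> \<bullet> i) * p \<theta>) \<xi> t) * t powr \<alpha> = 2 * t * F' \<xi> t"
          unfolding F'_def 2 3 unfolding 1(2) sum_distrib_left[symmetric] unfolding 1(1)
          by (simp add: algebra_simps)
      qed
    qed
    ultimately show ?case using base[OF p C g] meas[OF p g] unfolding admissible.simps admissible0_def by blast
  }
qed

section \<open>Logarithmic moments\<close>

lemma integral_lborel_reflect:
  fixes g :: "'a::euclidean_space \<Rightarrow> 'b::{banach, second_countable_topology}"
  assumes "g \<in> borel_measurable borel"
  shows "(\<integral>x. g (c - x) \<partial>lborel) = (\<integral>x. g x \<partial>lborel)"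
    and "integrable lborel (\<lambda>x. g (c - x)) \<longleftrightarrow> integrable lborel g"
proof -
  have eq: "distr lborel borel (\<lambda>x. c - x) = (lborel :: 'a measure)"
    using lborel_affine[of "-1" c] by (simp add: density_1)
  show "(\<integral>x. g (c - x) \<partial>lborel) = (\<integral>x. g x \<partial>lborel)"
    using integral_distr[of "\<lambda>x. c - x" lborel borel g] assms unfolding eq by simp
  show "integrable lborel (\<lambda>x. g (c - x)) \<longleftrightarrow> integrable lborel g"
    using integrable_distr_eq[of "\<lambda>x. c - x" lborel borel g] assms unfolding eq by simp
qed

text \<open>From ln y <= y - 1 applied to y = x^(-1/2), near 0 the logarithm is at most 2 x^(-1/2),
  an integrable power; for x >= 1 it is at most x.\<close>

lemma integrable_abs_ln:
  assumes "c \<ge> 0"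
  shows "integrable lborel (\<lambda>u::real. indicator {-c..c} u * \<bar>ln \<bar>u\<bar>\<bar>)"
proof -
  define P where "P u = indicator {0..c} u *\<^sub>R (u powr (-1/2))" for u :: real
  have "(\<lambda>u. u powr (-1/2)) absolutely_integrable_on {0..c}"
    using integrable_on_powr_from_0[of "-1/2" c] assms by (intro nonnegative_absolutely_integrable_1) auto
  then have P: "integrable lborel P"
    unfolding set_integrable_def P_def by (subst (asm) integrable_completion) measurable
  have P_neg: "integrable lborel (\<lambda>u. P (- u))"
    using lborel_integrable_real_affine[OF P, of "-1" 0] by simp
  have int: "integrable lborel (\<lambda>u. 2 * P u + 2 * P (- u) + indicator {-c..c} u * c)"
    using assms by (intro Bochner_Integration.integrable_add integrable_mult_right P P_neg integrable_mult_left integrable_real_indicator) auto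
  show ?thesis
  proof (rule Bochner_Integration.integrable_bound[OF int])
    show "AE u in lborel. norm (indicator {-c..c} u * \<bar>ln \<bar>u\<bar>\<bar>) \<le> norm (2 * P u + 2 * P (- u) + indicator {-c..c} u * c)"
    proof (rule eventually_mono[OF AE_lborel_singleton[of 0]])
      fix u :: real assume "u \<noteq> 0"
      define x where "x = \<bar>u\<bar>"
      have x: "x > 0" using \<open>u \<noteq> 0\<close> by (simp add: x_def)
      have bound: "\<bar>ln x\<bar> \<le> 2 * x powr (-1/2) + x"
      proof (cases "x \<ge> 1")
        case True
        then have "\<bar>ln x\<bar> \<le> x" using ln_le_minus_one[of x] by (simp add: ln_ge_zero)
        then show ?thesis by (simp add: add_increasing)
      next
        case False
        have "ln (x powr (-1/2)) \<le> x powr (-1/2) - 1" using x by (intro ln_le_minus_one) auto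
        then have "- ln x \<le> 2 * x powr (-1/2) - 2" using x by (simp add: ln_powr)
        then show ?thesis using False x by (simp add: abs_if)
      qed
      show "norm (indicator {-c..c} u * \<bar>ln \<bar>u\<bar>\<bar>) \<le> norm (2 * P u + 2 * P (- u) + indicator {-c..c} u * c)"
      proof (cases "u \<in> {-c..c}")
        case True
        have "P u + P (- u) = x powr (-1/2)"
          using True \<open>u \<noteq> 0\<close> by (cases "u > 0") (auto simp: P_def x_def indicator_def)
        then have "2 * x powr (-1/2) = 2 * P u + 2 * P (- u)" by simp
        moreover have "x \<le> c" using True by (auto simp: x_def)
        ultimately have "\<bar>ln x\<bar> \<le> 2 * P u + 2 * P (- u) + c" using bound by linarith
        then show ?thesis using True by (simp add: x_def)
      qed auto
    qed
  qed measurable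
qed

section \<open>Boundary values of the complex logarithm along a sequence of heights in (0,
  1]\<close>

definition inv_seq :: "nat \<Rightarrow> real" where "inv_seq k = inverse (real (Suc k))"

lemma inv_seq: "inv_seq k > 0" "inv_seq k \<le> 1" "inv_seq \<longlonglongrightarrow> 0"
  using LIMSEQ_inverse_real_of_nat by (auto simp: inv_seq_def[abs_def] divide_simps)

lemma tendsto_Complex_inv_seq: "(\<lambda>k. Complex y (s * inv_seq k)) \<longlonglongrightarrow> of_real y"
proof -
  have "(\<lambda>k. Complex y (s * inv_seq k)) \<longlonglongrightarrow> Complex y (s * 0)"
    by (intro tendsto_Complex tendsto_intros inv_seq)
  then show ?thesis by (simp add: complex_of_real_def)
qed

text \<open>The negative axis is the branch cut and is approached from above, where the argument
  tends to \<pi>. Writing Ln w as Ln(-w) + i \<pi> moves the limit to the positive axis, where Ln is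
  continuous.\<close>

lemma Im_Ln_tendsto:
  assumes "y \<noteq> 0"
  shows "(\<lambda>k. Im (Ln (Complex y (inv_seq k)))) \<longlonglongrightarrow> (if y > 0 then 0 else pi)"
proof (cases "y > 0")
  case True
  have "(\<lambda>k. Ln (Complex y (1 * inv_seq k))) \<longlonglongrightarrow> Ln (of_real y)"
    by (intro tendsto_Ln tendsto_Complex_inv_seq) (use True in auto)
  from tendsto_Im[OF this] show ?thesis using True by (simp add: Ln_of_real)
next
  case False
  then have y: "- y > 0" using assms by simp
  have eq: "Ln (Complex y (inv_seq k)) = Ln (Complex (- y) ((- 1) * inv_seq k)) + \<i> * pi" for k
  proof -
    have "Complex y (inv_seq k) = - Complex (- y) ((- 1) * inv_seq k)" by (simp add: complex_eq_iff)
    moreover have "Complex (- y) ((- 1) * inv_seq k) \<noteq> 0" using y by (simp add: complex_eq_iff)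
    ultimately show ?thesis
      using Ln_minus[of "Complex (- y) ((- 1) * inv_seq k)"] inv_seq(1)[of k] y by simp
  qed
  have "(\<lambda>k. Ln (Complex (- y) ((- 1) * inv_seq k)) + \<i> * pi) \<longlonglongrightarrow> Ln (of_real (- y)) + \<i> * pi"
    by (intro tendsto_add tendsto_const tendsto_Ln tendsto_Complex_inv_seq) (use y in auto)
  from tendsto_Im[OF this] show ?thesis using False y unfolding eq by (simp add: Ln_of_real flip: of_real_minus)
qed

lemma Complex_upper_half:
  assumes "\<epsilon> > 0"
  shows "Complex y \<epsilon> \<notin> \<real>\<^sub>\<le>\<^sub>0" "Complex y \<epsilon> \<noteq> 0" "norm (Complex y \<epsilon>) \<ge> \<epsilon>" "norm (Complex y \<epsilon>) \<ge> \<bar>y\<bar>"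
  using assms abs_Im_le_cmod[of "Complex y \<epsilon>"] abs_Re_le_cmod[of "Complex y \<epsilon>"]
  by (auto simp: complex_nonpos_Reals_iff complex_eq_iff)

text \<open>For \<epsilon> <= 1 the modulus lies between |y| and |y| + 1, so its logarithm has a
  majorant that does not involve \<epsilon>.\<close>

lemma Re_Ln_bound:
  assumes "y \<noteq> 0" "0 < \<epsilon>" "\<epsilon> \<le> 1"
  shows "\<bar>Re (Ln (Complex y \<epsilon>))\<bar> \<le> \<bar>ln \<bar>y\<bar>\<bar> + \<bar>y\<bar>"
proof -
  define z where "z = Complex y \<epsilon>"
  have z: "z \<noteq> 0" "norm z \<ge> \<bar>y\<bar>" using Complex_upper_half[OF assms(2)] by (auto simp: z_def)
  have "norm z \<le> \<bar>y\<bar> + 1" using cmod_le[of z] assms by (simp add: z_def)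
  have "\<bar>ln (norm z)\<bar> \<le> \<bar>ln \<bar>y\<bar>\<bar> + \<bar>y\<bar>"
  proof (cases "norm z \<ge> 1")
    case True
    then have "\<bar>ln (norm z)\<bar> \<le> norm z - 1" using ln_le_minus_one[of "norm z"] z by (simp add: ln_ge_zero)
    also have "\<dots> \<le> \<bar>y\<bar>" using \<open>norm z \<le> \<bar>y\<bar> + 1\<close> by simp
    finally show ?thesis by simp
  next
    case False
    have "ln \<bar>y\<bar> \<le> ln (norm z)" using z assms by simp
    moreover have "ln (norm z) \<le> 0" using False z by simp
    ultimately show ?thesis by linarith
  qed
  then show ?thesis using z by (simp add: z_def)
qed

text \<open>Abstracts the family of iterated D-derivatives of one function of t. The cut c > 0 keeps
  away from t = 0, and vanishing at both ends removes every boundary term.\<close>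

locale radial_derivatives =
  fixes H :: "nat \<Rightarrow> real \<Rightarrow> real" and c d :: real
  assumes cd: "0 < c" "c < d"
    and deriv: "\<And>j t. t > 0 \<Longrightarrow> (H j has_real_derivative 2 * t * H (Suc j) t) (at t)"
    and ends: "\<And>j. H j c = 0" "\<And>j. H j d = 0"
begin

lemma cont: "continuous_on {c..d} (H j)"
  using cd DERIV_isCont[OF deriv] by (intro continuous_at_imp_continuous_on) auto

lemma by_parts:
  fixes L L' :: "real \<Rightarrow> complex"
  assumes L: "\<And>t. t \<in> {c..d} \<Longrightarrow> (L has_vector_derivative L' t) (at t)" and L': "continuous_on {c..d} L'"
  shows "(\<integral>t. indicator {c..d} t *\<^sub>R (of_real (2 * t * H (Suc j) t) * L t) \<partial>lborel) =
    - (\<integral>t. indicator {c..d} t *\<^sub>R (of_real (H j t) * L' t) \<partial>lborel)"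
proof -
  have contL: "continuous_on {c..d} L"
    using L by (intro continuous_at_imp_continuous_on ballI has_vector_derivative_continuous) auto
  have I1: "integrable lborel (\<lambda>t. indicator {c..d} t *\<^sub>R (of_real (2 * t * H (Suc j) t) * L t))"
    by (rule borel_integrable_compact) (auto intro!: continuous_intros cont contL)
  have I2: "integrable lborel (\<lambda>t. indicator {c..d} t *\<^sub>R (of_real (H j t) * L' t))"
    by (rule borel_integrable_compact) (auto intro!: continuous_intros cont L')
  have "(\<integral>t. indicator {c..d} t *\<^sub>R (of_real (H j t) * L' t + of_real (2 * t * H (Suc j) t) * L t) \<partial>lborel)
    = of_real (H j d) * L d - of_real (H j c) * L c"
  proof (rule integral_FTC_Icc)
    fix t assume "c \<le> t" "t \<le> d"
    then have t: "t \<in> {c..d}" "t > 0" using cd by auto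
    have "((\<lambda>t. of_real (H j t) :: complex) has_vector_derivative of_real (2 * t * H (Suc j) t)) (at t)"
      using deriv[OF t(2)] by (intro has_vector_derivative_of_real) (simp add: has_real_derivative_iff_has_vector_derivative)
    from has_vector_derivative_mult[OF this L[OF t(1)]]
    show "((\<lambda>t. of_real (H j t) * L t) has_vector_derivative of_real (H j t) * L' t + of_real (2 * t * H (Suc j) t) * L t) (at t within {c..d})"
      by (rule has_vector_derivative_at_within)
  qed (use cd in \<open>auto intro!: continuous_intros cont contL L'\<close>)
  also have "\<dots> = 0" by (simp add: ends)
  finally have "0 = (\<integral>t. indicator {c..d} t *\<^sub>R (of_real (H j t) * L' t) + indicator {c..d} t *\<^sub>R (of_real (2 * t * H (Suc j) t) * L t) \<partial>lborel)"
    by (simp add: scaleR_add_right)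
  also have "\<dots> = (\<integral>t. indicator {c..d} t *\<^sub>R (of_real (H j t) * L' t) \<partial>lborel) + (\<integral>t. indicator {c..d} t *\<^sub>R (of_real (2 * t * H (Suc j) t) * L t) \<partial>lborel)"
    by (rule Bochner_Integration.integral_add[OF I2 I1])
  finally show ?thesis by (simp add: eq_neg_iff_add_eq_0 add.commute)
qed

text \<open>Here j counts the derivatives still on the function and p is the order of the pole. The
  factor 2t is the density of t^2.\<close>

definition moment :: "real \<Rightarrow> real \<Rightarrow> nat \<Rightarrow> nat \<Rightarrow> complex" where
  "moment \<tau> \<epsilon> j p = (\<integral>t. indicator {c..d} t *\<^sub>R (of_real (2 * t * H j t) * (1 / Complex (\<tau> - t\<^sup>2) \<epsilon> ^ p)) \<partial>lborel)"

definition log_moment :: "real \<Rightarrow> real \<Rightarrow> nat \<Rightarrow> complex" where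
  "log_moment \<tau> \<epsilon> j = (\<integral>t. indicator {c..d} t *\<^sub>R (of_real (2 * t * H j t) * Ln (Complex (\<tau> - t\<^sup>2) \<epsilon>)) \<partial>lborel)"

lemma Complex_line_deriv: "((\<lambda>t. Complex (\<tau> - t\<^sup>2) \<epsilon>) has_vector_derivative of_real (- 2 * t)) (at t)"
proof -
  have "((\<lambda>t. of_real (\<tau> - t\<^sup>2) :: complex) has_vector_derivative of_real (- 2 * t)) (at t)"
    by (intro has_vector_derivative_of_real) (auto intro!: derivative_eq_intros simp flip: has_real_derivative_iff_has_vector_derivative)
  from has_vector_derivative_add_const[THEN iffD2, OF this, of "\<i> * of_real \<epsilon>"]
  show ?thesis by (simp add: Complex_eq)
qed

lemma continuous_Complex_line [continuous_intros]: "continuous_on S (\<lambda>t. Complex (\<tau> - t\<^sup>2) \<epsilon>)"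
  by (intro continuous_at_imp_continuous_on ballI has_vector_derivative_continuous[OF Complex_line_deriv])

text \<open>Integration by parts in t^2 moves one D onto the kernel, whose derivative in t^2 is p
  times the next power.\<close>

lemma moment_Suc:
  assumes "\<epsilon> > 0"
  shows "moment \<tau> \<epsilon> (Suc j) p = - of_nat p * moment \<tau> \<epsilon> j (Suc p)"
proof -
  have "moment \<tau> \<epsilon> (Suc j) p = - (\<integral>t. indicator {c..d} t *\<^sub>R (of_real (H j t) *
      (of_real (- 2 * t) * (- of_nat p / Complex (\<tau> - t\<^sup>2) \<epsilon> ^ Suc p))) \<partial>lborel)"
    unfolding moment_def
  proof (rule by_parts)
    show "((\<lambda>t. 1 / Complex (\<tau> - t\<^sup>2) \<epsilon> ^ p) has_vector_derivative of_real (- 2 * t) * (- of_nat p / Complex (\<tau> - t\<^sup>2) \<epsilon> ^ Suc p)) (at t)" for t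
      using field_vector_diff_chain_at[OF Complex_line_deriv has_field_derivative_inverse_power[OF Complex_upper_half(2)[OF assms]]]
      by (simp add: comp_def)
  qed (use Complex_upper_half(2)[OF assms] in \<open>auto intro!: continuous_intros\<close>)
  also have "(\<lambda>t. indicator {c..d} t *\<^sub>R (of_real (H j t) * (of_real (- 2 * t) * (- of_nat p / Complex (\<tau> - t\<^sup>2) \<epsilon> ^ Suc p))))
    = (\<lambda>t. of_nat p * (indicator {c..d} t *\<^sub>R (of_real (2 * t * H j t) * (1 / Complex (\<tau> - t\<^sup>2) \<epsilon> ^ Suc p))))"
    by (simp add: fun_eq_iff scaleR_conv_of_real)
  finally show ?thesis unfolding moment_def by (simp only: integral_mult_right_zero mult_minus_left)
qed

lemma log_moment_Suc:
  assumes "\<epsilon> > 0"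
  shows "log_moment \<tau> \<epsilon> (Suc j) = moment \<tau> \<epsilon> j 1"
proof -
  have "log_moment \<tau> \<epsilon> (Suc j) = - (\<integral>t. indicator {c..d} t *\<^sub>R (of_real (H j t) *
      (of_real (- 2 * t) * inverse (Complex (\<tau> - t\<^sup>2) \<epsilon>))) \<partial>lborel)"
    unfolding log_moment_def
  proof (rule by_parts)
    show "((\<lambda>t. Ln (Complex (\<tau> - t\<^sup>2) \<epsilon>)) has_vector_derivative of_real (- 2 * t) * inverse (Complex (\<tau> - t\<^sup>2) \<epsilon>)) (at t)" for t
      using field_vector_diff_chain_at[OF Complex_line_deriv has_field_derivative_Ln[OF Complex_upper_half(1)[OF assms]]]
      by (simp add: comp_def)
  qed (use Complex_upper_half(2)[OF assms] in \<open>auto intro!: continuous_intros\<close>)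
  also have "(\<lambda>t. indicator {c..d} t *\<^sub>R (of_real (H j t) * (of_real (- 2 * t) * inverse (Complex (\<tau> - t\<^sup>2) \<epsilon>))))
    = (\<lambda>t. - (indicator {c..d} t *\<^sub>R (of_real (2 * t * H j t) * (1 / Complex (\<tau> - t\<^sup>2) \<epsilon> ^ 1))))"
    by (simp add: fun_eq_iff scaleR_conv_of_real divide_inverse)
  finally show ?thesis unfolding moment_def by simp
qed

text \<open>The logarithm becomes a simple pole after one integration by parts, without sign; the N
  further ones contribute the factors -1, -2, ..., -N and raise the pole to order N + 1.\<close>

lemma log_moment_eq:
  assumes "\<epsilon> > 0"
  shows "log_moment \<tau> \<epsilon> (Suc N) = (- 1) ^ N * fact N * moment \<tau> \<epsilon> 0 (Suc N)"
proof -
  have "j \<le> N \<Longrightarrow> moment \<tau> \<epsilon> N 1 = (- 1) ^ j * fact j * moment \<tau> \<epsilon> (N - j) (Suc j)" for j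
  proof (induction j)
    case (Suc j)
    then have "moment \<tau> \<epsilon> N 1 = (- 1) ^ j * fact j * moment \<tau> \<epsilon> (Suc (N - Suc j)) (Suc j)"
      by (simp add: Suc_diff_Suc)
    also have "\<dots> = (- 1) ^ Suc j * fact (Suc j) * moment \<tau> \<epsilon> (N - Suc j) (Suc (Suc j))"
      unfolding moment_Suc[OF assms] by (simp add: algebra_simps)
    finally show ?case .
  qed simp
  from this[of N] show ?thesis using log_moment_Suc[OF assms] by simp
qed

end

section \<open>Uniform bounds and limits of the logarithmic moments as the height tends to 0\<close>

context radial_derivatives
begin

lemma integrable_log_moment:
  assumes "\<epsilon> > 0"
  shows "integrable lborel (\<lambda>t. indicator {c..d} t *\<^sub>R (of_real (2 * t * H j t) * Ln (Complex (\<tau> - t\<^sup>2) \<epsilon>)))"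
  by (rule borel_integrable_compact)
     (use Complex_upper_half(1)[OF assms] in \<open>auto intro!: continuous_intros cont\<close>)

lemma Im_log_moment:
  assumes "\<epsilon> > 0"
  shows "Im (log_moment \<tau> \<epsilon> j) = (\<integral>t. indicator {c..d} t * (2 * t * H j t * Im (Ln (Complex (\<tau> - t\<^sup>2) \<epsilon>))) \<partial>lborel)"
  unfolding log_moment_def
  by (subst integral_bounded_linear[OF bounded_linear_Im integrable_log_moment[OF assms], symmetric])
     (simp add: mult.assoc)

lemma Re_log_moment:
  assumes "\<epsilon> > 0"
  shows "Re (log_moment \<tau> \<epsilon> j) = (\<integral>t. indicator {c..d} t * (2 * t * H j t * Re (Ln (Complex (\<tau> - t\<^sup>2) \<epsilon>))) \<partial>lborel)"
  unfolding log_moment_def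
  by (subst integral_bounded_linear[OF bounded_linear_Re integrable_log_moment[OF assms], symmetric])
     (simp add: mult.assoc del: Re_Ln)

lemma integrable_indicator_const: "integrable lborel (\<lambda>t. indicator {c..d} t * (K::real))"
  using cd by (intro integrable_mult_left integrable_real_indicator) auto

lemma measurable_H [measurable]: "(\<lambda>t. indicator {c..d} t * H j t) \<in> borel_measurable borel"
  using borel_measurable_continuous_on_indicator[OF _ cont, of j] by simp

lemma integrand_bound:
  assumes B: "\<And>t. t > 0 \<Longrightarrow> \<bar>H j t\<bar> \<le> B"
  shows "\<bar>indicator {c..d} t * (2 * t * H j t * w)\<bar> \<le> indicator {c..d} t * (2 * d * B * \<bar>w\<bar>)"
proof (cases "t \<in> {c..d}")
  case True
  then have "2 * t * \<bar>H j t\<bar> \<le> 2 * d * B" using cd B[of t] by (intro mult_mono) auto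
  then have "2 * t * \<bar>H j t\<bar> * \<bar>w\<bar> \<le> 2 * d * B * \<bar>w\<bar>" by (intro mult_right_mono) auto
  then show ?thesis using True cd by (simp add: abs_mult)
qed simp

lemma abs_Im_Ln_le: "\<epsilon> > 0 \<Longrightarrow> \<bar>Im (Ln (Complex y \<epsilon>))\<bar> \<le> pi"
  using Im_Ln_le_pi[OF Complex_upper_half(2)] mpi_less_Im_Ln[OF Complex_upper_half(2)] by (simp add: abs_le_iff less_imp_le)
    (metis less_imp_le minus_less_iff)

lemma measurable_integrand_Im:
  assumes "\<epsilon> > 0"
  shows "(\<lambda>t. indicator {c..d} t * (2 * t * H j t * Im (Ln (Complex (\<tau> - t\<^sup>2) \<epsilon>)))) \<in> borel_measurable lborel"
  using measurable_compose[OF borel_measurable_integrable[OF integrable_log_moment[OF assms, of j \<tau>]] borel_measurable_Im]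
  by (simp add: mult.assoc)

lemma measurable_integrand_Re:
  assumes "\<epsilon> > 0"
  shows "(\<lambda>t. indicator {c..d} t * (2 * t * H j t * Re (Ln (Complex (\<tau> - t\<^sup>2) \<epsilon>)))) \<in> borel_measurable lborel"
  using measurable_compose[OF borel_measurable_integrable[OF integrable_log_moment[OF assms, of j \<tau>]] borel_measurable_Re]
  by (simp add: mult.assoc del: Re_Ln)

lemma Im_log_moment_bound:
  assumes B: "\<And>t. t > 0 \<Longrightarrow> \<bar>H j t\<bar> \<le> B" and "\<epsilon> > 0"
  shows "\<bar>Im (log_moment \<tau> \<epsilon> j)\<bar> \<le> 2 * d * B * pi * (d - c)"
proof -
  have "\<bar>Im (log_moment \<tau> \<epsilon> j)\<bar> \<le> (\<integral>t. indicator {c..d} t * (2 * d * B * pi) \<partial>lborel)"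
    unfolding Im_log_moment[OF \<open>\<epsilon> > 0\<close>]
  proof (rule order_trans[OF integral_abs_bound integral_mono'])
    have "0 \<le> B" using B[of 1] by linarith
    have le: "indicator {c..d} t * (2 * d * B * \<bar>Im (Ln (Complex (\<tau> - t\<^sup>2) \<epsilon>))\<bar>) \<le> indicator {c..d} t * (2 * d * B * pi)" for t
      using cd \<open>0 \<le> B\<close> abs_Im_Ln_le[OF \<open>\<epsilon> > 0\<close>] by (intro mult_left_mono) auto
    show "\<bar>indicator {c..d} t * (2 * t * H j t * Im (Ln (Complex (\<tau> - t\<^sup>2) \<epsilon>)))\<bar> \<le> indicator {c..d} t * (2 * d * B * pi)" for t
      using integrand_bound[OF B] le by (rule order_trans)
    show "0 \<le> indicator {c..d} t * (2 * d * B * pi)" for t using cd \<open>0 \<le> B\<close> by simp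
  qed (rule integrable_indicator_const)
  also have "\<dots> = 2 * d * B * pi * (d - c)" using cd by simp
  finally show ?thesis .
qed

text \<open>The argument of s^2 - t^2 + i \<epsilon> tends to 0 for t < s and to \<pi> for t > s, so
  the limit is \<pi> times the integral of 2t H (Suc j) from s to d, which the fundamental theorem
  evaluates. One D is thereby consumed: hence D^(n-3) in the odd formula against D^(n-2) in the even
  one.\<close>

lemma Im_log_moment_tendsto:
  assumes B: "\<And>t. t > 0 \<Longrightarrow> \<bar>H (Suc j) t\<bar> \<le> B" and s: "c \<le> s" "s \<le> d"
  shows "(\<lambda>k. Im (log_moment (s\<^sup>2) (inv_seq k) (Suc j))) \<longlonglongrightarrow> - pi * H j s"
proof -
  define g where "g t = indicator {c..d} t * (2 * t * H (Suc j) t * (if s\<^sup>2 - t\<^sup>2 > 0 then 0 else pi))" for t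
  have "(\<lambda>k. Im (log_moment (s\<^sup>2) (inv_seq k) (Suc j))) \<longlonglongrightarrow> (\<integral>t. g t \<partial>lborel)"
    unfolding Im_log_moment[OF inv_seq(1)]
  proof (rule integral_dominated_convergence[where w = "\<lambda>t. indicator {c..d} t * (2 * d * B * pi)"])
    have "g = (\<lambda>t. (indicator {c..d} t * H (Suc j) t) * (2 * t * (if s\<^sup>2 - t\<^sup>2 > 0 then 0 else pi)))"
      by (auto simp: g_def)
    then show "g \<in> borel_measurable lborel" by simp
    show "AE t in lborel. (\<lambda>k. indicator {c..d} t * (2 * t * H (Suc j) t * Im (Ln (Complex (s\<^sup>2 - t\<^sup>2) (inv_seq k))))) \<longlonglongrightarrow> g t"
    proof (rule eventually_mono[OF AE_lborel_singleton[of s]])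
      fix t assume "t \<noteq> s"
      show "(\<lambda>k. indicator {c..d} t * (2 * t * H (Suc j) t * Im (Ln (Complex (s\<^sup>2 - t\<^sup>2) (inv_seq k))))) \<longlonglongrightarrow> g t"
      proof (cases "t \<in> {c..d}")
        case True
        then have "s\<^sup>2 - t\<^sup>2 \<noteq> 0" using \<open>t \<noteq> s\<close> s cd by (auto simp: power2_eq_iff)
        then show ?thesis unfolding g_def by (intro tendsto_intros Im_Ln_tendsto)
      qed (simp add: g_def)
    qed
    have "0 \<le> B" using B[of 1] by linarith
    have le: "indicator {c..d} t * (2 * d * B * \<bar>Im (Ln (Complex (s\<^sup>2 - t\<^sup>2) (inv_seq k)))\<bar>) \<le> indicator {c..d} t * (2 * d * B * pi)" for t k
      using cd \<open>0 \<le> B\<close> abs_Im_Ln_le[OF inv_seq(1)] by (intro mult_left_mono) auto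
    show "AE t in lborel. norm (indicator {c..d} t * (2 * t * H (Suc j) t * Im (Ln (Complex (s\<^sup>2 - t\<^sup>2) (inv_seq k))))) \<le> indicator {c..d} t * (2 * d * B * pi)" for k
      unfolding real_norm_def using integrand_bound[OF B] le by (intro AE_I2) (rule order_trans)
  qed (rule integrable_indicator_const measurable_integrand_Im[OF inv_seq(1)])+
  also have "(\<integral>t. g t \<partial>lborel) = (\<integral>t. indicator {s..d} t *\<^sub>R (pi * (2 * t * H (Suc j) t)) \<partial>lborel)"
  proof (rule Bochner_Integration.integral_cong[OF refl])
    fix t
    have "t < s \<longleftrightarrow> s\<^sup>2 - t\<^sup>2 > 0" if "t \<ge> c"
    proof -
      have *: "0 \<le> t" "0 \<le> s" using that cd s by auto
      show ?thesis
      proof (cases "t < s")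
        case True
        then show ?thesis using power_strict_mono[OF True *(1), of 2] by simp
      next
        case False
        then have "s \<le> t" by simp
        from power_mono[OF this *(2), of 2] False show ?thesis by simp
      qed
    qed
    then show "g t = indicator {s..d} t *\<^sub>R (pi * (2 * t * H (Suc j) t))"
      using s by (auto simp: g_def indicator_def)
  qed
  also have "\<dots> = pi * H j d - pi * H j s"
  proof (rule integral_FTC_Icc)
    show "((\<lambda>t. pi * H j t) has_vector_derivative pi * (2 * t * H (Suc j) t)) (at t within {s..d})" if "s \<le> t" for t
      using DERIV_cmult[OF deriv, of t pi j] that s cd
      unfolding has_real_derivative_iff_has_vector_derivative by (auto intro: has_vector_derivative_at_within)
    show "continuous_on {s..d} (\<lambda>t. pi * (2 * t * H (Suc j) t))"
      using s by (intro continuous_intros continuous_on_subset[OF cont]) auto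
  qed (use s in auto)
  also have "\<dots> = - pi * H j s" by (simp add: ends)
  finally show ?thesis .
qed

text \<open>Majorises |ln|s^2 - t^2|| + |s^2 - t^2| on [c, d]: the logarithm splits as ln|s - t| +
  ln(s + t), the latter being bounded because s + t lies between c and 2d; d^2 bounds the last
  term.\<close>

definition log_majorant :: "real \<Rightarrow> real \<Rightarrow> real" where
  "log_majorant s t = indicator {-d..d} (s - t) * \<bar>ln \<bar>s - t\<bar>\<bar> + indicator {c..d} t * (\<bar>ln c\<bar> + \<bar>ln (2 * d)\<bar> + d\<^sup>2)"

definition log_majorant_integral :: real where
  "log_majorant_integral = (\<integral>u. indicator {-d..d} u * \<bar>ln \<bar>u\<bar>\<bar> \<partial>lborel) + (d - c) * (\<bar>ln c\<bar> + \<bar>ln (2 * d)\<bar> + d\<^sup>2)"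

text \<open>The singular part is a reflected translate of a fixed function, so the integral is the
  same for every s. This makes \<open>Re_log_moment_bound\<close> uniform over the sphere.\<close>

lemma log_majorant_has_integral: "has_bochner_integral lborel (log_majorant s) log_majorant_integral"
proof -
  have m: "(\<lambda>u::real. indicator {-d..d} u * \<bar>ln \<bar>u\<bar>\<bar>) \<in> borel_measurable borel" by measurable
  have 1: "has_bochner_integral lborel (\<lambda>t. indicator {-d..d} (s - t) * \<bar>ln \<bar>s - t\<bar>\<bar>) (\<integral>u. indicator {-d..d} u * \<bar>ln \<bar>u\<bar>\<bar> \<partial>lborel)"
    unfolding has_bochner_integral_iff
    using integral_lborel_reflect[OF m, of s] integrable_abs_ln[of d] cd by simp
  have 2: "has_bochner_integral lborel (\<lambda>t. indicator {c..d} t * (\<bar>ln c\<bar> + \<bar>ln (2 * d)\<bar> + d\<^sup>2)) ((d - c) * (\<bar>ln c\<bar> + \<bar>ln (2 * d)\<bar> + d\<^sup>2))"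
    unfolding has_bochner_integral_iff using cd by (auto intro!: integrable_mult_left)
  show ?thesis unfolding log_majorant_def log_majorant_integral_def by (rule has_bochner_integral_add[OF 1 2])
qed

lemma Re_Ln_le_majorant:
  assumes s: "c \<le> s" "s \<le> d" and t: "t \<in> {c..d}" "t \<noteq> s" and \<epsilon>: "0 < \<epsilon>" "\<epsilon> \<le> 1"
  shows "\<bar>Re (Ln (Complex (s\<^sup>2 - t\<^sup>2) \<epsilon>))\<bar> \<le> log_majorant s t"
proof -
  have y: "s\<^sup>2 - t\<^sup>2 = (s - t) * (s + t)" by (simp add: power2_eq_square algebra_simps)
  have pos: "s + t > 0" "\<bar>s - t\<bar> > 0" using s t cd by auto
  have "\<bar>Re (Ln (Complex (s\<^sup>2 - t\<^sup>2) \<epsilon>))\<bar> \<le> \<bar>ln \<bar>s\<^sup>2 - t\<^sup>2\<bar>\<bar> + \<bar>s\<^sup>2 - t\<^sup>2\<bar>"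
    by (rule Re_Ln_bound) (use pos \<epsilon> y in auto)
  also have "ln \<bar>s\<^sup>2 - t\<^sup>2\<bar> = ln \<bar>s - t\<bar> + ln (s + t)"
    unfolding y abs_mult using pos by (subst ln_mult) auto
  also have "\<bar>ln \<bar>s - t\<bar> + ln (s + t)\<bar> \<le> \<bar>ln \<bar>s - t\<bar>\<bar> + (\<bar>ln c\<bar> + \<bar>ln (2 * d)\<bar>)"
  proof -
    have "ln c \<le> ln (s + t)" "ln (s + t) \<le> ln (2 * d)" using s t cd pos by auto
    then show ?thesis by linarith
  qed
  also have "\<bar>s\<^sup>2 - t\<^sup>2\<bar> \<le> d\<^sup>2"
  proof -
    have "s\<^sup>2 \<le> d\<^sup>2" "t\<^sup>2 \<le> d\<^sup>2" using s t cd by (auto intro!: power_mono)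
    then show ?thesis using zero_le_power2[of s] zero_le_power2[of t] by linarith
  qed
  finally show ?thesis using s t cd by (simp add: log_majorant_def)
qed

lemma log_majorant_nonneg: "log_majorant s t \<ge> 0"
  by (auto simp: log_majorant_def)

lemma Re_integrand_bound:
  assumes B: "\<And>t. t > 0 \<Longrightarrow> \<bar>H j t\<bar> \<le> B" and s: "c \<le> s" "s \<le> d" and \<epsilon>: "0 < \<epsilon>" "\<epsilon> \<le> 1"
  shows "AE t in lborel. \<bar>indicator {c..d} t * (2 * t * H j t * Re (Ln (Complex (s\<^sup>2 - t\<^sup>2) \<epsilon>)))\<bar> \<le> 2 * d * B * log_majorant s t"
proof (rule eventually_mono[OF AE_lborel_singleton[of s]])
  fix t assume t: "t \<noteq> s"
  have "0 \<le> B" using B[of 1] by linarith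
  show "\<bar>indicator {c..d} t * (2 * t * H j t * Re (Ln (Complex (s\<^sup>2 - t\<^sup>2) \<epsilon>)))\<bar> \<le> 2 * d * B * log_majorant s t"
  proof (cases "t \<in> {c..d}")
    case True
    have "2 * d * B * \<bar>Re (Ln (Complex (s\<^sup>2 - t\<^sup>2) \<epsilon>))\<bar> \<le> 2 * d * B * log_majorant s t"
      using cd \<open>0 \<le> B\<close> by (intro mult_left_mono Re_Ln_le_majorant[OF s True t \<epsilon>]) auto
    with integrand_bound[OF B, of t "Re (Ln (Complex (s\<^sup>2 - t\<^sup>2) \<epsilon>))"] True show ?thesis by (simp del: Re_Ln)
  next
    case False
    then show ?thesis using log_majorant_nonneg[of s t] cd \<open>0 \<le> B\<close> by simp
  qed
qed

lemma Re_log_moment_bound: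
  assumes B: "\<And>t. t > 0 \<Longrightarrow> \<bar>H j t\<bar> \<le> B" and s: "c \<le> s" "s \<le> d" and \<epsilon>: "0 < \<epsilon>" "\<epsilon> \<le> 1"
  shows "\<bar>Re (log_moment (s\<^sup>2) \<epsilon> j)\<bar> \<le> 2 * d * B * log_majorant_integral"
proof -
  have maj: "integrable lborel (\<lambda>t. 2 * d * B * log_majorant s t)"
    using log_majorant_has_integral by (auto simp: has_bochner_integral_iff)
  have "\<bar>Re (log_moment (s\<^sup>2) \<epsilon> j)\<bar> \<le> (\<integral>t. 2 * d * B * log_majorant s t \<partial>lborel)"
    unfolding Re_log_moment[OF \<epsilon>(1)]
  proof (rule order_trans[OF integral_abs_bound integral_mono_AE])
    show "integrable lborel (\<lambda>t. \<bar>indicator {c..d} t * (2 * t * H j t * Re (Ln (Complex (s\<^sup>2 - t\<^sup>2) \<epsilon>)))\<bar>)"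
      by (rule Bochner_Integration.integrable_bound[OF maj])
         (use Re_integrand_bound[OF B s \<epsilon>] measurable_integrand_Re[OF \<epsilon>(1)] in \<open>auto elim!: eventually_mono\<close>)
  qed (use maj Re_integrand_bound[OF B s \<epsilon>] in auto)
  also have "\<dots> = 2 * d * B * log_majorant_integral"
    using log_majorant_has_integral[of s] by (simp add: has_bochner_integral_iff)
  finally show ?thesis .
qed

lemma Re_log_moment_tendsto:
  assumes B: "\<And>t. t > 0 \<Longrightarrow> \<bar>H j t\<bar> \<le> B" and s: "c \<le> s" "s \<le> d"
  shows "(\<lambda>k. Re (log_moment (s\<^sup>2) (inv_seq k) j)) \<longlonglongrightarrow>
    (\<integral>t. indicator {c..d} t * (2 * t * H j t * ln \<bar>s\<^sup>2 - t\<^sup>2\<bar>) \<partial>lborel)"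
  unfolding Re_log_moment[OF inv_seq(1)]
proof (rule integral_dominated_convergence[where w = "\<lambda>t. 2 * d * B * log_majorant s t"])
  have "(\<lambda>t. indicator {c..d} t * (2 * t * H j t * ln \<bar>s\<^sup>2 - t\<^sup>2\<bar>)) = (\<lambda>t. (indicator {c..d} t * H j t) * (2 * t * ln \<bar>s\<^sup>2 - t\<^sup>2\<bar>))"
    by auto
  then show "(\<lambda>t. indicator {c..d} t * (2 * t * H j t * ln \<bar>s\<^sup>2 - t\<^sup>2\<bar>)) \<in> borel_measurable lborel" by simp
  show "integrable lborel (\<lambda>t. 2 * d * B * log_majorant s t)"
    using log_majorant_has_integral by (auto simp: has_bochner_integral_iff)
  show "AE t in lborel. (\<lambda>k. indicator {c..d} t * (2 * t * H j t * Re (Ln (Complex (s\<^sup>2 - t\<^sup>2) (inv_seq k))))) \<longlonglongrightarrow>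
      indicator {c..d} t * (2 * t * H j t * ln \<bar>s\<^sup>2 - t\<^sup>2\<bar>)"
  proof (rule eventually_mono[OF AE_lborel_singleton[of s]])
    fix t assume "t \<noteq> s"
    show "(\<lambda>k. indicator {c..d} t * (2 * t * H j t * Re (Ln (Complex (s\<^sup>2 - t\<^sup>2) (inv_seq k))))) \<longlonglongrightarrow>
      indicator {c..d} t * (2 * t * H j t * ln \<bar>s\<^sup>2 - t\<^sup>2\<bar>)"
    proof (cases "t \<in> {c..d}")
      case True
      then have y: "s\<^sup>2 - t\<^sup>2 \<noteq> 0" using \<open>t \<noteq> s\<close> s cd by (auto simp: power2_eq_iff)
      have "(\<lambda>k. ln (norm (Complex (s\<^sup>2 - t\<^sup>2) (1 * inv_seq k)))) \<longlonglongrightarrow> ln (norm (complex_of_real (s\<^sup>2 - t\<^sup>2)))"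
        using y by (intro tendsto_ln tendsto_norm tendsto_Complex_inv_seq) (metis norm_eq_zero of_real_eq_0_iff)
      then have "(\<lambda>k. Re (Ln (Complex (s\<^sup>2 - t\<^sup>2) (inv_seq k)))) \<longlonglongrightarrow> ln \<bar>s\<^sup>2 - t\<^sup>2\<bar>"
        using Complex_upper_half(2)[OF inv_seq(1)] by (simp only: Re_Ln norm_of_real mult_1 not_False_eq_True)
      then show ?thesis by (intro tendsto_intros)
    qed simp
  qed
  show "AE t in lborel. norm (indicator {c..d} t * (2 * t * H j t * Re (Ln (Complex (s\<^sup>2 - t\<^sup>2) (inv_seq k))))) \<le> 2 * d * B * log_majorant s t" for k
    unfolding real_norm_def by (rule Re_integrand_bound[OF B s inv_seq(1,2)])
qed (rule measurable_integrand_Re[OF inv_seq(1)])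

end

section \<open>Backprojection\<close>

text \<open>The sign and factorial come from \<open>log_moment_eq\<close> with N = n - 3; the factor
  2 / \<open>sigma_area\<close> comes from \<open>sph_mean_polar\<close>.\<close>

definition log_factor :: "nat \<Rightarrow> real" where
  "log_factor n = (- 1) ^ (n - 3) * fact (n - 3) * (2 / sigma_area n)"

locale spherical_inversion =
  fixes f :: "'a::euclidean_space \<Rightarrow> real" and R r :: real
  assumes n3: "DIM('a) \<ge> 3" and r: "0 \<le> r" "r < R" and f: "test_function r f"
begin

lemma sigma_pos: "sigma_area DIM('a) > 0" using n3 by (intro sigma_area_pos) simp

lemma f_measurable [measurable]: "f \<in> borel_measurable borel"
  by (rule test_function_measurable[OF f])

definition H :: "'a \<Rightarrow> nat \<Rightarrow> real \<Rightarrow> real" where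
  "H \<xi> j = (Dop ^^ j) (\<lambda>t. t ^ (DIM('a) - 2) * sph_mean f \<xi> t)"

lemma admissible_H: "admissible R (R - r) (R + r) k (\<lambda>\<xi>. H \<xi> j)"
proof -
  have "admissible R (R - r) (R + r) (j + k) (\<lambda>\<xi> t. t powr (real (DIM('a) - 2)) * weighted_mean f (\<lambda>_. 1 / sigma_area DIM('a)) \<xi> t)"
    by (rule admissible_weighted_mean[OF r _ _ f, where C = "\<bar>1 / sigma_area DIM('a)\<bar>"]) auto
  moreover have "t powr (real (DIM('a) - 2)) * weighted_mean f (\<lambda>_. 1 / sigma_area DIM('a)) \<xi> t = t ^ (DIM('a) - 2) * sph_mean f \<xi> t" if "t > 0" for \<xi> t
    using that by (simp add: powr_realpow weighted_mean_def sph_mean_def)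
  ultimately have "admissible R (R - r) (R + r) (j + k) (\<lambda>\<xi> t. t ^ (DIM('a) - 2) * sph_mean f \<xi> t)"
    by (subst (asm) admissible_cong[where G = "\<lambda>\<xi> t. t ^ (DIM('a) - 2) * sph_mean f \<xi> t"]) auto
  from admissible_Dop_power[OF this] show ?thesis unfolding H_def .
qed

lemma H_measurable: "(\<lambda>(\<xi>, t). indicator {0<..} t * H \<xi> j t) \<in> borel_measurable (borel \<Otimes>\<^sub>M borel)"
  using admissible_imp_0[OF admissible_H[where k = 0 and j = j]] unfolding admissible0_def by simp

lemma H_bounded_family: "bounded_family R (R - r) (R + r) (\<lambda>\<xi>. H \<xi> j)"
  using admissible_imp_0[OF admissible_H[where k = 0 and j = j]] unfolding admissible0_def by simp

lemma H_bound: obtains B where "\<And>\<xi> t. norm \<xi> = R \<Longrightarrow> t > 0 \<Longrightarrow> \<bar>H \<xi> j t\<bar> \<le> B"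
  using H_bounded_family[of j] unfolding bounded_family_def by blast

lemma H_eq_0: "norm \<xi> = R \<Longrightarrow> t > 0 \<Longrightarrow> t < R - r \<or> t > R + r \<Longrightarrow> H \<xi> j t = 0"
  using H_bounded_family[of j] unfolding bounded_family_def by blast

lemma H_deriv: "t > 0 \<Longrightarrow> (H \<xi> j has_real_derivative 2 * t * H \<xi> (Suc j) t) (at t)"
  using admissible_Suc_deriv[OF admissible_H[of "Suc 0" j]] by (simp add: H_def)

text \<open>A positive lower limit of integration, the same for all \<xi> on the sphere, that lies
  below R - r, so that nothing of the means is cut off, and not above any distance |x - \<xi>|, so
  that this distance falls into the interval.\<close>

definition inner_cut :: "'a \<Rightarrow> real" where "inner_cut x = min ((R - r) / 2) (R - norm x)"

lemma inner_cut: "norm x < R \<Longrightarrow> inner_cut x > 0" "inner_cut x < R - r" "inner_cut x \<le> R - norm x"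
  using r by (auto simp: inner_cut_def min_less_iff_disj)

lemma radial_derivatives_H:
  assumes "norm x < R" "norm \<xi> = R"
  shows "radial_derivatives (H \<xi>) (inner_cut x) (2 * R)"
proof
  show "0 < inner_cut x" "inner_cut x < 2 * R" using inner_cut[of x] assms r by auto
  show "H \<xi> j (inner_cut x) = 0" for j using inner_cut[of x] assms by (intro H_eq_0) auto
  show "H \<xi> j (2 * R) = 0" for j using assms r by (intro H_eq_0) auto
qed (rule H_deriv)

lemma dist_sphere:
  assumes "norm x < R" "norm \<xi> = R"
  shows "inner_cut x \<le> norm (x - \<xi>)" "norm (x - \<xi>) \<le> 2 * R"
  using assms inner_cut(3)[of x] norm_triangle_ineq4[of x \<xi>] norm_triangle_ineq3[of x \<xi>] by auto

text \<open>The kernel depends on y only through |\<xi> - y|, so polar coordinates about \<xi>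
  apply. The exponent n - 2 in the definition of H is exactly what makes 2t H the polar density
  t^(n-1) times the mean, up to the factor 2.\<close>

lemma sph_mean_polar:
  assumes "norm x < R" "norm \<xi> = R" "\<epsilon> > 0"
  shows "radial_derivatives.moment (H \<xi>) (inner_cut x) (2 * R) \<tau> \<epsilon> 0 p =
    of_real (2 / sigma_area DIM('a)) * (\<integral>y. of_real (f y) * (1 / Complex (\<tau> - (norm (\<xi> - y))\<^sup>2) \<epsilon> ^ p) \<partial>lborel)"
proof -
  interpret radial_derivatives "H \<xi>" "inner_cut x" "2 * R" by (rule radial_derivatives_H[OF assms(1,2)])
  obtain B where B: "B \<ge> 0" "\<And>y. \<bar>f y\<bar> \<le> B" using test_function_bounded[OF f] by metis
  define F :: "'a \<Rightarrow> complex" where "F y = of_real (f (\<xi> - y)) * (1 / Complex (\<tau> - (norm y)\<^sup>2) \<epsilon> ^ p)" for y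
  have [measurable]: "(\<lambda>y::'a. Complex (\<tau> - (norm y)\<^sup>2) \<epsilon>) \<in> borel_measurable borel"
    unfolding Complex_eq by measurable
  have [measurable]: "F \<in> borel_measurable borel" unfolding F_def[abs_def] by measurable
  have bound: "norm (F y) \<le> B * (1 / \<epsilon> ^ p)" for y
    unfolding F_def norm_mult norm_divide norm_power norm_of_real
    using B Complex_upper_half(3)[OF assms(3)] assms(3) by (intro mult_mono frac_le power_mono) auto
  have "norm (\<xi> - y) > r" if "norm y > R + r" for y
    using norm_triangle_ineq4[of \<xi> "\<xi> - y"] that assms by simp
  then have intF: "integrable lborel F"
    by (intro integrable_bounded_support[OF _ bound, where r = "R + r"]) (auto simp: F_def test_function_eq_0[OF f])
  have "(\<integral>y. F y \<partial>lborel) = (\<integral>t. (indicator {0<..} t * t ^ (DIM('a) - 1)) *\<^sub>R (\<integral>\<theta>. F (t *\<^sub>R \<theta>) \<partial>sphere_surface 0 1) \<partial>lborel)"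
    by (rule integral_polar(1)[OF intF])
  also have "\<dots> = (\<integral>t. of_real (sigma_area DIM('a) / 2) * (indicator {inner_cut x..2 * R} t *\<^sub>R (of_real (2 * t * H \<xi> 0 t) * (1 / Complex (\<tau> - t\<^sup>2) \<epsilon> ^ p))) \<partial>lborel)"
  proof (rule Bochner_Integration.integral_cong[OF refl])
    fix t :: real
    show "(indicator {0<..} t * t ^ (DIM('a) - 1)) *\<^sub>R (\<integral>\<theta>. F (t *\<^sub>R \<theta>) \<partial>sphere_surface 0 1) =
      of_real (sigma_area DIM('a) / 2) * (indicator {inner_cut x..2 * R} t *\<^sub>R (of_real (2 * t * H \<xi> 0 t) * (1 / Complex (\<tau> - t\<^sup>2) \<epsilon> ^ p)))"
    proof (cases "t > 0")
      case True
      have "(\<integral>\<theta>. F (t *\<^sub>R \<theta>) \<partial>sphere_surface 0 1) =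
        (\<integral>\<theta>. of_real (f (\<xi> - t *\<^sub>R \<theta>)) * (1 / Complex (\<tau> - t\<^sup>2) \<epsilon> ^ p) \<partial>sphere_surface 0 1)"
      proof (rule integral_cong_AE)
        show "AE \<theta> in sphere_surface 0 1. F (t *\<^sub>R \<theta>) = of_real (f (\<xi> - t *\<^sub>R \<theta>)) * (1 / Complex (\<tau> - t\<^sup>2) \<epsilon> ^ p)"
          by (rule eventually_mono[OF AE_sphere_surface[of 1]]) (use True in \<open>auto simp: F_def\<close>)
      qed measurable
      also have "\<dots> = of_real (sigma_area DIM('a) * sph_mean f \<xi> t) * (1 / Complex (\<tau> - t\<^sup>2) \<epsilon> ^ p)"
        unfolding integral_mult_left_zero using sigma_pos by (simp add: sph_mean_def)
      finally have inner: "(\<integral>\<theta>. F (t *\<^sub>R \<theta>) \<partial>sphere_surface 0 1) = of_real (sigma_area DIM('a) * sph_mean f \<xi> t) * (1 / Complex (\<tau> - t\<^sup>2) \<epsilon> ^ p)" .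
      have "DIM('a) - 1 = Suc (DIM('a) - 2)" using n3 by simp
      then have pw: "t ^ (DIM('a) - 1) = t * t ^ (DIM('a) - 2)" by (simp only: power_Suc)
      have H0: "H \<xi> 0 t = t ^ (DIM('a) - 2) * sph_mean f \<xi> t" by (simp add: H_def)
      have "(indicator {0<..} t * t ^ (DIM('a) - 1)) *\<^sub>R (\<integral>\<theta>. F (t *\<^sub>R \<theta>) \<partial>sphere_surface 0 1) =
        of_real (sigma_area DIM('a) / 2) * (of_real (2 * t * H \<xi> 0 t) * (1 / Complex (\<tau> - t\<^sup>2) \<epsilon> ^ p))"
        unfolding inner pw H0 using True by (simp add: scaleR_conv_of_real mult_ac)
      moreover have "H \<xi> 0 t = 0" if "\<not> (inner_cut x \<le> t \<and> t \<le> 2 * R)"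
        using that True inner_cut(2)[of x] r assms by (intro H_eq_0) auto
      ultimately show ?thesis by (cases "inner_cut x \<le> t \<and> t \<le> 2 * R") auto
    next
      case False
      then show ?thesis using inner_cut(1)[OF assms(1)] by auto
    qed
  qed
  also have "\<dots> = of_real (sigma_area DIM('a) / 2) * moment \<tau> \<epsilon> 0 p"
    unfolding moment_def by (simp only: integral_mult_right_zero)
  finally have "moment \<tau> \<epsilon> 0 p = of_real (2 / sigma_area DIM('a)) * (\<integral>y. F y \<partial>lborel)"
    using sigma_pos by (simp add: field_simps)
  also have "(\<integral>y. F y \<partial>lborel) = (\<integral>y. F (\<xi> - y) \<partial>lborel)"
    by (rule integral_lborel_reflect(1)[symmetric]) simp
  finally show ?thesis by (simp add: F_def)
qed

definition V :: "'a \<Rightarrow> real \<Rightarrow> 'a \<Rightarrow> complex" where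
  "V x \<epsilon> \<xi> = (\<integral>y. of_real (f y) * (1 / Complex ((norm (x - \<xi>))\<^sup>2 - (norm (\<xi> - y))\<^sup>2) \<epsilon> ^ (DIM('a) - 2)) \<partial>lborel)"

lemma Complex_diff_measurable [measurable]:
  "(\<lambda>(\<xi>::'a, y::'a). Complex ((norm (x - \<xi>))\<^sup>2 - (norm (\<xi> - y))\<^sup>2) \<epsilon>) \<in> borel_measurable (borel \<Otimes>\<^sub>M borel)"
  unfolding Complex_eq by measurable

lemma V_measurable [measurable]: "V x \<epsilon> \<in> borel_measurable borel"
  unfolding V_def[abs_def] by measurable

text \<open>With \<tau> = |x - \<xi>|^2 and n - 2 = Suc (n - 3), the pole produced by
  \<open>log_moment_eq\<close> has order n - 2, the power occurring in \<open>V\<close>.\<close>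

lemma log_moment_V:
  assumes "norm x < R" "norm \<xi> = R" "\<epsilon> > 0"
  shows "radial_derivatives.log_moment (H \<xi>) (inner_cut x) (2 * R) ((norm (x - \<xi>))\<^sup>2) \<epsilon> (DIM('a) - 2) = of_real (log_factor DIM('a)) * V x \<epsilon> \<xi>"
proof -
  interpret radial_derivatives "H \<xi>" "inner_cut x" "2 * R" by (rule radial_derivatives_H[OF assms(1,2)])
  have n2: "DIM('a) - 2 = Suc (DIM('a) - 3)" using n3 by simp
  have "log_moment ((norm (x - \<xi>))\<^sup>2) \<epsilon> (DIM('a) - 2) =
    (- 1) ^ (DIM('a) - 3) * fact (DIM('a) - 3) * (of_real (2 / sigma_area DIM('a)) * V x \<epsilon> \<xi>)"
    unfolding V_def sph_mean_polar[OF assms, symmetric]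
    using log_moment_eq[OF assms(3), of "(norm (x - \<xi>))\<^sup>2" "DIM('a) - 3"] unfolding n2[symmetric] .
  then show ?thesis by (simp add: log_factor_def mult.assoc)
qed

lemma sphere_integrable_bounded:
  fixes g :: "'a \<Rightarrow> 'b::{banach, second_countable_topology}"
  assumes "g \<in> borel_measurable borel" "\<And>\<xi>. norm \<xi> = R \<Longrightarrow> norm (g \<xi>) \<le> K"
  shows "integrable (sphere_surface 0 R) g"
proof -
  interpret S: finite_measure "sphere_surface 0 R :: 'a measure"
    using r by (intro finite_measure_sphere_surface) simp
  show ?thesis
  proof (rule S.integrable_const_bound[where B = K])
    show "AE \<xi> in sphere_surface 0 R. norm (g \<xi>) \<le> K"
      by (rule eventually_mono[OF AE_sphere_surface assms(2)]) (use r in auto)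
  qed (use assms in simp)
qed

lemma sphere_dominated_convergence:
  fixes g :: "'a \<Rightarrow> real"
  assumes "g \<in> borel_measurable borel" "\<And>k. s k \<in> borel_measurable borel"
    and "\<And>\<xi>. norm \<xi> = R \<Longrightarrow> (\<lambda>k. s k \<xi>) \<longlonglongrightarrow> g \<xi>"
    and "\<And>\<xi> k. norm \<xi> = R \<Longrightarrow> \<bar>s k \<xi>\<bar> \<le> K"
  shows "(\<lambda>k. \<integral>\<xi>. s k \<xi> \<partial>sphere_surface 0 R) \<longlonglongrightarrow> (\<integral>\<xi>. g \<xi> \<partial>sphere_surface 0 R)"
proof -
  interpret S: finite_measure "sphere_surface 0 R :: 'a measure"
    using r by (intro finite_measure_sphere_surface) simp
  show ?thesis
  proof (rule integral_dominated_convergence[where w = "\<lambda>_. K"])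
    show "AE \<xi> in sphere_surface 0 R. (\<lambda>k. s k \<xi>) \<longlonglongrightarrow> g \<xi>"
      by (rule eventually_mono[OF AE_sphere_surface assms(3)]) (use r in auto)
    show "AE \<xi> in sphere_surface 0 R. norm (s k \<xi>) \<le> K" for k
      unfolding real_norm_def by (rule eventually_mono[OF AE_sphere_surface assms(4)]) (use r in auto)
  qed (use assms in auto)
qed

text \<open>For fixed \<epsilon> only, to have integrability over the sphere; bounds uniform in
  \<epsilon> come from the logarithmic moments.\<close>

lemma V_bound:
  assumes "\<epsilon> > 0"
  obtains K where "\<And>\<xi>. norm (V x \<epsilon> \<xi>) \<le> K"
proof -
  obtain B where B: "B \<ge> 0" "\<And>y. \<bar>f y\<bar> \<le> B" using test_function_bounded[OF f] by metis
  have intf: "integrable lborel (\<lambda>y. \<bar>f y\<bar>)"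
    by (intro integrable_abs integrable_bounded_support[where r = r and B = B])
       (use B test_function_eq_0[OF f] in auto)
  have "norm (V x \<epsilon> \<xi>) \<le> (\<integral>y. \<bar>f y\<bar> * (1 / \<epsilon> ^ (DIM('a) - 2)) \<partial>lborel)" for \<xi>
    unfolding V_def
  proof (rule order_trans[OF integral_norm_bound integral_mono'])
    show "norm (of_real (f y) * (1 / Complex ((norm (x - \<xi>))\<^sup>2 - (norm (\<xi> - y))\<^sup>2) \<epsilon> ^ (DIM('a) - 2))) \<le> \<bar>f y\<bar> * (1 / \<epsilon> ^ (DIM('a) - 2))" for y
      unfolding norm_mult norm_divide norm_power norm_of_real
      using Complex_upper_half(3)[OF assms] assms by (intro mult_left_mono frac_le power_mono) auto
  qed (use intf assms in auto)
  then show thesis using that by blast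
qed

text \<open>Joint measurability is known only for t > 0, whereas the distance is 0 at \<xi> = x; the
  value at that single point is split off as a constant.\<close>

lemma H_odd_measurable: "(\<lambda>\<xi>. H \<xi> j (norm (x - \<xi>))) \<in> borel_measurable borel"
proof -
  have "(\<lambda>\<xi>. if \<xi> = x then H x j 0 else (\<lambda>(\<xi>, t). indicator {0<..} t * H \<xi> j t) (\<xi>, norm (x - \<xi>))) \<in> borel_measurable borel"
    by (intro measurable_If measurable_compose[OF _ H_measurable[of j]]) measurable
  moreover have "(\<lambda>\<xi>. if \<xi> = x then H x j 0 else (\<lambda>(\<xi>, t). indicator {0<..} t * H \<xi> j t) (\<xi>, norm (x - \<xi>))) = (\<lambda>\<xi>. H \<xi> j (norm (x - \<xi>)))"
    by (auto simp: fun_eq_iff)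
  ultimately show ?thesis by simp
qed

lemma H_even_measurable:
  "(\<lambda>\<xi>. \<integral>t. indicator {0<..<2 * R} t * (t * H \<xi> j t * ln \<bar>t\<^sup>2 - (norm (x - \<xi>))\<^sup>2\<bar>) \<partial>lborel) \<in> borel_measurable borel"
proof -
  note [measurable] = H_measurable[of j]
  have "(\<lambda>\<xi>. \<integral>t. indicator {0<..<2 * R} t * (t * (\<lambda>(\<xi>, t). indicator {0<..} t * H \<xi> j t) (\<xi>, t) * ln \<bar>t\<^sup>2 - (norm (x - \<xi>))\<^sup>2\<bar>) \<partial>lborel) \<in> borel_measurable borel"
    by measurable
  moreover have "(\<lambda>t. indicator {0<..<2 * R} t * (t * (\<lambda>(\<xi>, t). indicator {0<..} t * H \<xi> j t) (\<xi>, t) * ln \<bar>t\<^sup>2 - (norm (x - \<xi>))\<^sup>2\<bar>))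
    = (\<lambda>t. indicator {0<..<2 * R} t * (t * H \<xi> j t * ln \<bar>t\<^sup>2 - (norm (x - \<xi>))\<^sup>2\<bar>))" for \<xi>
    by (auto simp: fun_eq_iff indicator_def)
  ultimately show ?thesis by (simp only:)
qed

text \<open>Dominated convergence over the sphere; the majorant is a constant because the argument
  of a complex number is at most \<pi> and H is bounded uniformly in \<xi>.\<close>

lemma integral_Im_V_tendsto:
  assumes x: "norm x < R"
  shows "(\<lambda>k. log_factor DIM('a) * Im (\<integral>\<xi>. V x (inv_seq k) \<xi> \<partial>sphere_surface 0 R)) \<longlonglongrightarrow>
    - pi * (\<integral>\<xi>. H \<xi> (DIM('a) - 3) (norm (x - \<xi>)) \<partial>sphere_surface 0 R)"
proof -
  have n2: "DIM('a) - 2 = Suc (DIM('a) - 3)" using n3 by simp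
  obtain B where B: "\<And>\<xi> t. norm \<xi> = R \<Longrightarrow> t > 0 \<Longrightarrow> \<bar>H \<xi> (DIM('a) - 2) t\<bar> \<le> B" using H_bound by metis
  have lim: "(\<lambda>k. \<integral>\<xi>. log_factor DIM('a) * Im (V x (inv_seq k) \<xi>) \<partial>sphere_surface 0 R) \<longlonglongrightarrow> (\<integral>\<xi>. - pi * H \<xi> (DIM('a) - 3) (norm (x - \<xi>)) \<partial>sphere_surface 0 R)"
  proof (rule sphere_dominated_convergence[where K = "2 * (2 * R) * B * pi * (2 * R - inner_cut x)"])
    show "(\<lambda>\<xi>. - pi * H \<xi> (DIM('a) - 3) (norm (x - \<xi>))) \<in> borel_measurable borel"
      by (intro borel_measurable_times borel_measurable_const H_odd_measurable)
    fix \<xi> :: 'a assume \<xi>: "norm \<xi> = R"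
    interpret radial_derivatives "H \<xi>" "inner_cut x" "2 * R" by (rule radial_derivatives_H[OF x \<xi>])
    have eq: "log_factor DIM('a) * Im (V x (inv_seq k) \<xi>) = Im (log_moment ((norm (x - \<xi>))\<^sup>2) (inv_seq k) (DIM('a) - 2))" for k
      unfolding log_moment_V[OF x \<xi> inv_seq(1)] by simp
    show "(\<lambda>k. log_factor DIM('a) * Im (V x (inv_seq k) \<xi>)) \<longlonglongrightarrow> - pi * H \<xi> (DIM('a) - 3) (norm (x - \<xi>))"
      unfolding eq n2
      by (rule Im_log_moment_tendsto[OF _ dist_sphere[OF x \<xi>]]) (use B[OF \<xi>] n2 in auto)
    show "\<bar>log_factor DIM('a) * Im (V x (inv_seq k) \<xi>)\<bar> \<le> 2 * (2 * R) * B * pi * (2 * R - inner_cut x)" for k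
      unfolding eq by (rule Im_log_moment_bound[OF B[OF \<xi>] inv_seq(1)])
  qed measurable
  have eq: "(\<integral>\<xi>. log_factor DIM('a) * Im (V x (inv_seq k) \<xi>) \<partial>sphere_surface 0 R) = log_factor DIM('a) * Im (\<integral>\<xi>. V x (inv_seq k) \<xi> \<partial>sphere_surface 0 R)" for k
  proof -
    obtain K where "\<And>\<xi>. norm (V x (inv_seq k) \<xi>) \<le> K" using V_bound[OF inv_seq(1)] by metis
    then have "integrable (sphere_surface 0 R) (V x (inv_seq k))" by (intro sphere_integrable_bounded) auto
    then show ?thesis by (simp add: integral_bounded_linear[OF bounded_linear_Im])
  qed
  show ?thesis using lim unfolding eq unfolding integral_mult_right_zero .
qed

lemma integral_Re_V_tendsto:
  assumes x: "norm x < R"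
  shows "(\<lambda>k. log_factor DIM('a) * Re (\<integral>\<xi>. V x (inv_seq k) \<xi> \<partial>sphere_surface 0 R)) \<longlonglongrightarrow>
    2 * (\<integral>\<xi>. (\<integral>t. indicator {0<..<2 * R} t * (t * H \<xi> (DIM('a) - 2) t * ln \<bar>t\<^sup>2 - (norm (x - \<xi>))\<^sup>2\<bar>) \<partial>lborel) \<partial>sphere_surface 0 R)"
proof -
  obtain B where B: "\<And>\<xi> t. norm \<xi> = R \<Longrightarrow> t > 0 \<Longrightarrow> \<bar>H \<xi> (DIM('a) - 2) t\<bar> \<le> B" using H_bound by metis
  define g where "g \<xi> = (\<integral>t. indicator {0<..<2 * R} t * (t * H \<xi> (DIM('a) - 2) t * ln \<bar>t\<^sup>2 - (norm (x - \<xi>))\<^sup>2\<bar>) \<partial>lborel)" for \<xi>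
  \<comment> \<open>The interval (0, 2R) and the cut interval give the same integral since H
    vanishes below the cut and at 2R.\<close>
  have g_eq: "2 * g \<xi> = (\<integral>t. indicator {inner_cut x..2 * R} t * (2 * t * H \<xi> (DIM('a) - 2) t * ln \<bar>(norm (x - \<xi>))\<^sup>2 - t\<^sup>2\<bar>) \<partial>lborel)"
    if \<xi>: "norm \<xi> = R" for \<xi>
    unfolding g_def integral_mult_right_zero[symmetric]
  proof (rule Bochner_Integration.integral_cong[OF refl])
    fix t :: real
    have 0: "H \<xi> (DIM('a) - 2) t = 0" if "t > 0" "t < inner_cut x \<or> t \<ge> 2 * R"
      using that inner_cut(2)[of x] r \<xi> by (intro H_eq_0) auto
    show "2 * (indicator {0<..<2 * R} t * (t * H \<xi> (DIM('a) - 2) t * ln \<bar>t\<^sup>2 - (norm (x - \<xi>))\<^sup>2\<bar>)) =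
      indicator {inner_cut x..2 * R} t * (2 * t * H \<xi> (DIM('a) - 2) t * ln \<bar>(norm (x - \<xi>))\<^sup>2 - t\<^sup>2\<bar>)"
    proof (cases "t > 0 \<and> \<not> (t < inner_cut x \<or> t \<ge> 2 * R)")
      case True
      then show ?thesis by (auto simp: abs_minus_commute)
    next
      case False
      then show ?thesis using 0 inner_cut(1)[OF x] by (auto simp: indicator_def)
    qed
  qed
  have lim: "(\<lambda>k. \<integral>\<xi>. log_factor DIM('a) * Re (V x (inv_seq k) \<xi>) \<partial>sphere_surface 0 R) \<longlonglongrightarrow> (\<integral>\<xi>. 2 * g \<xi> \<partial>sphere_surface 0 R)"
  proof (rule sphere_dominated_convergence[where K = "2 * (2 * R) * B * radial_derivatives.log_majorant_integral (inner_cut x) (2 * R)"])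
    show "(\<lambda>\<xi>. 2 * g \<xi>) \<in> borel_measurable borel"
      unfolding g_def by (intro borel_measurable_times borel_measurable_const H_even_measurable)
    fix \<xi> :: 'a assume \<xi>: "norm \<xi> = R"
    interpret radial_derivatives "H \<xi>" "inner_cut x" "2 * R" by (rule radial_derivatives_H[OF x \<xi>])
    have eq: "log_factor DIM('a) * Re (V x (inv_seq k) \<xi>) = Re (log_moment ((norm (x - \<xi>))\<^sup>2) (inv_seq k) (DIM('a) - 2))" for k
      unfolding log_moment_V[OF x \<xi> inv_seq(1)] by simp
    show "(\<lambda>k. log_factor DIM('a) * Re (V x (inv_seq k) \<xi>)) \<longlonglongrightarrow> 2 * g \<xi>"
      unfolding eq g_eq[OF \<xi>] by (rule Re_log_moment_tendsto[OF B[OF \<xi>] dist_sphere[OF x \<xi>]])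
    show "\<bar>log_factor DIM('a) * Re (V x (inv_seq k) \<xi>)\<bar> \<le> 2 * (2 * R) * B * log_majorant_integral" for k
      unfolding eq by (rule Re_log_moment_bound[OF B[OF \<xi>] dist_sphere[OF x \<xi>] inv_seq(1,2)])
  qed measurable
  have eq: "(\<integral>\<xi>. log_factor DIM('a) * Re (V x (inv_seq k) \<xi>) \<partial>sphere_surface 0 R) = log_factor DIM('a) * Re (\<integral>\<xi>. V x (inv_seq k) \<xi> \<partial>sphere_surface 0 R)" for k
  proof -
    obtain K where "\<And>\<xi>. norm (V x (inv_seq k) \<xi>) \<le> K" using V_bound[OF inv_seq(1)] by metis
    then have "integrable (sphere_surface 0 R) (V x (inv_seq k))" by (intro sphere_integrable_bounded) auto
    then show ?thesis by (simp add: integral_bounded_linear[OF bounded_linear_Re])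
  qed
  show ?thesis using lim unfolding eq unfolding integral_mult_right_zero g_def .
qed

end

section \<open>The backprojected kernel and its limit\<close>

context spherical_inversion
begin

definition K :: "'a \<Rightarrow> real \<Rightarrow> 'a \<Rightarrow> complex" where
  "K x \<epsilon> y = (\<integral>\<xi>. 1 / Complex ((norm (x - \<xi>))\<^sup>2 - (norm (\<xi> - y))\<^sup>2) \<epsilon> ^ (DIM('a) - 2) \<partial>sphere_surface 0 R)"

lemma f_bound_integrable: "integrable lborel (\<lambda>y. \<bar>f y\<bar>)" "integrable lborel f"
proof -
  obtain B where B: "B \<ge> 0" "\<And>y. \<bar>f y\<bar> \<le> B" using test_function_bounded[OF f] by metis
  show "integrable lborel f"
    by (intro integrable_bounded_support[where r = r and B = B])
       (use B test_function_eq_0[OF f] in auto)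
  then show "integrable lborel (\<lambda>y. \<bar>f y\<bar>)" by (rule integrable_abs)
qed

text \<open>Fubini, legitimate because for positive \<epsilon> the integrand is bounded by |f| /
  \<epsilon>^(n-2) and the sphere has finite measure.\<close>

lemma sphere_integral_V:
  assumes \<epsilon>: "\<epsilon> > 0"
  shows "(\<integral>\<xi>. V x \<epsilon> \<xi> \<partial>sphere_surface 0 R) = (\<integral>y. of_real (f y) * K x \<epsilon> y \<partial>lborel)"
    and "integrable lborel (\<lambda>y. of_real (f y) * K x \<epsilon> y)"
proof -
  interpret S: finite_measure "sphere_surface 0 R :: 'a measure"
    using r by (intro finite_measure_sphere_surface) simp
  interpret pair_sigma_finite "sphere_surface 0 R :: 'a measure" "lborel :: 'a measure" ..
  define G :: "'a \<Rightarrow> 'a \<Rightarrow> complex" where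
    "G \<xi> y = of_real (f y) * (1 / Complex ((norm (x - \<xi>))\<^sup>2 - (norm (\<xi> - y))\<^sup>2) \<epsilon> ^ (DIM('a) - 2))" for \<xi> y
  have G_meas[measurable]: "(\<lambda>(\<xi>, y). G \<xi> y) \<in> borel_measurable (borel \<Otimes>\<^sub>M borel)"
    unfolding G_def by measurable
  have G_bound: "norm (G \<xi> y) \<le> \<bar>f y\<bar> * (1 / \<epsilon> ^ (DIM('a) - 2))" for \<xi> y
    unfolding G_def norm_mult norm_divide norm_power norm_of_real
    using Complex_upper_half(3)[OF \<epsilon>] \<epsilon> by (intro mult_left_mono frac_le power_mono) auto
  have G_int: "integrable lborel (G \<xi>)" for \<xi>
    by (rule Bochner_Integration.integrable_bound[OF integrable_mult_left[OF f_bound_integrable(1), of "1 / \<epsilon> ^ (DIM('a) - 2)"]])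
       (use G_bound \<epsilon> in \<open>auto simp: abs_mult\<close>)
  have int: "integrable (sphere_surface 0 R \<Otimes>\<^sub>M lborel) (\<lambda>(\<xi>, y). G \<xi> y)"
  proof (rule Fubini_integrable)
    show "integrable (sphere_surface 0 R) (\<lambda>\<xi>. \<integral>y. norm (case (\<xi>, y) of (\<xi>, y) \<Rightarrow> G \<xi> y) \<partial>lborel)"
    proof (rule sphere_integrable_bounded[where K = "\<integral>y. \<bar>f y\<bar> * (1 / \<epsilon> ^ (DIM('a) - 2)) \<partial>lborel"])
      fix \<xi> :: 'a
      have "(\<integral>y. norm (G \<xi> y) \<partial>lborel) \<le> (\<integral>y. \<bar>f y\<bar> * (1 / \<epsilon> ^ (DIM('a) - 2)) \<partial>lborel)"
        by (rule integral_mono[OF integrable_norm[OF G_int] integrable_mult_left[OF f_bound_integrable(1)] G_bound])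
      then show "norm (\<integral>y. norm (case (\<xi>, y) of (\<xi>, y) \<Rightarrow> G \<xi> y) \<partial>lborel) \<le> (\<integral>y. \<bar>f y\<bar> * (1 / \<epsilon> ^ (DIM('a) - 2)) \<partial>lborel)"
        by simp
    qed measurable
  qed (use G_int in auto)
  have K_eq: "(\<integral>\<xi>. G \<xi> y \<partial>sphere_surface 0 R) = of_real (f y) * K x \<epsilon> y" for y
    unfolding G_def K_def by (simp only: integral_mult_right_zero)
  have "(\<integral>\<xi>. V x \<epsilon> \<xi> \<partial>sphere_surface 0 R) = (\<integral>\<xi>. (\<integral>y. G \<xi> y \<partial>lborel) \<partial>sphere_surface 0 R)"
    by (simp add: V_def G_def)
  also have "\<dots> = (\<integral>y. (\<integral>\<xi>. G \<xi> y \<partial>sphere_surface 0 R) \<partial>lborel)"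
    by (rule Fubini_integral[OF int, symmetric])
  finally show "(\<integral>\<xi>. V x \<epsilon> \<xi> \<partial>sphere_surface 0 R) = (\<integral>y. of_real (f y) * K x \<epsilon> y \<partial>lborel)"
    unfolding K_eq .
  show "integrable lborel (\<lambda>y. of_real (f y) * K x \<epsilon> y)"
    using integrable_snd[OF int] unfolding K_eq by simp
qed

text \<open>On \<open>|\<xi>| = R\<close> the difference \<open>|x - \<xi>|\<^sup>2 - |y - \<xi>|\<^sup>2\<close> is affine in \<open>\<xi>\<close>, with slope in the direction \<open>x - y\<close>.\<close>
lemma K_eq_normalized_kernel:
  assumes "y \<noteq> x" and \<epsilon>: "\<epsilon> > 0"
  defines "\<kappa> \<equiv> 2 * R * norm (x - y)"
  shows "K x \<epsilon> y = of_real (R / 2 ^ (DIM('a) - 2) * (1 / norm (x - y) ^ (DIM('a) - 2))) * (\<i> * (- \<i>) ^ (DIM('a) - 1)) *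
    normalized_kernel (sgn (x - y)) (Complex (((norm x)\<^sup>2 - (norm y)\<^sup>2) / \<kappa>) (\<epsilon> / \<kappa>))"
proof -
  define m where "m = DIM('a) - 2"
  have n: "DIM('a) - 1 = Suc m" using n3 by (simp add: m_def)
  define e where "e = sgn (x - y)"
  define z where "z = Complex (((norm x)\<^sup>2 - (norm y)\<^sup>2) / \<kappa>) (\<epsilon> / \<kappa>)"
  have R: "R > 0" using r by simp
  have nv: "norm (x - y) > 0" using assms by simp
  have \<kappa>: "\<kappa> > 0" using R nv by (simp add: \<kappa>_def)
  have e: "x - y = norm (x - y) *\<^sub>R e" using nv by (simp add: e_def sgn_div_norm)
  \<comment> \<open>The terms R^2 cancel in the difference of squares; dividing by the length
    \<kappa> of the slope makes e a unit vector and rescales \<epsilon> to \<epsilon> /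
    \<kappa>.\<close>
  have key: "Complex ((norm (x - R *\<^sub>R \<theta>))\<^sup>2 - (norm (R *\<^sub>R \<theta> - y))\<^sup>2) \<epsilon> = of_real \<kappa> * (z - of_real (\<theta> \<bullet> e))" for \<theta>
  proof -
    have "(norm (x - R *\<^sub>R \<theta>))\<^sup>2 - (norm (R *\<^sub>R \<theta> - y))\<^sup>2 = (norm x)\<^sup>2 - (norm y)\<^sup>2 - 2 * R * (\<theta> \<bullet> (x - y))"
      unfolding power2_norm_eq_inner by (simp add: algebra_simps inner_commute)
    also have "\<theta> \<bullet> (x - y) = norm (x - y) * (\<theta> \<bullet> e)" by (subst e) simp
    also have "(norm x)\<^sup>2 - (norm y)\<^sup>2 - 2 * R * (norm (x - y) * (\<theta> \<bullet> e)) = ((norm x)\<^sup>2 - (norm y)\<^sup>2) - \<kappa> * (\<theta> \<bullet> e)"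
      by (simp add: \<kappa>_def)
    also have "\<dots> = \<kappa> * (((norm x)\<^sup>2 - (norm y)\<^sup>2) / \<kappa> - \<theta> \<bullet> e)"
    proof -
      have "A - \<kappa> * w = \<kappa> * (A / \<kappa> - w)" for A w using \<kappa> by (simp add: right_diff_distrib)
      then show ?thesis .
    qed
    finally have "(norm (x - R *\<^sub>R \<theta>))\<^sup>2 - (norm (R *\<^sub>R \<theta> - y))\<^sup>2 = \<kappa> * (((norm x)\<^sup>2 - (norm y)\<^sup>2) / \<kappa> - \<theta> \<bullet> e)" .
    then show ?thesis using \<kappa> by (simp add: complex_eq_iff z_def)
  qed
  have [measurable]: "(\<lambda>\<xi>. Complex ((norm (x - \<xi>))\<^sup>2 - (norm (\<xi> - y))\<^sup>2) \<epsilon>) \<in> borel_measurable borel"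
    unfolding Complex_eq by measurable
  have "K x \<epsilon> y = R ^ Suc m *\<^sub>R (\<integral>\<theta>. 1 / (of_real \<kappa> * (z - of_real (\<theta> \<bullet> e))) ^ m \<partial>sphere_surface 0 1)"
    unfolding K_def m_def[symmetric] key[symmetric] n[symmetric]
    by (rule integral_sphere_surface_scale) (use R in auto)
  also have "(\<integral>\<theta>. 1 / (of_real \<kappa> * (z - of_real (\<theta> \<bullet> e))) ^ m \<partial>sphere_surface 0 1) = of_real (1 / \<kappa> ^ m) * sphere_kernel e m z"
    unfolding sphere_kernel_def integral_mult_right_zero[symmetric] by (simp add: power_mult_distrib)
  also have "sphere_kernel e m z = (\<i> * (- \<i>) ^ (DIM('a) - 1)) * normalized_kernel e z"
    by (simp add: normalized_kernel_def m_def)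
  also have "R ^ Suc m *\<^sub>R (of_real (1 / \<kappa> ^ m) * ((\<i> * (- \<i>) ^ (DIM('a) - 1)) * normalized_kernel e z)) =
    of_real (R ^ Suc m * (1 / \<kappa> ^ m)) * (\<i> * (- \<i>) ^ (DIM('a) - 1)) * normalized_kernel e z"
    by (simp add: scaleR_conv_of_real mult_ac)
  \<comment> \<open>The power of \<kappa> = 2 R |x - y| is the source of the Newtonian kernel |x -
    y|^(2-n).\<close>
  also have "R ^ Suc m * (1 / \<kappa> ^ m) = R / 2 ^ m * (1 / norm (x - y) ^ m)"
    unfolding \<kappa>_def using R by (simp add: power_mult_distrib)
  finally show ?thesis unfolding m_def e_def z_def .
qed

definition newton_potential :: "'a \<Rightarrow> real" where
  "newton_potential x = (\<integral>z. f (x - z) * (1 / norm z ^ (DIM('a) - 2)) \<partial>lborel)"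

text \<open>The definition, with the moving point in f, is the form that can be differentiated; the
  form with the moving point in the kernel is the one that the limit produces.\<close>

lemma newton_potential_eq:
  shows "integrable lborel (\<lambda>y. f y * (1 / norm (x - y) ^ (DIM('a) - 2)))"
    and "newton_potential x = (\<integral>y. f y * (1 / norm (x - y) ^ (DIM('a) - 2)) \<partial>lborel)"
proof -
  obtain B where B: "B \<ge> 0" "\<And>y. \<bar>f y\<bar> \<le> B" using test_function_bounded[OF f] by metis
  define g where "g y = f y * (1 / norm (x - y) ^ (DIM('a) - 2))" for y
  have [measurable]: "g \<in> borel_measurable borel" unfolding g_def[abs_def] by measurable
  have g: "g (x - z) = f (x - z) * (1 / norm z ^ (DIM('a) - 2))" for z by (simp add: g_def)
  have "integrable lborel (\<lambda>z. g (x - z))"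
    unfolding g
  proof (rule integrable_singular_kernel[where r = "norm x + r" and p = "DIM('a) - 2"])
    show "\<bar>f (x - z)\<bar> \<le> B" for z by (rule B)
    show "f (x - z) = 0" if "norm z > norm x + r" for z
      using that norm_triangle_ineq4[of x "x - z"] by (intro test_function_eq_0[OF f]) simp
  qed (use n3 in auto)
  then have "integrable lborel g" by (simp add: integral_lborel_reflect(2))
  then show "integrable lborel (\<lambda>y. f y * (1 / norm (x - y) ^ (DIM('a) - 2)))" unfolding g_def[abs_def] .
  have "newton_potential x = (\<integral>z. g (x - z) \<partial>lborel)" by (simp add: newton_potential_def g)
  also have "\<dots> = (\<integral>y. g y \<partial>lborel)" by (rule integral_lborel_reflect(1)) simp
  finally show "newton_potential x = (\<integral>y. f y * (1 / norm (x - y) ^ (DIM('a) - 2)) \<partial>lborel)" by (simp add: g_def)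
qed

text \<open>Division by the unit i (-i)^(n-1) turns the kernel into the normalised one, whose real
  part tends to a constant times |x - y|^(2-n) for every y in the support other than x. The majorant
  is a multiple of |f| times the Newtonian kernel.\<close>

lemma V_limit:
  assumes x: "norm x < R"
  shows "(\<lambda>k. Re ((\<integral>\<xi>. V x (inv_seq k) \<xi> \<partial>sphere_surface 0 R) / (\<i> * (- \<i>) ^ (DIM('a) - 1)))) \<longlonglongrightarrow>
    R / 2 ^ (DIM('a) - 2) * ((DIM('a) - 2) * sigma_area DIM('a) * beta_const (DIM('a) - 1)) * newton_potential x"
proof -
  define \<omega> where "\<omega> = \<i> * (- \<i>) ^ (DIM('a) - 1)"
  have \<omega>: "\<omega> \<noteq> 0" by (simp add: \<omega>_def)
  define L where "L = (DIM('a) - 2) * sigma_area DIM('a) * beta_const (DIM('a) - 1)"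
  define C where "C = R / 2 ^ (DIM('a) - 2)"
  have R: "R > 0" using r by simp
  have C: "C > 0" using R by (simp add: C_def)
  define g where "g y = f y * (1 / norm (x - y) ^ (DIM('a) - 2))" for y
  have g_int: "integrable lborel g" unfolding g_def by (rule newton_potential_eq)
  define \<kappa> where "\<kappa> y = 2 * R * norm (x - y)" for y
  define h where "h y = ((norm x)\<^sup>2 - (norm y)\<^sup>2) / \<kappa> y" for y
  \<comment> \<open>Since ||x| - |y|| <= |x - y|, the abscissa h y is at most (|x| + |y|) / (2R) in
    modulus; with x inside the ball and the support in radius r < R this stays strictly below 1,
    uniformly in y.\<close>
  define h0 where "h0 = (norm x + r) / (2 * R)"
  have h0: "0 \<le> h0" "h0 < 1" using x r by (auto simp: h0_def divide_simps)
  obtain M where M: "\<And>(e::'a) h \<eta>. norm e = 1 \<Longrightarrow> \<bar>h\<bar> \<le> h0 \<Longrightarrow> \<eta> > 0 \<Longrightarrow> \<bar>Re (normalized_kernel e (Complex h \<eta>))\<bar> \<le> M"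
    using Re_normalized_kernel_bound[OF n3 h0] by metis
  have bl: "bounded_linear (\<lambda>z. Re (z / \<omega>))"
    by (intro bounded_linear_compose[OF bounded_linear_Re] bounded_linear_divide)
  have s_eq: "Re (of_real (f y) * K x \<epsilon> y / \<omega>) = C * g y * Re (normalized_kernel (sgn (x - y)) (Complex (h y) (\<epsilon> / \<kappa> y)))"
    if "y \<noteq> x" "\<epsilon> > 0" for y \<epsilon>
  proof -
    have "of_real (f y) * K x \<epsilon> y / \<omega> = of_real (C * g y) * normalized_kernel (sgn (x - y)) (Complex (h y) (\<epsilon> / \<kappa> y))"
      unfolding K_eq_normalized_kernel[OF that] \<omega>_def[symmetric] C_def[symmetric] \<kappa>_def[symmetric] h_def[symmetric] g_def
      using \<omega> by simp
    then show ?thesis by (simp only: Re_complex_of_real Im_complex_of_real times_complex.sel mult_zero_left diff_zero)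
  qed
  have h_bound: "\<bar>h y\<bar> \<le> h0" if "y \<noteq> x" "norm y \<le> r" for y
  proof -
    have nv: "norm (x - y) > 0" using that by simp
    have "(norm x)\<^sup>2 - (norm y)\<^sup>2 = (norm x - norm y) * (norm x + norm y)"
      by (simp add: power2_eq_square algebra_simps)
    then have "\<bar>(norm x)\<^sup>2 - (norm y)\<^sup>2\<bar> = \<bar>norm x - norm y\<bar> * (norm x + norm y)"
      by (simp add: abs_mult)
    also have "\<dots> \<le> norm (x - y) * (norm x + r)"
      using that norm_triangle_ineq3[of x y] by (intro mult_mono) auto
    finally show ?thesis using nv R by (simp add: h_def \<kappa>_def h0_def abs_mult divide_simps mult_ac)
  qed
  have "(\<lambda>k. \<integral>y. Re (of_real (f y) * K x (inv_seq k) y / \<omega>) \<partial>lborel) \<longlonglongrightarrow> (\<integral>y. C * g y * L \<partial>lborel)"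
  proof (rule integral_dominated_convergence[where w = "\<lambda>y. C * M * \<bar>g y\<bar>"])
    show "integrable lborel (\<lambda>y. C * M * \<bar>g y\<bar>)" using g_int by auto
    show "(\<lambda>y. C * g y * L) \<in> borel_measurable lborel" using g_int by auto
    show "(\<lambda>y. Re (of_real (f y) * K x (inv_seq k) y / \<omega>)) \<in> borel_measurable lborel" for k
      using integrable_bounded_linear[OF bl sphere_integral_V(2)[OF inv_seq(1)]] by (rule borel_measurable_integrable)
    show "AE y in lborel. (\<lambda>k. Re (of_real (f y) * K x (inv_seq k) y / \<omega>)) \<longlonglongrightarrow> C * g y * L"
    proof (rule eventually_mono[OF AE_lborel_singleton[of x]])
      fix y assume y: "y \<noteq> x"
      show "(\<lambda>k. Re (of_real (f y) * K x (inv_seq k) y / \<omega>)) \<longlonglongrightarrow> C * g y * L"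
      proof (cases "norm y \<le> r")
        case True
        have \<kappa>: "\<kappa> y > 0" using y R by (simp add: \<kappa>_def)
        have e: "norm (sgn (x - y)) = 1" using y by (simp add: norm_sgn)
        have "filterlim (\<lambda>k. inv_seq k / \<kappa> y) (at_right 0) sequentially"
        proof (rule tendsto_imp_filterlim_at_right)
          have "(\<lambda>k. inv_seq k / \<kappa> y) \<longlonglongrightarrow> 0 / \<kappa> y" using \<kappa> by (intro tendsto_intros inv_seq) auto
          then show "(\<lambda>k. inv_seq k / \<kappa> y) \<longlonglongrightarrow> 0" by simp
        qed (use \<kappa> inv_seq(1) in auto)
        moreover have "\<bar>h y\<bar> < 1" using h_bound[OF y True] h0 by simp
        ultimately have "(\<lambda>k. Re (normalized_kernel (sgn (x - y)) (Complex (h y) (inv_seq k / \<kappa> y)))) \<longlonglongrightarrow> L"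
          unfolding L_def using filterlim_compose[OF Re_normalized_kernel_tendsto[OF n3 e]] by blast
        then show ?thesis unfolding s_eq[OF y inv_seq(1)] by (intro tendsto_intros)
      next
        case False
        then show ?thesis using test_function_eq_0[OF f, of y] by (simp add: g_def)
      qed
    qed
    show "AE y in lborel. norm (Re (of_real (f y) * K x (inv_seq k) y / \<omega>)) \<le> C * M * \<bar>g y\<bar>" for k
    proof (rule eventually_mono[OF AE_lborel_singleton[of x]])
      fix y assume y: "y \<noteq> x"
      show "norm (Re (of_real (f y) * K x (inv_seq k) y / \<omega>)) \<le> C * M * \<bar>g y\<bar>"
      proof (cases "norm y \<le> r")
        case True
        have "\<kappa> y > 0" using y R by (simp add: \<kappa>_def)
        then have "\<bar>Re (normalized_kernel (sgn (x - y)) (Complex (h y) (inv_seq k / \<kappa> y)))\<bar> \<le> M"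
          using h_bound[OF y True] inv_seq(1)[of k] y by (intro M) (auto simp: norm_sgn)
        then have "C * \<bar>g y\<bar> * \<bar>Re (normalized_kernel (sgn (x - y)) (Complex (h y) (inv_seq k / \<kappa> y)))\<bar> \<le> C * \<bar>g y\<bar> * M"
          using C by (intro mult_left_mono) auto
        then show ?thesis unfolding s_eq[OF y inv_seq(1)] using C by (simp add: abs_mult mult_ac)
      next
        case False
        then show ?thesis using test_function_eq_0[OF f, of y] by (simp add: g_def)
      qed
    qed
  qed
  moreover have "(\<integral>y. Re (of_real (f y) * K x (inv_seq k) y / \<omega>) \<partial>lborel) = Re ((\<integral>\<xi>. V x (inv_seq k) \<xi> \<partial>sphere_surface 0 R) / \<omega>)" for k
    unfolding sphere_integral_V(1)[OF inv_seq(1)]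
    by (rule integral_bounded_linear[OF bl sphere_integral_V(2)[OF inv_seq(1)]])
  moreover have "(\<integral>y. C * g y * L \<partial>lborel) = C * L * newton_potential x"
    unfolding newton_potential_eq(2) g_def[symmetric] by (simp add: mult_ac)
  ultimately show ?thesis unfolding \<omega>_def C_def L_def by (simp only:)
qed

end

section \<open>Constants and conclusion\<close>

text \<open>Legendre's duplication formula at half integers; raising k by one multiplies both sides
  by k through the functional equation of Gamma.\<close>

lemma Gamma_half_duplication:
  "k \<ge> 1 \<Longrightarrow> Gamma (real k / 2) * Gamma ((real k + 1) / 2) * 2 ^ (k - 1) = sqrt pi * fact (k - 1)"
proof (induction k rule: nat_induct_at_least)
  case base
  then show ?case by (simp add: Gamma_one_half_real)
next
  case (Suc k)
  obtain j where j: "k = Suc j" using Suc by (cases k) auto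
  have "Gamma (real k / 2 + 1) = real k / 2 * Gamma (real k / 2)"
    using nonpos_Ints_nonpos[of "real k / 2"] Suc by (intro Gamma_plus1) auto
  moreover have "(real (Suc k) + 1) / 2 = real k / 2 + 1" "real (Suc k) / 2 = (real k + 1) / 2" by (auto simp: field_simps)
  ultimately have "Gamma (real (Suc k) / 2) * Gamma ((real (Suc k) + 1) / 2) * 2 ^ (Suc k - 1)
    = real k * (Gamma (real k / 2) * Gamma ((real k + 1) / 2) * 2 ^ (k - 1))"
    unfolding j by (simp only: diff_Suc_1 power_Suc) simp
  also have "\<dots> = sqrt pi * fact (Suc k - 1)" unfolding Suc.IH by (simp add: j)
  finally show ?case .
qed

text \<open>Collects the factors of the whole argument: (n-3)! from the integrations by parts, one n
  - 2 and the beta value from the boundary limit, the other n - 2 from the Laplacian; of three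
  occurrences of the area one cancels against its reciprocal in \<open>log_factor\<close> and
  another is common to the final quotient. Both parities use it.\<close>

lemma inversion_constant:
  assumes "n \<ge> 3"
  shows "fact (n - 3) * (real (n - 2) * real (n - 2)) * sigma_area n * beta_const (n - 1) =
    2 * 2 ^ (n - 2) * pi powr (real n / 2) * Gamma (real n / 2)"
proof -
  define m where "m = n - 3"
  have n: "n = m + 3" using assms by (simp add: m_def)
  define a where "a = Gamma ((real m + 1) / 2)"
  define b where "b = Gamma ((real m + 2) / 2)"
  define g where "g = Gamma (real n / 2)"
  have pos: "a > 0" "b > 0" "g > 0" unfolding a_def b_def g_def by (intro Gamma_real_pos; simp add: n)+
  have g: "g = (real m + 1) / 2 * a"
  proof -
    have "Gamma ((real m + 1) / 2 + 1) = (real m + 1) / 2 * Gamma ((real m + 1) / 2)"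
      using nonpos_Ints_nonpos[of "(real m + 1) / 2"] by (intro Gamma_plus1) auto
    moreover have "(real m + 1) / 2 + 1 = real n / 2" by (simp add: n field_simps)
    ultimately show ?thesis unfolding g_def a_def by simp
  qed
  have dup: "b * g * 2 ^ (m + 1) = sqrt pi * fact (m + 1)"
  proof -
    have e: "real (m + 2) / 2 = (real m + 2) / 2" "(real (m + 2) + 1) / 2 = real n / 2" by (auto simp: n field_simps)
    show ?thesis using Gamma_half_duplication[of "m + 2"]
      unfolding e b_def[symmetric] g_def[symmetric] by (simp del: fact_Suc power_Suc)
  qed
  have beta: "beta_const (n - 1) = sqrt pi * a / (2 * b)"
  proof -
    have e: "(real (n - 1) - 1) / 2 = (real m + 1) / 2" "real (n - 1) / 2 = (real m + 2) / 2" by (auto simp: n)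
    show ?thesis unfolding beta_const_def a_def b_def e ..
  qed
  have sig: "sigma_area n = 2 * pi powr (real n / 2) / g" by (simp add: sigma_area_def g_def)
  have fact: "fact (n - 3) * real (n - 2) = (fact (m + 1) :: real)" by (simp add: n)
  have n2: "real (n - 2) = real m + 1" by (simp add: n)
  have "fact (n - 3) * (real (n - 2) * real (n - 2)) * sigma_area n * beta_const (n - 1)
    = (sqrt pi * fact (m + 1)) * ((real m + 1) * a) * pi powr (real n / 2) / (g * b)"
    unfolding sig beta fact[symmetric] n2 using pos by (simp add: field_simps)
  also have "(real m + 1) * a = 2 * g" using g by simp
  also have "sqrt pi * fact (m + 1) = b * g * 2 ^ (m + 1)" using dup by simp
  also have "b * g * 2 ^ (m + 1) * (2 * g) * pi powr (real n / 2) / (g * b) = 2 * 2 ^ (n - 2) * pi powr (real n / 2) * g"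
    using pos by (simp add: n field_simps)
  finally show ?thesis by (simp add: g_def)
qed

text \<open>The backprojection formulas hold only for |y| < R. As second derivatives are local,
  agreement on a neighbourhood of x suffices, but it must be passed through both applications of
  \<open>deriv\<close>.\<close>

lemma laplacian_cong_open:
  fixes x :: "'a::euclidean_space"
  assumes "open S" "x \<in> S" "\<And>y. y \<in> S \<Longrightarrow> g1 y = g2 y"
  shows "laplacian g1 x = laplacian g2 x"
  unfolding laplacian_def
proof (rule sum.cong[OF refl])
  fix i :: 'a
  have "isCont (\<lambda>s. x + s *\<^sub>R i) 0" by (intro continuous_intros)
  then have "\<forall>\<^sub>F s in nhds 0. x + s *\<^sub>R i \<in> S"
    using assms(1,2) topological_tendstoD[of "\<lambda>s. x + s *\<^sub>R i" x "nhds 0" S]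
    by (simp add: isCont_def tendsto_nhds_iff)
  then have "\<forall>\<^sub>F s in nhds 0. g1 (x + s *\<^sub>R i) = g2 (x + s *\<^sub>R i)"
    using assms(3) by (auto elim: eventually_mono)
  then have "\<forall>\<^sub>F s in nhds 0. \<forall>\<^sub>F s' in nhds s. g1 (x + s' *\<^sub>R i) = g2 (x + s' *\<^sub>R i)"
    by (simp add: eventually_eventually)
  then have "\<forall>\<^sub>F s in nhds 0. deriv (\<lambda>s. g1 (x + s *\<^sub>R i)) s = deriv (\<lambda>s. g2 (x + s *\<^sub>R i)) s"
    by (rule eventually_mono) (rule deriv_cong_ev[OF _ refl])
  then show "deriv (deriv (\<lambda>s. g1 (x + s *\<^sub>R i))) 0 = deriv (deriv (\<lambda>s. g2 (x + s *\<^sub>R i))) 0"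
    by (rule deriv_cong_ev[OF _ refl])
qed

context spherical_inversion
begin

text \<open>\<open>deriv\<close> is linear only on differentiable functions, so the two derivatives
  of the potential along each axis are exhibited explicitly before the constant is pulled
  out.\<close>

lemma laplacian_newton_potential_cmult:
  "laplacian (\<lambda>y. c * newton_potential y) x = - (c * (real (DIM('a) - 2) * sigma_area DIM('a) * f x))"
proof -
  have p: "DIM('a) - 2 < DIM('a)" using n3 by simp
  have "laplacian (\<lambda>y. c * newton_potential y) x = c * laplacian newton_potential x"
    unfolding laplacian_def sum_distrib_left
  proof (rule sum.cong[OF refl])
    fix i :: 'a
    define d1 where "d1 s = (\<integral>z. dir_deriv f i (x + s *\<^sub>R i - z) * (1 / norm z ^ (DIM('a) - 2)) \<partial>lborel)" for s
    define d2 where "d2 = (\<integral>z. dir_deriv (dir_deriv f i) i (x + 0 *\<^sub>R i - z) * (1 / norm z ^ (DIM('a) - 2)) \<partial>lborel)"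
    have D1: "((\<lambda>s. newton_potential (x + s *\<^sub>R i)) has_real_derivative d1 s) (at s)" for s
      unfolding newton_potential_def d1_def by (rule potential_deriv[OF f p])
    have D2: "(d1 has_real_derivative d2) (at 0)"
      unfolding d1_def d2_def by (rule potential_deriv[OF test_function_dir_deriv[OF f] p])
    have "deriv (\<lambda>s. newton_potential (x + s *\<^sub>R i)) = d1" using D1 by (intro ext DERIV_imp_deriv)
    moreover have "deriv (\<lambda>s. c * newton_potential (x + s *\<^sub>R i)) = (\<lambda>s. c * d1 s)"
      using DERIV_cmult[OF D1] by (intro ext DERIV_imp_deriv)
    ultimately show "deriv (deriv (\<lambda>s. c * newton_potential (x + s *\<^sub>R i))) 0 = c * deriv (deriv (\<lambda>s. newton_potential (x + s *\<^sub>R i))) 0"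
      using DERIV_imp_deriv[OF D2] DERIV_imp_deriv[OF DERIV_cmult[OF D2, of c]] by simp
  qed
  also have "laplacian newton_potential x = - (real (DIM('a) - 2) * sigma_area DIM('a) * f x)"
    using laplacian_newton_potential[OF f n3, of x] by (simp add: newton_potential_def[abs_def])
  finally show ?thesis by simp
qed

definition limit_const :: "nat \<Rightarrow> real" where
  "limit_const n = R / 2 ^ (n - 2) * (real (n - 2) * sigma_area n * beta_const (n - 1))"

lemma odd_backprojection:
  assumes "odd DIM('a)" "norm x < R"
  shows "(\<integral>\<xi>. H \<xi> (DIM('a) - 3) (norm (x - \<xi>)) \<partial>sphere_surface 0 R) =
    - (1 / pi) * (fact (DIM('a) - 3) * (2 / sigma_area DIM('a))) * (- 1) ^ ((DIM('a) - 1) div 2) *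
      limit_const DIM('a) * newton_potential x"
proof -
  define s :: real where "s = (- 1) ^ ((DIM('a) - 1) div 2)"
  obtain m where m: "DIM('a) = 2 * m + 1" using assms(1) by (auto elim: oddE)
  have s: "s = (- 1) ^ m" by (simp add: s_def m)
  have ss: "s * s = 1" unfolding s by (simp flip: power_add mult_2)
  have "(- \<i>) ^ (DIM('a) - 1) = of_real s"
    by (simp add: m s power_mult)
  \<comment> \<open>For odd n the power of -i is the sign s, so the unit is i s and the real part in
    \<open>V_limit\<close> picks out the imaginary part.\<close>
  then have Re: "Re (z / (\<i> * (- \<i>) ^ (DIM('a) - 1))) = s * Im z" for z
    using ss by (cases "even m") (auto simp: s Re_divide power2_eq_square)
  have "log_factor DIM('a) = fact (DIM('a) - 3) * (2 / sigma_area DIM('a))"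
    using assms(1) n3 by (simp add: log_factor_def)
  note lf = this
  have "(\<lambda>k. log_factor DIM('a) * s * (s * Im (\<integral>\<xi>. V x (inv_seq k) \<xi> \<partial>sphere_surface 0 R))) \<longlonglongrightarrow>
    log_factor DIM('a) * s * (limit_const DIM('a) * newton_potential x)"
    using V_limit[OF assms(2)] unfolding Re limit_const_def by (intro tendsto_mult_left)
  moreover have "log_factor DIM('a) * s * (s * w) = log_factor DIM('a) * w" for w
    using ss by (metis mult.assoc mult_1 mult.commute)
  ultimately have "(\<lambda>k. log_factor DIM('a) * Im (\<integral>\<xi>. V x (inv_seq k) \<xi> \<partial>sphere_surface 0 R)) \<longlonglongrightarrow>
    log_factor DIM('a) * s * (limit_const DIM('a) * newton_potential x)" by simp
  from LIMSEQ_unique[OF integral_Im_V_tendsto[OF assms(2)] this]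
  have "pi * (\<integral>\<xi>. H \<xi> (DIM('a) - 3) (norm (x - \<xi>)) \<partial>sphere_surface 0 R) = - (log_factor DIM('a) * s * (limit_const DIM('a) * newton_potential x))"
    by linarith
  then show ?thesis unfolding s_def[symmetric] lf[symmetric] by (simp add: field_simps)
qed

lemma even_backprojection:
  assumes "even DIM('a)" "norm x < R"
  shows "(\<integral>\<xi>. (\<integral>t. indicator {0<..<2 * R} t * (t * H \<xi> (DIM('a) - 2) t * ln \<bar>t\<^sup>2 - (norm (x - \<xi>))\<^sup>2\<bar>) \<partial>lborel) \<partial>sphere_surface 0 R) =
    1 / 2 * (- (fact (DIM('a) - 3) * (2 / sigma_area DIM('a)))) * (- 1) ^ (DIM('a) div 2 - 1) *
      limit_const DIM('a) * newton_potential x"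
proof -
  define s :: real where "s = (- 1) ^ (DIM('a) div 2 - 1)"
  define k where "k = DIM('a) div 2 - 1"
  have k: "DIM('a) - 1 = Suc (2 * k)" "DIM('a) = 2 * k + 2" using assms(1) n3 by (auto simp: k_def elim!: evenE)
  have s: "s = (- 1) ^ k" by (simp add: s_def k_def)
  have ss: "s * s = 1" unfolding s by (simp flip: power_add mult_2)
  \<comment> \<open>For even n the extra factor -i cancels i, so the unit is a real sign and the
    real part survives.\<close>
  have "\<i> * (- \<i>) ^ (DIM('a) - 1) = of_real s"
    unfolding k(1) by (simp add: s power_mult)
  then have Re: "Re (z / (\<i> * (- \<i>) ^ (DIM('a) - 1))) = s * Re z" for z
    using ss by (cases "even k") (auto simp: s)
  have lf: "log_factor DIM('a) = - (fact (DIM('a) - 3) * (2 / sigma_area DIM('a)))"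
    using assms(1) n3 by (simp add: log_factor_def)
  have "(\<lambda>k. log_factor DIM('a) * s * (s * Re (\<integral>\<xi>. V x (inv_seq k) \<xi> \<partial>sphere_surface 0 R))) \<longlonglongrightarrow>
    log_factor DIM('a) * s * (limit_const DIM('a) * newton_potential x)"
    using V_limit[OF assms(2)] unfolding Re limit_const_def by (intro tendsto_mult_left)
  moreover have "log_factor DIM('a) * s * (s * w) = log_factor DIM('a) * w" for w
    using ss by (metis mult.assoc mult_1 mult.commute)
  ultimately have "(\<lambda>k. log_factor DIM('a) * Re (\<integral>\<xi>. V x (inv_seq k) \<xi> \<partial>sphere_surface 0 R)) \<longlonglongrightarrow>
    log_factor DIM('a) * s * (limit_const DIM('a) * newton_potential x)" by simp
  from LIMSEQ_unique[OF integral_Re_V_tendsto[OF assms(2)] this]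
  show ?thesis unfolding s_def[symmetric] lf[symmetric] by simp
qed

lemma odd_inversion:
  assumes odd: "odd DIM('a)" and x: "norm x < R"
  shows "f x = ((-1) ^ ((DIM('a) - 1) div 2) * pi powr (1 - real DIM('a) / 2) / (4 * R * Gamma (real DIM('a) / 2))) *
    laplacian (\<lambda>y. \<integral>\<xi>. H \<xi> (DIM('a) - 3) (norm (y - \<xi>)) \<partial>sphere_surface 0 R) x"
proof -
  define s :: real where "s = (- 1) ^ ((DIM('a) - 1) div 2)"
  define c where "c = - (1 / pi) * (fact (DIM('a) - 3) * (2 / sigma_area DIM('a))) * s * limit_const DIM('a)"
  have "laplacian (\<lambda>y. \<integral>\<xi>. H \<xi> (DIM('a) - 3) (norm (y - \<xi>)) \<partial>sphere_surface 0 R) x = laplacian (\<lambda>y. c * newton_potential y) x"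
    by (rule laplacian_cong_open[of "ball 0 R"]) (use x odd_backprojection[OF odd] in \<open>auto simp: c_def s_def\<close>)
  also have "\<dots> = - (c * (real (DIM('a) - 2) * sigma_area DIM('a) * f x))" by (rule laplacian_newton_potential_cmult)
  finally have lap: "laplacian (\<lambda>y. \<integral>\<xi>. H \<xi> (DIM('a) - 3) (norm (y - \<xi>)) \<partial>sphere_surface 0 R) x =
    - (c * (real (DIM('a) - 2) * sigma_area DIM('a) * f x))" .
  have ss: "s * s = 1" unfolding s_def by (simp flip: power_add mult_2)
  have PQ: "pi powr (real DIM('a) / 2) * pi powr (1 - real DIM('a) / 2) = pi" by (simp flip: powr_add)
  have pos: "R > 0" "Gamma (real DIM('a) / 2) > 0" using r by (auto intro!: Gamma_real_pos)
  \<comment> \<open>The constants are abstracted: F = (n-3)!, k = n - 2, S the sphere area, b the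
    beta value, T = 2^(n-2), G = Gamma(n/2), P and Q the complementary powers of \<pi>. The first
    premise is \<open>inversion_constant\<close>.\<close>
  have alg: "(s * Q / (4 * R * G)) * (- ((- (1 / pi) * (F * (2 / S)) * s * (R / T * (k * S * b))) * (k * S * fx))) = fx"
    if "F * (k * k) * S * b = 2 * T * P * G" "P * Q = pi" "G > 0" "S > 0" "T > 0" for F k S b T P G Q fx :: real
  proof -
    have "(s * Q / (4 * R * G)) * (- ((- (1 / pi) * (F * (2 / S)) * s * (R / T * (k * S * b))) * (k * S * fx)))
      = (s * s) * Q * (F * (k * k) * S * b) * fx / (2 * G * pi * T)"
      using that pos by (simp add: field_simps)
    also have "\<dots> = (P * Q) * fx / pi" unfolding that(1) ss using that(3,5) by (simp add: field_simps)
    also have "\<dots> = fx" unfolding that(2) by simp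
    finally show ?thesis .
  qed
  show ?thesis
    unfolding lap c_def limit_const_def s_def[symmetric]
    by (rule alg[OF inversion_constant[OF n3] PQ pos(2) sigma_pos, symmetric]) simp
qed

lemma even_inversion:
  assumes even: "even DIM('a)" and x: "norm x < R"
  shows "f x = ((-1) ^ (DIM('a) div 2 - 1) * pi powr (- real DIM('a) / 2) / (2 * R * fact (DIM('a) div 2 - 1))) *
    laplacian (\<lambda>y. \<integral>\<xi>. (\<integral>t. indicator {0<..<2 * R} t * (t * H \<xi> (DIM('a) - 2) t * ln \<bar>t\<^sup>2 - (norm (y - \<xi>))\<^sup>2\<bar>) \<partial>lborel) \<partial>sphere_surface 0 R) x"
    (is "_ = _ * laplacian ?I x")
proof -
  define s :: real where "s = (- 1) ^ (DIM('a) div 2 - 1)"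
  define c where "c = 1 / 2 * (- (fact (DIM('a) - 3) * (2 / sigma_area DIM('a)))) * s * limit_const DIM('a)"
  have "laplacian ?I x = laplacian (\<lambda>y. c * newton_potential y) x"
    by (rule laplacian_cong_open[of "ball 0 R"]) (use x even_backprojection[OF even] in \<open>auto simp: c_def s_def\<close>)
  also have "\<dots> = - (c * (real (DIM('a) - 2) * sigma_area DIM('a) * f x))" by (rule laplacian_newton_potential_cmult)
  finally have lap: "laplacian ?I x = - (c * (real (DIM('a) - 2) * sigma_area DIM('a) * f x))" .
  have ss: "s * s = 1" unfolding s_def by (simp flip: power_add mult_2)
  have PQ: "pi powr (real DIM('a) / 2) * pi powr (- real DIM('a) / 2) = 1" by (simp flip: powr_add)
  have pos: "R > 0" "Gamma (real DIM('a) / 2) > 0" using r by (auto intro!: Gamma_real_pos)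
  \<comment> \<open>For even n the Gamma value is a factorial, which lets the even case use the same
    constant identity as the odd one.\<close>
  have G: "fact (DIM('a) div 2 - 1) = Gamma (real DIM('a) / 2)"
  proof -
    obtain m where m: "DIM('a) = 2 * m" using even by (auto elim: evenE)
    from m n3 obtain k where k: "m = Suc k" by (cases m) auto
    have e: "real DIM('a) / 2 = 1 + real k" "DIM('a) div 2 - 1 = k" by (auto simp: m k)
    show ?thesis unfolding e by (rule Gamma_fact[symmetric])
  qed
  have alg: "(s * Q / (2 * R * G)) * (- ((1 / 2 * (- (F * (2 / S))) * s * (R / T * (k * S * b))) * (k * S * fx))) = fx"
    if "F * (k * k) * S * b = 2 * T * P * G" "P * Q = 1" "G > 0" "S > 0" "T > 0" for F k S b T P G Q fx :: real
  proof -
    have "(s * Q / (2 * R * G)) * (- ((1 / 2 * (- (F * (2 / S))) * s * (R / T * (k * S * b))) * (k * S * fx)))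
      = (s * s) * Q * (F * (k * k) * S * b) * fx / (2 * G * T)"
      using that pos by (simp add: field_simps)
    also have "\<dots> = (P * Q) * fx" unfolding that(1) ss using that(3,5) by (simp add: field_simps)
    also have "\<dots> = fx" unfolding that(2) by simp
    finally show ?thesis .
  qed
  show ?thesis
    unfolding lap c_def limit_const_def s_def[symmetric] G
    by (rule alg[OF inversion_constant[OF n3] PQ pos(2) sigma_pos, symmetric]) simp
qed

end

text \<open>The topological support is compact, so the norm attains its maximum on it, and this
  maximum is below R. The resulting gap between r and R is what the whole argument runs on.\<close>

lemma support_in_smaller_ball:
  fixes f :: "'a::euclidean_space \<Rightarrow> real"
  assumes "tsupp f \<subseteq> ball 0 R" "R > 0"
  obtains r where "0 \<le> r" "r < R" "\<And>x. norm x > r \<Longrightarrow> f x = 0"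
proof (cases "tsupp f = {}")
  case True
  then have "f x = 0" for x using closure_subset[of "{x. f x \<noteq> 0}"] by (auto simp: tsupp_def)
  then show thesis using that[of 0] assms by simp
next
  case False
  have "compact (tsupp f)"
    using assms(1) bounded_subset[OF bounded_ball] by (auto simp: compact_eq_bounded_closed tsupp_def)
  then obtain z where z: "z \<in> tsupp f" "\<And>y. y \<in> tsupp f \<Longrightarrow> norm y \<le> norm z"
    using continuous_attains_sup[OF _ False, of norm] by (auto intro: continuous_on_norm_id)
  have "f x = 0" if "norm x > norm z" for x
    using z(2)[of x] that closure_subset[of "{x. f x \<noteq> 0}"] by (force simp: tsupp_def)
  then show thesis using that[of "norm z"] z(1) assms(1) by (auto simp: subset_iff)
qed

theorem theorem3p4:
  fixes f :: "'a::euclidean_space \<Rightarrow> real" and R :: real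
  assumes n3: "DIM('a) \<ge> 3"
    and R: "R > 0"
    and smooth: "C_infinity f"
    and supp: "tsupp f \<subseteq> ball 0 R"
  shows "\<forall>x \<in> ball 0 R.
     (odd DIM('a) \<longrightarrow>
        f x = ((-1) ^ ((DIM('a) - 1) div 2) * pi powr (1 - real DIM('a) / 2)
                 / (4 * R * Gamma (real DIM('a) / 2)))
              * laplacian (\<lambda>y. \<integral>\<xi>. (Dop ^^ (DIM('a) - 3))
                    (\<lambda>t. t ^ (DIM('a) - 2) * sph_mean f \<xi> t) (norm (y - \<xi>))
                  \<partial>sphere_surface 0 R) x)
   \<and> (even DIM('a) \<longrightarrow>
        f x = ((-1) ^ (DIM('a) div 2 - 1) * pi powr (- real DIM('a) / 2)
                 / (2 * R * fact (DIM('a) div 2 - 1)))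
              * laplacian (\<lambda>y. \<integral>\<xi>.
                   (LINT t : {0<..<2 * R} | lborel.
                      t * (Dop ^^ (DIM('a) - 2)) (\<lambda>s. s ^ (DIM('a) - 2) * sph_mean f \<xi> s) t
                        * ln \<bar>t\<^sup>2 - (norm (y - \<xi>))\<^sup>2\<bar>)
                  \<partial>sphere_surface 0 R) x)"
proof -
  obtain r where r: "0 \<le> r" "r < R" "\<And>x. norm x > r \<Longrightarrow> f x = 0"
    using support_in_smaller_ball[OF supp R] by blast
  then interpret spherical_inversion f R r
    using n3 smooth by unfold_locales (auto simp: test_function_def)
  show ?thesis
    using odd_inversion even_inversion
    unfolding H_def set_lebesgue_integral_def real_scaleR_def by simp
qed

end
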